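(* Let $(-)^*$ be a monoidal associative contravariant pseudo functor from a category $\mathcal B$ to (suspended, triangulated) symmetric monoidal closed categories. Let $\mathcal B'$ be the subcategory of $\mathcal B$ with the same objects whose morphisms are those $f$ for which $f^*$ has a right adjoint $f_*$ and $f_*$ has a right adjoint $f^!$; fix such adjoints. For morphisms $f:X\to Y$ and $g:Y\to Z$ in $\mathcal B'$ and $K$ an object of $\mathcal C_Z$, the isomorphism of functors $b_{g,f}:(gf)_*\to g_*f_*$ is a morphism of duality preserving functors from $$\{(gf)_*,\zeta_K\}\,I_{c_{g,f,K}}\quad\text{to}\quad\{g_*,\zeta_K\}\{f_*,\zeta_{g^!K}\}$$ (both from $(\mathcal C_X,D_{f^!g^!K},\varpi_{f^!g^!K})$ to $(\mathcal C_Z,D_K,\varpi_K)$).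
   Context: Closed categories. A symmetric monoidal closed category $(\mathcal C,\otimes)$ (with symmetry $s$) has an internal Hom $[-,-]$ with adjunctions $(-\otimes X)\dashv[X,-]$ natural in $X$, with counit $\mathrm{ev}^l_{X,A}:[X,A]\otimes X\to A$ and unit $\mathrm{coev}^l_{X,A}:A\to[X,A\otimes X]$. Put $\mathrm{ev}^r_{A,K}=\mathrm{ev}^l_{A,K}\circ s$. Dualities. For an object $K$, $D_K=[-,K]:\mathcal C\to\mathcal C^o$, with opposite functor $D_K^o$, and $\varpi_K:\mathrm{Id}\to D_K^oD_K$ has component $\varpi_{K,A}:A\to[[A,K],K]$ corresponding to $\mathrm{ev}^r_{A,K}:A\otimes[A,K]\to K$ under $(-\otimes[A,K])\dashv[[A,K],-]$. A duality preserving functor $\{F,\phi\}:(\mathcal C_1,D_1,\varpi_1)\to(\mathcal C_2,D_2,\varpi_2)$ is a functor $F$ and a natural transformation $\phi:FD_1^o\to D_2^oF^o$ (components $\phi_A:FD_1A\to D_2FA$) with $\phi_{D_1A}\circ F(\varpi_{1,A})=D_2(\phi_A)\circ\varpi_{2,FA}$ for all $A$. Composition: $\{F',\phi'\}\{F,\phi\}=\{F'F,\phi'F^o\circ F'\phi\}$. A morphism $\{F,\phi\}\to\{F',\phi'\}$ is a natural transformation $\rho:F\to F'$ with $\phi_A=D_2(\rho_A)\circ\phi'_A\circ\rho_{D_1A}$ for all $A$ (in the suspended/triangulated setting, $\rho$ is moreover required to be a morphism of suspended functors). A morphism $\iota:K\to M$ induces the duality preserving functor $I_\iota=\{\mathrm{Id},\tilde\iota\}:(\mathcal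 C,D_K,\varpi_K)\to(\mathcal C,D_M,\varpi_M)$, where $\tilde\iota:[-,K]\to[-,M]$ is composition with $\iota$. Pseudo functors. A contravariant pseudo functor $(-)^*$ on $\mathcal B$ assigns to each object $X$ a (suspended, triangulated) symmetric monoidal closed category $\mathcal C_X$, to each $f:X\to Y$ a (suspended, exact) functor $f^*:\mathcal C_Y\to\mathcal C_X$, with identities sent to identities, together with isomorphisms of (suspended) functors $a_{g,f}:f^*g^*\to(gf)^*$. It is associative if the two isomorphisms $f^*g^*h^*\to(hgf)^*$ built from $a$ agree. It is monoidal if each $f^*$ is symmetric monoidal, i.e. equipped with a natural isomorphism $\alpha^f_{A,B}:f^*A\otimes f^*B\to f^*(A\otimes B)$ compatible with associativity and symmetry (and units, when considered), and $a_{g,f,A\otimes B}\circ f^*(\alpha^{g}_{A,B})\circ\alpha^{f}_{g^*A,g^*B}=\alpha^{gf}_{A,B}\circ(a_{g,f,A}\otimes a_{g,f,B})$. Push-forward. For $f$ in $\mathcal B'$ let $\eta^*_*,\epsilon^*_*$ be unit and counit of $f^*\dashv f_*$ and $\epsilon^!_*:f_*f^!\to\mathrm{Id}$ the counit of $f_*\dashv f^!$. Let $\lambda_{A,B}$: $f_*A\otimes f_*B\xrightarrow{\eta^*_*}f_*f^*(f_*A\otimes f_*B)\xrightarrow{\alpha^{-1}}f_*(f^*f_*A\otimes f^*f_*B)\xrightarrow{\epsilon^*_*\otimes\epsilon^*_*}f_*(A\otimes B)$, let $\mu_{A,B}$: $f_*[A,B]\xrightarrow{\mathrm{coev}^l}[f_*A,f_*[A,B]\otimes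 f_*A]\xrightarrow{\lambda}[f_*A,f_*([A,B]\otimes A)]\xrightarrow{\mathrm{ev}^l}[f_*A,f_*B]$, and let $\zeta_{A,K}$: $f_*[A,f^!K]\xrightarrow{\mu}[f_*A,f_*f^!K]\xrightarrow{\epsilon^!_*}[f_*A,K]$. Then $\{f_*,\zeta_K\}:(\mathcal C_X,D_{f^!K},\varpi_{f^!K})\to(\mathcal C_Y,D_K,\varpi_K)$ is a duality preserving functor for $f:X\to Y$. The isomorphisms $b$ and $c$. The adjoints are chosen with $(\mathrm{Id}_X)_*=\mathrm{Id}_X^!=\mathrm{Id}_{\mathcal C_X}$. $b_{g,f}:(gf)_*\to g_*f_*$ is the isomorphism conjugate to $a_{g,f}$: it induces $\mathrm{Hom}(A,(gf)_*B)\simeq\mathrm{Hom}((gf)^*A,B)\xrightarrow{-\circ a_{g,f,A}}\mathrm{Hom}(f^*g^*A,B)\simeq\mathrm{Hom}(A,g_*f_*B)$. $c_{g,f}:f^!g^!\to(gf)^!$ is the isomorphism conjugate to $b_{g,f}$: it induces $\mathrm{Hom}(A,f^!g^!B)\simeq\mathrm{Hom}(g_*f_*A,B)\xrightarrow{-\circ b_{g,f,A}}\mathrm{Hom}((gf)_*A,B)\simeq\mathrm{Hom}(A,(gf)^!B)$. Suspended version: a suspended category is an additive category with a functor $T$ having a strict inverse; suspended functors carry isomorphisms $FT\simeq TF$, and morphisms of suspended functors commute with them. In a suspended symmetric monoidal closed category $\otimes$ carries natural isomorphisms $TA\otimes B\to T(A\otimes B)$, $A\otimes TB\to T(A\otimes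 B)$ such that the two composites $TA\otimes TB\to T^2(A\otimes B)$ differ by the sign $-1$, compatible with associativity and symmetry; $f^*$ is suspended and $\alpha$ commutes with these isomorphisms; $f_*$, $f^!$ carry the unique suspended structures for which units and counits of the adjunctions are morphisms of suspended functors. In the triangulated version $f^*$, $\otimes$ (in both variables) and $[-,-]$ (in the first variable) are moreover exact. *)

theory Defs
  imports "HOL-Algebra.Group"
begin

section \<open>Categories, functors, natural transformations, adjunctions\<close>

record ('o, 'm) cat =
  Obj :: "'o set"
  Arr :: "'m set"
  Dom :: "'m \<Rightarrow> 'o"
  Cod :: "'m \<Rightarrow> 'o"
  Ident :: "'o \<Rightarrow> 'm"
  cmp :: "'m \<Rightarrow> 'm \<Rightarrow> 'm"  (infixr "\<cdot>\<index>" 70)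

definition homs :: "('o, 'm) cat \<Rightarrow> 'o \<Rightarrow> 'o \<Rightarrow> 'm set" where
  "homs C A B = {f \<in> Arr C. Dom C f = A \<and> Cod C f = B}"

definition category :: "('o, 'm) cat \<Rightarrow> bool" where
  "category C \<longleftrightarrow>
     (\<forall>f\<in>Arr C. Dom C f \<in> Obj C \<and> Cod C f \<in> Obj C) \<and>
     (\<forall>A\<in>Obj C. Ident C A \<in> homs C A A) \<and>
     (\<forall>A A' A'' f g. f \<in> homs C A A' \<longrightarrow> g \<in> homs C A' A'' \<longrightarrow> g \<cdot>\<^bsub>C\<^esub> f \<in> homs C A A'') \<and>
     (\<forall>A B f. f \<in> homs C A B \<longrightarrow> f \<cdot>\<^bsub>C\<^esub> Ident C A = f \<and> Ident C B \<cdot>\<^bsub>C\<^esub> f = f) \<and>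
     (\<forall>A A' A'' A''' f g h. f \<in> homs C A A' \<longrightarrow> g \<in> homs C A' A'' \<longrightarrow> h \<in> homs C A'' A''' \<longrightarrow>
        (h \<cdot>\<^bsub>C\<^esub> g) \<cdot>\<^bsub>C\<^esub> f = h \<cdot>\<^bsub>C\<^esub> (g \<cdot>\<^bsub>C\<^esub> f))"

definition op_cat :: "('o, 'm) cat \<Rightarrow> ('o, 'm) cat" where
  "op_cat C = \<lparr>Obj = Obj C, Arr = Arr C, Dom = Cod C, Cod = Dom C, Ident = Ident C,
               cmp = (\<lambda>g f. f \<cdot>\<^bsub>C\<^esub> g)\<rparr>"

definition prod_cat :: "('o, 'm) cat \<Rightarrow> ('p, 'n) cat \<Rightarrow> ('o \<times> 'p, 'm \<times> 'n) cat" where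
  "prod_cat C D = \<lparr>Obj = Obj C \<times> Obj D, Arr = Arr C \<times> Arr D,
     Dom = (\<lambda>(f, g). (Dom C f, Dom D g)), Cod = (\<lambda>(f, g). (Cod C f, Cod D g)),
     Ident = (\<lambda>(A, B). (Ident C A, Ident D B)),
     cmp = (\<lambda>(f', g') (f, g). (f' \<cdot>\<^bsub>C\<^esub> f, g' \<cdot>\<^bsub>D\<^esub> g))\<rparr>"

definition inverse_arrows :: "('o, 'm) cat \<Rightarrow> 'm \<Rightarrow> 'm \<Rightarrow> bool" where
  "inverse_arrows C f g \<longleftrightarrow> f \<in> Arr C \<and> g \<in> homs C (Cod C f) (Dom C f) \<and>
     g \<cdot>\<^bsub>C\<^esub> f = Ident C (Dom C f) \<and> f \<cdot>\<^bsub>C\<^esub> g = Ident C (Cod C f)"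

definition iso_arrow :: "('o, 'm) cat \<Rightarrow> 'm \<Rightarrow> bool" where
  "iso_arrow C f \<longleftrightarrow> (\<exists>g. inverse_arrows C f g)"

definition inv_arrow :: "('o, 'm) cat \<Rightarrow> 'm \<Rightarrow> 'm" where
  "inv_arrow C f = (THE g. inverse_arrows C f g)"

text \<open>The opposite \<open>F\<^sup>o\<close> of a functor \<open>F\<close> from \<open>C\<close> to \<open>D\<close> has the same underlying maps as \<open>F\<close>; it is
  therefore the same record, regarded as a functor from \<^term>\<open>op_cat C\<close> to \<^term>\<open>op_cat D\<close>.\<close>

record ('o, 'm, 'p, 'n) func =
  fob :: "'o \<Rightarrow> 'p"
  far :: "'m \<Rightarrow> 'n"

definition is_functor :: "('o, 'm) cat \<Rightarrow> ('p, 'n) cat \<Rightarrow> ('o, 'm, 'p, 'n) func \<Rightarrow> bool" where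
  "is_functor C D F \<longleftrightarrow> category C \<and> category D \<and>
     (\<forall>A\<in>Obj C. fob F A \<in> Obj D \<and> far F (Ident C A) = Ident D (fob F A)) \<and>
     (\<forall>A B f. f \<in> homs C A B \<longrightarrow> far F f \<in> homs D (fob F A) (fob F B)) \<and>
     (\<forall>A A' A'' f g. f \<in> homs C A A' \<longrightarrow> g \<in> homs C A' A'' \<longrightarrow>
        far F (g \<cdot>\<^bsub>C\<^esub> f) = far F g \<cdot>\<^bsub>D\<^esub> far F f)"

definition id_fun :: "('o, 'm, 'o, 'm) func" where
  "id_fun = \<lparr>fob = (\<lambda>A. A), far = (\<lambda>f. f)\<rparr>"

definition comp_fun ::
  "('p, 'n, 'q, 'k) func \<Rightarrow> ('o, 'm, 'p, 'n) func \<Rightarrow> ('o, 'm, 'q, 'k) func"  (infixr "\<circ>\<^sub>F" 75) where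
  "G \<circ>\<^sub>F F = \<lparr>fob = (\<lambda>A. fob G (fob F A)), far = (\<lambda>f. far G (far F f))\<rparr>"

definition prod_fun ::
  "('o, 'm, 'p, 'n) func \<Rightarrow> ('o', 'm', 'p', 'n') func \<Rightarrow> ('o \<times> 'o', 'm \<times> 'm', 'p \<times> 'p', 'n \<times> 'n') func"
  (infixr "\<times>\<^sub>F" 80) where
  "F \<times>\<^sub>F G = \<lparr>fob = (\<lambda>(A, B). (fob F A, fob G B)), far = (\<lambda>(f, g). (far F f, far G g))\<rparr>"

text \<open>Equality of functors out of \<open>C\<close>: values outside \<open>C\<close> are irrelevant.\<close>

definition func_eq :: "('o, 'm) cat \<Rightarrow> ('o, 'm, 'p, 'n) func \<Rightarrow> ('o, 'm, 'p, 'n) func \<Rightarrow> bool" where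
  "func_eq C F G \<longleftrightarrow> (\<forall>A\<in>Obj C. fob F A = fob G A) \<and> (\<forall>f\<in>Arr C. far F f = far G f)"

definition nat_trans :: "('o, 'm) cat \<Rightarrow> ('p, 'n) cat \<Rightarrow> ('o, 'm, 'p, 'n) func \<Rightarrow>
    ('o, 'm, 'p, 'n) func \<Rightarrow> ('o \<Rightarrow> 'n) \<Rightarrow> bool" where
  "nat_trans C D F G \<tau> \<longleftrightarrow> is_functor C D F \<and> is_functor C D G \<and>
     (\<forall>A\<in>Obj C. \<tau> A \<in> homs D (fob F A) (fob G A)) \<and>
     (\<forall>A B f. f \<in> homs C A B \<longrightarrow> \<tau> B \<cdot>\<^bsub>D\<^esub> far F f = far G f \<cdot>\<^bsub>D\<^esub> \<tau> A)"

definition nat_iso :: "('o, 'm) cat \<Rightarrow> ('p, 'n) cat \<Rightarrow> ('o, 'm, 'p, 'n) func \<Rightarrow>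
    ('o, 'm, 'p, 'n) func \<Rightarrow> ('o \<Rightarrow> 'n) \<Rightarrow> bool" where
  "nat_iso C D F G \<tau> \<longleftrightarrow> nat_trans C D F G \<tau> \<and> (\<forall>A\<in>Obj C. iso_arrow D (\<tau> A))"

text \<open>\<open>F \<stileturn> G\<close> with unit \<open>\<eta>\<close> and counit \<open>\<epsilon>\<close>.\<close>

definition adjunction :: "('o, 'm) cat \<Rightarrow> ('p, 'n) cat \<Rightarrow> ('o, 'm, 'p, 'n) func \<Rightarrow>
    ('p, 'n, 'o, 'm) func \<Rightarrow> ('o \<Rightarrow> 'm) \<Rightarrow> ('p \<Rightarrow> 'n) \<Rightarrow> bool" where
  "adjunction C D F G \<eta> \<epsilon> \<longleftrightarrow> is_functor C D F \<and> is_functor D C G \<and>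
     nat_trans C C id_fun (G \<circ>\<^sub>F F) \<eta> \<and> nat_trans D D (F \<circ>\<^sub>F G) id_fun \<epsilon> \<and>
     (\<forall>A\<in>Obj C. \<epsilon> (fob F A) \<cdot>\<^bsub>D\<^esub> far F (\<eta> A) = Ident D (fob F A)) \<and>
     (\<forall>B\<in>Obj D. far G (\<epsilon> B) \<cdot>\<^bsub>C\<^esub> \<eta> (fob G B) = Ident C (fob G B))"

section \<open>Symmetric monoidal closed categories\<close>

text \<open>The unit object and its constraints are optional: \<open>munit\<close> is either \<open>None\<close> or
  \<open>Some (I, \<lambda>, \<rho>)\<close> with \<open>\<lambda>\<^sub>A : I \<otimes> A \<rightarrow> A\<close> and \<open>\<rho>\<^sub>A : A \<otimes> I \<rightarrow> A\<close>.
  \<open>coev X A : A \<rightarrow> [X, A \<otimes> X]\<close> and \<open>ev X A : [X, A] \<otimes> X \<rightarrow> A\<close>.\<close>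

record ('o, 'm) smc =
  tens :: "('o \<times> 'o, 'm \<times> 'm, 'o, 'm) func"
  assc :: "'o \<times> 'o \<times> 'o \<Rightarrow> 'm"
  symm :: "'o \<times> 'o \<Rightarrow> 'm"
  munit :: "('o \<times> ('o \<Rightarrow> 'm) \<times> ('o \<Rightarrow> 'm)) option"
  ihom :: "('o \<times> 'o, 'm \<times> 'm, 'o, 'm) func"
  coev :: "'o \<Rightarrow> 'o \<Rightarrow> 'm"
  ev :: "'o \<Rightarrow> 'o \<Rightarrow> 'm"

abbreviation tob :: "('o, 'm) smc \<Rightarrow> 'o \<Rightarrow> 'o \<Rightarrow> 'o"  ("(_ \<odot>\<index>/ _)" [76, 75] 75) where
  "A \<odot>\<^bsub>M\<^esub> B \<equiv> fob (tens M) (A, B)"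

abbreviation tar :: "('o, 'm) smc \<Rightarrow> 'm \<Rightarrow> 'm \<Rightarrow> 'm"  ("(_ \<star>\<index>/ _)" [76, 75] 75) where
  "f \<star>\<^bsub>M\<^esub> g \<equiv> far (tens M) (f, g)"

abbreviation hob :: "('o, 'm) smc \<Rightarrow> 'o \<Rightarrow> 'o \<Rightarrow> 'o" where
  "hob M A B \<equiv> fob (ihom M) (A, B)"

abbreviation har :: "('o, 'm) smc \<Rightarrow> 'm \<Rightarrow> 'm \<Rightarrow> 'm" where
  "har M f g \<equiv> far (ihom M) (f, g)"

definition tens_right :: "('o, 'm) cat \<Rightarrow> ('o, 'm) smc \<Rightarrow> 'o \<Rightarrow> ('o, 'm, 'o, 'm) func" where
  "tens_right C M X = \<lparr>fob = (\<lambda>A. A \<odot>\<^bsub>M\<^esub> X), far = (\<lambda>f. f \<star>\<^bsub>M\<^esub> Ident C X)\<rparr>"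

definition tens_left :: "('o, 'm) cat \<Rightarrow> ('o, 'm) smc \<Rightarrow> 'o \<Rightarrow> ('o, 'm, 'o, 'm) func" where
  "tens_left C M X = \<lparr>fob = (\<lambda>A. X \<odot>\<^bsub>M\<^esub> A), far = (\<lambda>f. Ident C X \<star>\<^bsub>M\<^esub> f)\<rparr>"

definition ihom_from :: "('o, 'm) cat \<Rightarrow> ('o, 'm) smc \<Rightarrow> 'o \<Rightarrow> ('o, 'm, 'o, 'm) func" where
  "ihom_from C M X = \<lparr>fob = (\<lambda>A. hob M X A), far = (\<lambda>f. har M (Ident C X) f)\<rparr>"

text \<open>The contravariant functor \<open>D\<^sub>K = [-, K]\<close>.\<close>

definition dual_fun :: "('o, 'm) cat \<Rightarrow> ('o, 'm) smc \<Rightarrow> 'o \<Rightarrow> ('o, 'm, 'o, 'm) func" where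
  "dual_fun C M K = \<lparr>fob = (\<lambda>A. hob M A K), far = (\<lambda>f. har M f (Ident C K))\<rparr>"

text \<open>The bijection \<open>Hom (A \<otimes> X, B) \<rightarrow> Hom (A, [X, B])\<close>.\<close>

definition curry_ar :: "('o, 'm) cat \<Rightarrow> ('o, 'm) smc \<Rightarrow> 'o \<Rightarrow> 'o \<Rightarrow> 'm \<Rightarrow> 'm" where
  "curry_ar C M A X h = har M (Ident C X) h \<cdot>\<^bsub>C\<^esub> coev M X A"

definition symmetric_monoidal :: "('o, 'm) cat \<Rightarrow> ('o, 'm) smc \<Rightarrow> bool" where
  "symmetric_monoidal C M \<longleftrightarrow>
     is_functor (prod_cat C C) C (tens M) \<and>
     nat_iso (prod_cat C (prod_cat C C)) C
       \<lparr>fob = (\<lambda>(A, B, E). (A \<odot>\<^bsub>M\<^esub> B) \<odot>\<^bsub>M\<^esub> E), far = (\<lambda>(f, g, h). (f \<star>\<^bsub>M\<^esub> g) \<star>\<^bsub>M\<^esub> h)\<rparr>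
       \<lparr>fob = (\<lambda>(A, B, E). A \<odot>\<^bsub>M\<^esub> (B \<odot>\<^bsub>M\<^esub> E)), far = (\<lambda>(f, g, h). f \<star>\<^bsub>M\<^esub> (g \<star>\<^bsub>M\<^esub> h))\<rparr>
       (assc M) \<and>
     (\<forall>A\<in>Obj C. \<forall>B\<in>Obj C. \<forall>E\<in>Obj C. \<forall>G\<in>Obj C.
        assc M (A, B, E \<odot>\<^bsub>M\<^esub> G) \<cdot>\<^bsub>C\<^esub> assc M (A \<odot>\<^bsub>M\<^esub> B, E, G)
        = (Ident C A \<star>\<^bsub>M\<^esub> assc M (B, E, G)) \<cdot>\<^bsub>C\<^esub> assc M (A, B \<odot>\<^bsub>M\<^esub> E, G)
          \<cdot>\<^bsub>C\<^esub> (assc M (A, B, E) \<star>\<^bsub>M\<^esub> Ident C G)) \<and>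
     nat_iso (prod_cat C C) C (tens M)
       \<lparr>fob = (\<lambda>(A, B). B \<odot>\<^bsub>M\<^esub> A), far = (\<lambda>(f, g). g \<star>\<^bsub>M\<^esub> f)\<rparr> (symm M) \<and>
     (\<forall>A\<in>Obj C. \<forall>B\<in>Obj C. symm M (B, A) \<cdot>\<^bsub>C\<^esub> symm M (A, B) = Ident C (A \<odot>\<^bsub>M\<^esub> B)) \<and>
     (\<forall>A\<in>Obj C. \<forall>B\<in>Obj C. \<forall>E\<in>Obj C.
        assc M (B, E, A) \<cdot>\<^bsub>C\<^esub> symm M (A, B \<odot>\<^bsub>M\<^esub> E) \<cdot>\<^bsub>C\<^esub> assc M (A, B, E)
        = (Ident C B \<star>\<^bsub>M\<^esub> symm M (A, E)) \<cdot>\<^bsub>C\<^esub> assc M (B, A, E)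
          \<cdot>\<^bsub>C\<^esub> (symm M (A, B) \<star>\<^bsub>M\<^esub> Ident C E)) \<and>
     (\<forall>I l r. munit M = Some (I, l, r) \<longrightarrow>
        I \<in> Obj C \<and> nat_iso C C (tens_left C M I) id_fun l \<and> nat_iso C C (tens_right C M I) id_fun r \<and>
        (\<forall>A\<in>Obj C. \<forall>B\<in>Obj C.
           (Ident C A \<star>\<^bsub>M\<^esub> l B) \<cdot>\<^bsub>C\<^esub> assc M (A, I, B) = r A \<star>\<^bsub>M\<^esub> Ident C B) \<and>
        (\<forall>A\<in>Obj C. l A \<cdot>\<^bsub>C\<^esub> symm M (A, I) = r A))"

definition symmetric_monoidal_closed :: "('o, 'm) cat \<Rightarrow> ('o, 'm) smc \<Rightarrow> bool" where
  "symmetric_monoidal_closed C M \<longleftrightarrow> symmetric_monoidal C M \<and>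
     is_functor (prod_cat (op_cat C) C) C (ihom M) \<and>
     (\<forall>X\<in>Obj C. adjunction C C (tens_right C M X) (ihom_from C M X) (coev M X) (ev M X)) \<and>
     (\<forall>A\<in>Obj C. \<forall>X X' B x h. x \<in> homs C X' X \<longrightarrow> h \<in> homs C (A \<odot>\<^bsub>M\<^esub> X) B \<longrightarrow>
        curry_ar C M A X' (h \<cdot>\<^bsub>C\<^esub> (Ident C A \<star>\<^bsub>M\<^esub> x)) = har M x (Ident C B) \<cdot>\<^bsub>C\<^esub> curry_ar C M A X h)"

text \<open>\<open>ev\<^sup>r\<close> in the variables \<open>A, K\<close>, from \<open>A \<otimes> [A, K]\<close> to \<open>K\<close>.\<close>

definition ev_r :: "('o, 'm) cat \<Rightarrow> ('o, 'm) smc \<Rightarrow> 'o \<Rightarrow> 'o \<Rightarrow> 'm" where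
  "ev_r C M A K = ev M A K \<cdot>\<^bsub>C\<^esub> symm M (A, hob M A K)"

definition varpi :: "('o, 'm) cat \<Rightarrow> ('o, 'm) smc \<Rightarrow> 'o \<Rightarrow> 'o \<Rightarrow> 'm" where
  "varpi C M K A = curry_ar C M A (hob M A K) (ev_r C M A K)"

section \<open>Dualities\<close>

record ('o, 'm) catdual =
  ucat :: "('o, 'm) cat"
  dual :: "('o, 'm, 'o, 'm) func"
  bidual :: "'o \<Rightarrow> 'm"

text \<open>The functor \<open>D\<close> from \<open>C\<close> to \<open>C\<^sup>o\<close> is adjoint to its opposite with \<open>\<varpi>\<close> as both unit and counit,
  so the two triangle identities coincide.\<close>

definition category_with_duality :: "('o, 'm) catdual \<Rightarrow> bool" where
  "category_with_duality W \<longleftrightarrow>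
     is_functor (ucat W) (op_cat (ucat W)) (dual W) \<and>
     nat_trans (ucat W) (ucat W) id_fun (dual W \<circ>\<^sub>F dual W) (bidual W) \<and>
     (\<forall>A\<in>Obj (ucat W).
        far (dual W) (bidual W A) \<cdot>\<^bsub>ucat W\<^esub> bidual W (fob (dual W) A) = Ident (ucat W) (fob (dual W) A))"

record ('o, 'm, 'p, 'n) dualpair =
  dfun :: "('o, 'm, 'p, 'n) func"
  dphi :: "'o \<Rightarrow> 'n"

definition duality_preserving ::
  "('o, 'm) catdual \<Rightarrow> ('p, 'n) catdual \<Rightarrow> ('o, 'm, 'p, 'n) dualpair \<Rightarrow> bool" where
  "duality_preserving W1 W2 P \<longleftrightarrow>
     category_with_duality W1 \<and> category_with_duality W2 \<and>
     is_functor (ucat W1) (ucat W2) (dfun P) \<and>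
     nat_trans (op_cat (ucat W1)) (ucat W2) (dfun P \<circ>\<^sub>F dual W1) (dual W2 \<circ>\<^sub>F dfun P) (dphi P) \<and>
     (\<forall>A\<in>Obj (ucat W1).
        dphi P (fob (dual W1) A) \<cdot>\<^bsub>ucat W2\<^esub> far (dfun P) (bidual W1 A)
        = far (dual W2) (dphi P A) \<cdot>\<^bsub>ucat W2\<^esub> bidual W2 (fob (dfun P) A))"

text \<open>The composite of \<open>P'\<close> after \<open>P\<close>, where \<open>E\<close> is the target category of \<open>P'\<close>.\<close>

definition dualpair_comp :: "('q, 'k) cat \<Rightarrow> ('p, 'n, 'q, 'k) dualpair \<Rightarrow> ('o, 'm, 'p, 'n) dualpair \<Rightarrow>
    ('o, 'm, 'q, 'k) dualpair" where
  "dualpair_comp E P' P = \<lparr>dfun = dfun P' \<circ>\<^sub>F dfun P,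
     dphi = (\<lambda>A. dphi P' (fob (dfun P) A) \<cdot>\<^bsub>E\<^esub> far (dfun P') (dphi P A))\<rparr>"

definition duality_morphism :: "('o, 'm) catdual \<Rightarrow> ('p, 'n) catdual \<Rightarrow>
    ('o, 'm, 'p, 'n) dualpair \<Rightarrow> ('o, 'm, 'p, 'n) dualpair \<Rightarrow> ('o \<Rightarrow> 'n) \<Rightarrow> bool" where
  "duality_morphism W1 W2 P P' \<rho> \<longleftrightarrow>
     duality_preserving W1 W2 P \<and> duality_preserving W1 W2 P' \<and>
     nat_trans (ucat W1) (ucat W2) (dfun P) (dfun P') \<rho> \<and>
     (\<forall>A\<in>Obj (ucat W1).
        dphi P A = far (dual W2) (\<rho> A) \<cdot>\<^bsub>ucat W2\<^esub> dphi P' A \<cdot>\<^bsub>ucat W2\<^esub> \<rho> (fob (dual W1) A))"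

definition dual_at :: "('o, 'm) cat \<Rightarrow> ('o, 'm) smc \<Rightarrow> 'o \<Rightarrow> ('o, 'm) catdual" where
  "dual_at C M K = \<lparr>ucat = C, dual = dual_fun C M K, bidual = varpi C M K\<rparr>"

text \<open>The functor \<open>I\<^sub>\<iota>\<close> of an arrow \<open>\<iota>\<close>.\<close>

definition dual_change :: "('o, 'm) cat \<Rightarrow> ('o, 'm) smc \<Rightarrow> 'm \<Rightarrow> ('o, 'm, 'o, 'm) dualpair" where
  "dual_change C M \<iota> = \<lparr>dfun = id_fun, dphi = (\<lambda>A. har M (Ident C A) \<iota>)\<rparr>"

section \<open>Pseudo functors and push-forwards\<close>

text \<open>For \<open>f : X \<rightarrow> Y\<close> and \<open>g : Y \<rightarrow> Z\<close> in the base: \<open>pull f = f\<^sup>*\<close>,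
  \<open>pcomp g f = a\<^sub>g\<^sub>,\<^sub>f\<close>, \<open>pten f = \<alpha>\<^sup>f\<close>, and \<open>punit f\<close> is the unit constraint
  \<open>I \<rightarrow> f\<^sup>* I\<close>, which is meaningful only when units are present.  All fibres share their types
  of objects and of arrows.\<close>

record ('x, 'b, 'o, 'm) pseudo =
  base :: "('x, 'b) cat"
  fib :: "'x \<Rightarrow> ('o, 'm) cat"
  fmon :: "'x \<Rightarrow> ('o, 'm) smc"
  pull :: "'b \<Rightarrow> ('o, 'm, 'o, 'm) func"
  pcomp :: "'b \<Rightarrow> 'b \<Rightarrow> 'o \<Rightarrow> 'm"
  pten :: "'b \<Rightarrow> 'o \<times> 'o \<Rightarrow> 'm"
  punit :: "'b \<Rightarrow> 'm"

definition pseudo_functor :: "('x, 'b, 'o, 'm) pseudo \<Rightarrow> bool" where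
  "pseudo_functor P \<longleftrightarrow> category (base P) \<and>
     (\<forall>X\<in>Obj (base P). symmetric_monoidal_closed (fib P X) (fmon P X)) \<and>
     (\<forall>X Y f. f \<in> homs (base P) X Y \<longrightarrow> is_functor (fib P Y) (fib P X) (pull P f)) \<and>
     (\<forall>X\<in>Obj (base P). func_eq (fib P X) (pull P (Ident (base P) X)) id_fun) \<and>
     (\<forall>X Y Z f g. f \<in> homs (base P) X Y \<longrightarrow> g \<in> homs (base P) Y Z \<longrightarrow>
        nat_iso (fib P Z) (fib P X) (pull P f \<circ>\<^sub>F pull P g) (pull P (g \<cdot>\<^bsub>base P\<^esub> f)) (pcomp P g f))"

definition associative_pseudo :: "('x, 'b, 'o, 'm) pseudo \<Rightarrow> bool" where
  "associative_pseudo P \<longleftrightarrow>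
     (\<forall>W X Y Z f g h. f \<in> homs (base P) W X \<longrightarrow> g \<in> homs (base P) X Y \<longrightarrow> h \<in> homs (base P) Y Z \<longrightarrow>
        (\<forall>A\<in>Obj (fib P Z).
           pcomp P (h \<cdot>\<^bsub>base P\<^esub> g) f A \<cdot>\<^bsub>fib P W\<^esub> far (pull P f) (pcomp P h g A)
           = pcomp P h (g \<cdot>\<^bsub>base P\<^esub> f) A \<cdot>\<^bsub>fib P W\<^esub> pcomp P g f (fob (pull P h) A)))"

definition symmetric_monoidal_functor :: "('o, 'm) cat \<Rightarrow> ('o, 'm) smc \<Rightarrow> ('p, 'n) cat \<Rightarrow>
    ('p, 'n) smc \<Rightarrow> ('o, 'm, 'p, 'n) func \<Rightarrow> ('o \<times> 'o \<Rightarrow> 'n) \<Rightarrow> 'n \<Rightarrow> bool" where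
  "symmetric_monoidal_functor C M D N F \<alpha> \<upsilon> \<longleftrightarrow>
     is_functor C D F \<and>
     nat_iso (prod_cat C C) D (tens N \<circ>\<^sub>F (F \<times>\<^sub>F F)) (F \<circ>\<^sub>F tens M) \<alpha> \<and>
     (\<forall>A\<in>Obj C. \<forall>B\<in>Obj C. \<forall>E\<in>Obj C.
        far F (assc M (A, B, E)) \<cdot>\<^bsub>D\<^esub> \<alpha> (A \<odot>\<^bsub>M\<^esub> B, E) \<cdot>\<^bsub>D\<^esub> (\<alpha> (A, B) \<star>\<^bsub>N\<^esub> Ident D (fob F E))
        = \<alpha> (A, B \<odot>\<^bsub>M\<^esub> E) \<cdot>\<^bsub>D\<^esub> (Ident D (fob F A) \<star>\<^bsub>N\<^esub> \<alpha> (B, E))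
          \<cdot>\<^bsub>D\<^esub> assc N (fob F A, fob F B, fob F E)) \<and>
     (\<forall>A\<in>Obj C. \<forall>B\<in>Obj C.
        far F (symm M (A, B)) \<cdot>\<^bsub>D\<^esub> \<alpha> (A, B) = \<alpha> (B, A) \<cdot>\<^bsub>D\<^esub> symm N (fob F A, fob F B)) \<and>
     (\<forall>I l r I' l' r'. munit M = Some (I, l, r) \<longrightarrow> munit N = Some (I', l', r') \<longrightarrow>
        \<upsilon> \<in> homs D I' (fob F I) \<and> iso_arrow D \<upsilon> \<and>
        (\<forall>A\<in>Obj C.
           far F (l A) \<cdot>\<^bsub>D\<^esub> \<alpha> (I, A) \<cdot>\<^bsub>D\<^esub> (\<upsilon> \<star>\<^bsub>N\<^esub> Ident D (fob F A)) = l' (fob F A) \<and>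
           far F (r A) \<cdot>\<^bsub>D\<^esub> \<alpha> (A, I) \<cdot>\<^bsub>D\<^esub> (Ident D (fob F A) \<star>\<^bsub>N\<^esub> \<upsilon>) = r' (fob F A)))"

definition monoidal_pseudo :: "('x, 'b, 'o, 'm) pseudo \<Rightarrow> bool" where
  "monoidal_pseudo P \<longleftrightarrow>
     (\<forall>X Y f. f \<in> homs (base P) X Y \<longrightarrow>
        symmetric_monoidal_functor (fib P Y) (fmon P Y) (fib P X) (fmon P X) (pull P f) (pten P f) (punit P f)) \<and>
     (\<forall>X Y Z f g. f \<in> homs (base P) X Y \<longrightarrow> g \<in> homs (base P) Y Z \<longrightarrow>
        (\<forall>A\<in>Obj (fib P Z). \<forall>B\<in>Obj (fib P Z).
           pcomp P g f (A \<odot>\<^bsub>fmon P Z\<^esub> B) \<cdot>\<^bsub>fib P X\<^esub> far (pull P f) (pten P g (A, B))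
             \<cdot>\<^bsub>fib P X\<^esub> pten P f (fob (pull P g) A, fob (pull P g) B)
           = pten P (g \<cdot>\<^bsub>base P\<^esub> f) (A, B) \<cdot>\<^bsub>fib P X\<^esub> (pcomp P g f A \<star>\<^bsub>fmon P X\<^esub> pcomp P g f B)))"

definition base' :: "('x, 'b, 'o, 'm) pseudo \<Rightarrow> ('x, 'b) cat" where
  "base' P = (base P)\<lparr>Arr := {f \<in> Arr (base P).
     \<exists>G \<eta> \<epsilon> H \<eta>' \<epsilon>'.
       adjunction (fib P (Cod (base P) f)) (fib P (Dom (base P) f)) (pull P f) G \<eta> \<epsilon> \<and>
       adjunction (fib P (Dom (base P) f)) (fib P (Cod (base P) f)) G H \<eta>' \<epsilon>'}\<rparr>"

text \<open>Chosen adjoints: \<open>push f = f\<^sub>*\<close> and \<open>shriek f = f\<^sup>!\<close>;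
  \<open>eta_ps\<close>, \<open>eps_ps\<close> belong to \<open>f\<^sup>* \<stileturn> f\<^sub>*\<close>, and \<open>eta_sh\<close>, \<open>eps_sh\<close> to \<open>f\<^sub>* \<stileturn> f\<^sup>!\<close>.\<close>

record ('b, 'o, 'm) adjoints =
  push :: "'b \<Rightarrow> ('o, 'm, 'o, 'm) func"
  eta_ps :: "'b \<Rightarrow> 'o \<Rightarrow> 'm"
  eps_ps :: "'b \<Rightarrow> 'o \<Rightarrow> 'm"
  shriek :: "'b \<Rightarrow> ('o, 'm, 'o, 'm) func"
  eta_sh :: "'b \<Rightarrow> 'o \<Rightarrow> 'm"
  eps_sh :: "'b \<Rightarrow> 'o \<Rightarrow> 'm"

definition adjoint_choice :: "('x, 'b, 'o, 'm) pseudo \<Rightarrow> ('b, 'o, 'm) adjoints \<Rightarrow> bool" where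
  "adjoint_choice P J \<longleftrightarrow>
     (\<forall>X Y f. f \<in> homs (base' P) X Y \<longrightarrow>
        adjunction (fib P Y) (fib P X) (pull P f) (push J f) (eta_ps J f) (eps_ps J f) \<and>
        adjunction (fib P X) (fib P Y) (push J f) (shriek J f) (eta_sh J f) (eps_sh J f)) \<and>
     (\<forall>X\<in>Obj (base P).
        func_eq (fib P X) (push J (Ident (base P) X)) id_fun \<and>
        func_eq (fib P X) (shriek J (Ident (base P) X)) id_fun)"

abbreviation src :: "('x, 'b, 'o, 'm) pseudo \<Rightarrow> 'b \<Rightarrow> 'x" where
  "src P f \<equiv> Dom (base P) f"

abbreviation tgt :: "('x, 'b, 'o, 'm) pseudo \<Rightarrow> 'b \<Rightarrow> 'x" where
  "tgt P f \<equiv> Cod (base P) f"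

definition lambda_ar :: "('x, 'b, 'o, 'm) pseudo \<Rightarrow> ('b, 'o, 'm) adjoints \<Rightarrow> 'b \<Rightarrow> 'o \<Rightarrow> 'o \<Rightarrow> 'm" where
  "lambda_ar P J f A B =
     far (push J f) (eps_ps J f A \<star>\<^bsub>fmon P (src P f)\<^esub> eps_ps J f B)
     \<cdot>\<^bsub>fib P (tgt P f)\<^esub>
     far (push J f) (inv_arrow (fib P (src P f)) (pten P f (fob (push J f) A, fob (push J f) B)))
     \<cdot>\<^bsub>fib P (tgt P f)\<^esub>
     eta_ps J f (fob (push J f) A \<odot>\<^bsub>fmon P (tgt P f)\<^esub> fob (push J f) B)"

definition mu_ar :: "('x, 'b, 'o, 'm) pseudo \<Rightarrow> ('b, 'o, 'm) adjoints \<Rightarrow> 'b \<Rightarrow> 'o \<Rightarrow> 'o \<Rightarrow> 'm" where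
  "mu_ar P J f A B =
     (let X = src P f; Y = tgt P f; pA = fob (push J f) A; AB = hob (fmon P X) A B in
      har (fmon P Y) (Ident (fib P Y) pA) (far (push J f) (ev (fmon P X) A B))
      \<cdot>\<^bsub>fib P Y\<^esub> har (fmon P Y) (Ident (fib P Y) pA) (lambda_ar P J f AB A)
      \<cdot>\<^bsub>fib P Y\<^esub> coev (fmon P Y) pA (fob (push J f) AB))"

definition zeta_ar :: "('x, 'b, 'o, 'm) pseudo \<Rightarrow> ('b, 'o, 'm) adjoints \<Rightarrow> 'b \<Rightarrow> 'o \<Rightarrow> 'o \<Rightarrow> 'm" where
  "zeta_ar P J f K A =
     har (fmon P (tgt P f)) (Ident (fib P (tgt P f)) (fob (push J f) A)) (eps_sh J f K)
     \<cdot>\<^bsub>fib P (tgt P f)\<^esub> mu_ar P J f A (fob (shriek J f) K)"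

text \<open>The pair \<open>{f\<^sub>*, \<zeta>\<^sub>K}\<close>.\<close>

definition push_dual :: "('x, 'b, 'o, 'm) pseudo \<Rightarrow> ('b, 'o, 'm) adjoints \<Rightarrow> 'b \<Rightarrow> 'o \<Rightarrow>
    ('o, 'm, 'o, 'm) dualpair" where
  "push_dual P J f K = \<lparr>dfun = push J f, dphi = zeta_ar P J f K\<rparr>"

text \<open>The composite \<open>Hom (A, (gf)\<^sub>* B) \<simeq> Hom ((gf)\<^sup>* A, B) \<rightarrow> Hom (f\<^sup>* g\<^sup>* A, B) \<simeq> Hom (A, g\<^sub>* f\<^sub>* B)\<close>,
  and \<open>b\<^sub>g\<^sub>,\<^sub>f\<close> as the arrow inducing it.\<close>

definition b_induced :: "('x, 'b, 'o, 'm) pseudo \<Rightarrow> ('b, 'o, 'm) adjoints \<Rightarrow> 'b \<Rightarrow> 'b \<Rightarrow> 'o \<Rightarrow> 'o \<Rightarrow> 'm \<Rightarrow> 'm" where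
  "b_induced P J g f A B h =
     (let CX = fib P (src P f); CY = fib P (tgt P f); CZ = fib P (tgt P g); gf = g \<cdot>\<^bsub>base P\<^esub> f;
          h1 = eps_ps J gf B \<cdot>\<^bsub>CX\<^esub> far (pull P gf) h;
          h2 = h1 \<cdot>\<^bsub>CX\<^esub> pcomp P g f A;
          h3 = far (push J f) h2 \<cdot>\<^bsub>CY\<^esub> eta_ps J f (fob (pull P g) A)
      in far (push J g) h3 \<cdot>\<^bsub>CZ\<^esub> eta_ps J g A)"

definition b_ar :: "('x, 'b, 'o, 'm) pseudo \<Rightarrow> ('b, 'o, 'm) adjoints \<Rightarrow> 'b \<Rightarrow> 'b \<Rightarrow> 'o \<Rightarrow> 'm" where
  "b_ar P J g f B =
     (let CZ = fib P (tgt P g); gf = g \<cdot>\<^bsub>base P\<^esub> f in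
      THE u. u \<in> homs CZ (fob (push J gf) B) (fob (push J g) (fob (push J f) B)) \<and>
             (\<forall>A h. h \<in> homs CZ A (fob (push J gf) B) \<longrightarrow> u \<cdot>\<^bsub>CZ\<^esub> h = b_induced P J g f A B h))"

text \<open>The composite \<open>Hom (A, f\<^sup>! g\<^sup>! B) \<simeq> Hom (g\<^sub>* f\<^sub>* A, B) \<rightarrow> Hom ((gf)\<^sub>* A, B) \<simeq> Hom (A, (gf)\<^sup>! B)\<close>,
  and \<open>c\<^sub>g\<^sub>,\<^sub>f\<close> as the arrow inducing it.\<close>

definition c_induced :: "('x, 'b, 'o, 'm) pseudo \<Rightarrow> ('b, 'o, 'm) adjoints \<Rightarrow> 'b \<Rightarrow> 'b \<Rightarrow> 'o \<Rightarrow> 'o \<Rightarrow> 'm \<Rightarrow> 'm" where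
  "c_induced P J g f A B h =
     (let CX = fib P (src P f); CY = fib P (tgt P f); CZ = fib P (tgt P g); gf = g \<cdot>\<^bsub>base P\<^esub> f;
          h1 = eps_sh J f (fob (shriek J g) B) \<cdot>\<^bsub>CY\<^esub> far (push J f) h;
          h2 = eps_sh J g B \<cdot>\<^bsub>CZ\<^esub> far (push J g) h1;
          h3 = h2 \<cdot>\<^bsub>CZ\<^esub> b_ar P J g f A
      in far (shriek J gf) h3 \<cdot>\<^bsub>CX\<^esub> eta_sh J gf A)"

definition c_ar :: "('x, 'b, 'o, 'm) pseudo \<Rightarrow> ('b, 'o, 'm) adjoints \<Rightarrow> 'b \<Rightarrow> 'b \<Rightarrow> 'o \<Rightarrow> 'm" where
  "c_ar P J g f B =
     (let CX = fib P (src P f); gf = g \<cdot>\<^bsub>base P\<^esub> f in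
      THE u. u \<in> homs CX (fob (shriek J f) (fob (shriek J g) B)) (fob (shriek J gf) B) \<and>
             (\<forall>A h. h \<in> homs CX A (fob (shriek J f) (fob (shriek J g) B)) \<longrightarrow>
                    u \<cdot>\<^bsub>CX\<^esub> h = c_induced P J g f A B h))"

section \<open>Suspended categories\<close>

text \<open>\<open>shift = T\<close> and \<open>unshift = T\<^sup>-\<^sup>1\<close>; \<open>add_ar\<close> adds parallel arrows.\<close>

record ('o, 'm) susp =
  add_ar :: "'m \<Rightarrow> 'm \<Rightarrow> 'm"
  zero_ar :: "'o \<Rightarrow> 'o \<Rightarrow> 'm"
  shift :: "('o, 'm, 'o, 'm) func"
  unshift :: "('o, 'm, 'o, 'm) func"

definition hom_group :: "('o, 'm) cat \<Rightarrow> ('o, 'm) susp \<Rightarrow> 'o \<Rightarrow> 'o \<Rightarrow> 'm monoid" where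
  "hom_group C S A B = \<lparr>carrier = homs C A B, mult = add_ar S, one = zero_ar S A B\<rparr>"

definition neg_ar :: "('o, 'm) cat \<Rightarrow> ('o, 'm) susp \<Rightarrow> 'm \<Rightarrow> 'm" where
  "neg_ar C S f = inv\<^bsub>hom_group C S (Dom C f) (Cod C f)\<^esub> f"

definition zero_object :: "('o, 'm) cat \<Rightarrow> 'o \<Rightarrow> bool" where
  "zero_object C Z \<longleftrightarrow> Z \<in> Obj C \<and>
     (\<forall>A\<in>Obj C. (\<exists>!f. f \<in> homs C A Z) \<and> (\<exists>!f. f \<in> homs C Z A))"

definition biproduct :: "('o, 'm) cat \<Rightarrow> ('o, 'm) susp \<Rightarrow> 'o \<Rightarrow> 'o \<Rightarrow> 'o \<Rightarrow> 'm \<Rightarrow> 'm \<Rightarrow> 'm \<Rightarrow> 'm \<Rightarrow> bool" where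
  "biproduct C S A B E i j p q \<longleftrightarrow>
     i \<in> homs C A E \<and> j \<in> homs C B E \<and> p \<in> homs C E A \<and> q \<in> homs C E B \<and>
     p \<cdot>\<^bsub>C\<^esub> i = Ident C A \<and> q \<cdot>\<^bsub>C\<^esub> j = Ident C B \<and>
     p \<cdot>\<^bsub>C\<^esub> j = zero_ar S B A \<and> q \<cdot>\<^bsub>C\<^esub> i = zero_ar S A B \<and>
     add_ar S (i \<cdot>\<^bsub>C\<^esub> p) (j \<cdot>\<^bsub>C\<^esub> q) = Ident C E"

definition additive_category :: "('o, 'm) cat \<Rightarrow> ('o, 'm) susp \<Rightarrow> bool" where
  "additive_category C S \<longleftrightarrow> category C \<and>
     (\<forall>A\<in>Obj C. \<forall>B\<in>Obj C. comm_group (hom_group C S A B)) \<and>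
     (\<forall>A B E f g h. f \<in> homs C A B \<longrightarrow> g \<in> homs C A B \<longrightarrow> h \<in> homs C B E \<longrightarrow>
        h \<cdot>\<^bsub>C\<^esub> add_ar S f g = add_ar S (h \<cdot>\<^bsub>C\<^esub> f) (h \<cdot>\<^bsub>C\<^esub> g)) \<and>
     (\<forall>A B E f g h. f \<in> homs C A B \<longrightarrow> g \<in> homs C A B \<longrightarrow> h \<in> homs C E A \<longrightarrow>
        add_ar S f g \<cdot>\<^bsub>C\<^esub> h = add_ar S (f \<cdot>\<^bsub>C\<^esub> h) (g \<cdot>\<^bsub>C\<^esub> h)) \<and>
     (\<exists>Z. zero_object C Z) \<and>
     (\<forall>A\<in>Obj C. \<forall>B\<in>Obj C. \<exists>E i j p q. biproduct C S A B E i j p q)"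

definition suspended_category :: "('o, 'm) cat \<Rightarrow> ('o, 'm) susp \<Rightarrow> bool" where
  "suspended_category C S \<longleftrightarrow> additive_category C S \<and>
     is_functor C C (shift S) \<and> is_functor C C (unshift S) \<and>
     func_eq C (shift S \<circ>\<^sub>F unshift S) id_fun \<and> func_eq C (unshift S \<circ>\<^sub>F shift S) id_fun"

definition op_susp :: "('o, 'm) susp \<Rightarrow> ('o, 'm) susp" where
  "op_susp S = \<lparr>add_ar = add_ar S, zero_ar = (\<lambda>A B. zero_ar S B A), shift = unshift S, unshift = shift S\<rparr>"

text \<open>A suspended functor is a functor \<open>F\<close> together with \<open>t : F T \<simeq> T F\<close>; functors between
  additive categories are additive.\<close>

definition suspended_functor :: "('o, 'm) cat \<Rightarrow> ('o, 'm) susp \<Rightarrow> ('p, 'n) cat \<Rightarrow> ('p, 'n) susp \<Rightarrow>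
    ('o, 'm, 'p, 'n) func \<Rightarrow> ('o \<Rightarrow> 'n) \<Rightarrow> bool" where
  "suspended_functor C S D R F t \<longleftrightarrow>
     suspended_category C S \<and> suspended_category D R \<and>
     nat_iso C D (F \<circ>\<^sub>F shift S) (shift R \<circ>\<^sub>F F) t \<and> is_functor C D F \<and>
     (\<forall>A B f g. f \<in> homs C A B \<longrightarrow> g \<in> homs C A B \<longrightarrow>
        far F (add_ar S f g) = add_ar R (far F f) (far F g))"

definition sus_id :: "('o, 'm) cat \<Rightarrow> ('o, 'm) susp \<Rightarrow> 'o \<Rightarrow> 'm" where
  "sus_id C S A = Ident C (fob (shift S) A)"

text \<open>The structure on \<open>G F\<close>, where \<open>(F, t)\<close> and \<open>(G, u)\<close> are suspended and \<open>E\<close> is the target of \<open>G\<close>.\<close>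

definition sus_comp :: "('q, 'k) cat \<Rightarrow> ('p, 'n, 'q, 'k) func \<Rightarrow> ('p \<Rightarrow> 'k) \<Rightarrow>
    ('o, 'm, 'p, 'n) func \<Rightarrow> ('o \<Rightarrow> 'n) \<Rightarrow> 'o \<Rightarrow> 'k" where
  "sus_comp E G u F t A = u (fob F A) \<cdot>\<^bsub>E\<^esub> far G (t A)"

text \<open>The structure \<open>F\<^sup>o T\<^sup>-\<^sup>1 \<simeq> T\<^sup>-\<^sup>1 F\<^sup>o\<close> of the opposite functor, which in the target of \<open>F\<close> is an arrow
  \<open>T\<^sup>-\<^sup>1 F A \<rightarrow> F T\<^sup>-\<^sup>1 A\<close>: it is \<open>T\<^sup>-\<^sup>1\<close> of \<open>t\<close> at \<open>T\<^sup>-\<^sup>1 A\<close>.\<close>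

definition sus_op :: "('o, 'm) susp \<Rightarrow> ('p, 'n) susp \<Rightarrow> ('o \<Rightarrow> 'n) \<Rightarrow> 'o \<Rightarrow> 'n" where
  "sus_op S R t A = far (unshift R) (t (fob (unshift S) A))"

definition suspended_transformation :: "('o, 'm) cat \<Rightarrow> ('o, 'm) susp \<Rightarrow> ('p, 'n) cat \<Rightarrow> ('p, 'n) susp \<Rightarrow>
    ('o, 'm, 'p, 'n) func \<Rightarrow> ('o \<Rightarrow> 'n) \<Rightarrow> ('o, 'm, 'p, 'n) func \<Rightarrow> ('o \<Rightarrow> 'n) \<Rightarrow> ('o \<Rightarrow> 'n) \<Rightarrow> bool" where
  "suspended_transformation C S D R F t G u \<rho> \<longleftrightarrow>
     suspended_functor C S D R F t \<and> suspended_functor C S D R G u \<and> nat_trans C D F G \<rho> \<and>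
     (\<forall>A\<in>Obj C. u A \<cdot>\<^bsub>D\<^esub> \<rho> (fob (shift S) A) = far (shift R) (\<rho> A) \<cdot>\<^bsub>D\<^esub> t A)"

text \<open>\<open>l\<close> at \<open>(A, B)\<close> is \<open>T A \<otimes> B \<rightarrow> T (A \<otimes> B)\<close>, and \<open>r\<close> at \<open>(A, B)\<close> is \<open>A \<otimes> T B \<rightarrow> T (A \<otimes> B)\<close>.\<close>

definition suspended_smc :: "('o, 'm) cat \<Rightarrow> ('o, 'm) smc \<Rightarrow> ('o, 'm) susp \<Rightarrow>
    ('o \<times> 'o \<Rightarrow> 'm) \<Rightarrow> ('o \<times> 'o \<Rightarrow> 'm) \<Rightarrow> bool" where
  "suspended_smc C M S l r \<longleftrightarrow>
     symmetric_monoidal_closed C M \<and> suspended_category C S \<and>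
     nat_iso (prod_cat C C) C (tens M \<circ>\<^sub>F (shift S \<times>\<^sub>F id_fun)) (shift S \<circ>\<^sub>F tens M) l \<and>
     nat_iso (prod_cat C C) C (tens M \<circ>\<^sub>F (id_fun \<times>\<^sub>F shift S)) (shift S \<circ>\<^sub>F tens M) r \<and>
     (\<forall>B\<in>Obj C. suspended_functor C S C S (tens_right C M B) (\<lambda>A. l (A, B))) \<and>
     (\<forall>A\<in>Obj C. suspended_functor C S C S (tens_left C M A) (\<lambda>B. r (A, B))) \<and>
     (\<forall>A\<in>Obj C. \<forall>B\<in>Obj C.
        far (shift S) (r (A, B)) \<cdot>\<^bsub>C\<^esub> l (A, fob (shift S) B)
        = neg_ar C S (far (shift S) (l (A, B)) \<cdot>\<^bsub>C\<^esub> r (fob (shift S) A, B))) \<and>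
     (\<forall>A\<in>Obj C. \<forall>B\<in>Obj C. \<forall>E\<in>Obj C.
        far (shift S) (assc M (A, B, E)) \<cdot>\<^bsub>C\<^esub> l (A \<odot>\<^bsub>M\<^esub> B, E) \<cdot>\<^bsub>C\<^esub> (l (A, B) \<star>\<^bsub>M\<^esub> Ident C E)
        = l (A, B \<odot>\<^bsub>M\<^esub> E) \<cdot>\<^bsub>C\<^esub> assc M (fob (shift S) A, B, E)) \<and>
     (\<forall>A\<in>Obj C. \<forall>B\<in>Obj C. \<forall>E\<in>Obj C.
        far (shift S) (assc M (A, B, E)) \<cdot>\<^bsub>C\<^esub> l (A \<odot>\<^bsub>M\<^esub> B, E) \<cdot>\<^bsub>C\<^esub> (r (A, B) \<star>\<^bsub>M\<^esub> Ident C E)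
        = r (A, B \<odot>\<^bsub>M\<^esub> E) \<cdot>\<^bsub>C\<^esub> (Ident C A \<star>\<^bsub>M\<^esub> l (B, E)) \<cdot>\<^bsub>C\<^esub> assc M (A, fob (shift S) B, E)) \<and>
     (\<forall>A\<in>Obj C. \<forall>B\<in>Obj C. \<forall>E\<in>Obj C.
        far (shift S) (assc M (A, B, E)) \<cdot>\<^bsub>C\<^esub> r (A \<odot>\<^bsub>M\<^esub> B, E)
        = r (A, B \<odot>\<^bsub>M\<^esub> E) \<cdot>\<^bsub>C\<^esub> (Ident C A \<star>\<^bsub>M\<^esub> r (B, E)) \<cdot>\<^bsub>C\<^esub> assc M (A, B, fob (shift S) E)) \<and>
     (\<forall>A\<in>Obj C. \<forall>B\<in>Obj C.
        far (shift S) (symm M (A, B)) \<cdot>\<^bsub>C\<^esub> l (A, B) = r (B, A) \<cdot>\<^bsub>C\<^esub> symm M (fob (shift S) A, B))"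

text \<open>The suspended structure on \<open>D\<^sub>K : C \<rightarrow> C\<^sup>o\<close> induced by the tensor product.  An isomorphism
  \<open>D\<^sub>K T \<simeq> T\<^sup>-\<^sup>1 D\<^sub>K\<close> in \<open>C\<^sup>o\<close> is an arrow \<open>T\<^sup>-\<^sup>1 [A, K] \<rightarrow> [T A, K]\<close> in \<open>C\<close>; with \<open>Y = T\<^sup>-\<^sup>1 [A, K]\<close> it
  corresponds to \<open>Y \<otimes> T A \<rightarrow> T (Y \<otimes> A) \<leftarrow> T Y \<otimes> A = [A, K] \<otimes> A \<rightarrow> K\<close>, where the arrow pointing
  to the left is inverted.\<close>

definition dual_sus :: "('o, 'm) cat \<Rightarrow> ('o, 'm) smc \<Rightarrow> ('o, 'm) susp \<Rightarrow>
    ('o \<times> 'o \<Rightarrow> 'm) \<Rightarrow> ('o \<times> 'o \<Rightarrow> 'm) \<Rightarrow> 'o \<Rightarrow> 'o \<Rightarrow> 'm" where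
  "dual_sus C M S l r K A =
     (let Y = fob (unshift S) (hob M A K) in
      curry_ar C M Y (fob (shift S) A) (ev M A K \<cdot>\<^bsub>C\<^esub> inv_arrow C (l (Y, A)) \<cdot>\<^bsub>C\<^esub> r (Y, A)))"

text \<open>In the next definitions \<open>d\<close> is the suspended structure on the duality and \<open>t\<close> the one on the functor
  of a pair.\<close>

definition suspended_with_duality :: "('o, 'm) catdual \<Rightarrow> ('o, 'm) susp \<Rightarrow> ('o \<Rightarrow> 'm) \<Rightarrow> bool" where
  "suspended_with_duality W S d \<longleftrightarrow> category_with_duality W \<and>
     suspended_functor (ucat W) S (op_cat (ucat W)) (op_susp S) (dual W) d \<and>
     suspended_transformation (ucat W) S (ucat W) S
       id_fun (sus_id (ucat W) S)
       (dual W \<circ>\<^sub>F dual W) (sus_comp (ucat W) (dual W) (sus_op S (op_susp S) d) (dual W) d)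
       (bidual W)"

definition suspended_duality_preserving :: "('o, 'm) catdual \<Rightarrow> ('o, 'm) susp \<Rightarrow> ('o \<Rightarrow> 'm) \<Rightarrow>
    ('p, 'n) catdual \<Rightarrow> ('p, 'n) susp \<Rightarrow> ('p \<Rightarrow> 'n) \<Rightarrow> ('o, 'm, 'p, 'n) dualpair \<Rightarrow> ('o \<Rightarrow> 'n) \<Rightarrow> bool" where
  "suspended_duality_preserving W1 S1 d1 W2 S2 d2 P t \<longleftrightarrow>
     duality_preserving W1 W2 P \<and>
     suspended_with_duality W1 S1 d1 \<and> suspended_with_duality W2 S2 d2 \<and>
     suspended_functor (ucat W1) S1 (ucat W2) S2 (dfun P) t \<and>
     suspended_transformation (op_cat (ucat W1)) (op_susp S1) (ucat W2) S2
       (dfun P \<circ>\<^sub>F dual W1)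
       (sus_comp (ucat W2) (dfun P) t (dual W1) (sus_op S1 (op_susp S1) d1))
       (dual W2 \<circ>\<^sub>F dfun P)
       (sus_comp (ucat W2) (dual W2) (sus_op S2 (op_susp S2) d2) (dfun P) (sus_op S1 S2 t))
       (dphi P)"

definition suspended_duality_morphism :: "('o, 'm) catdual \<Rightarrow> ('o, 'm) susp \<Rightarrow> ('o \<Rightarrow> 'm) \<Rightarrow>
    ('p, 'n) catdual \<Rightarrow> ('p, 'n) susp \<Rightarrow> ('p \<Rightarrow> 'n) \<Rightarrow> ('o, 'm, 'p, 'n) dualpair \<Rightarrow> ('o \<Rightarrow> 'n) \<Rightarrow>
    ('o, 'm, 'p, 'n) dualpair \<Rightarrow> ('o \<Rightarrow> 'n) \<Rightarrow> ('o \<Rightarrow> 'n) \<Rightarrow> bool" where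
  "suspended_duality_morphism W1 S1 d1 W2 S2 d2 P t P' t' \<rho> \<longleftrightarrow>
     duality_morphism W1 W2 P P' \<rho> \<and>
     suspended_duality_preserving W1 S1 d1 W2 S2 d2 P t \<and>
     suspended_duality_preserving W1 S1 d1 W2 S2 d2 P' t' \<and>
     suspended_transformation (ucat W1) S1 (ucat W2) S2 (dfun P) t (dfun P') t' \<rho>"

text \<open>\<open>sten_l\<close> and \<open>sten_r\<close> are the suspension isomorphisms of the tensor products in the fibres;
  \<open>spull f\<close>, \<open>spush f\<close> and \<open>sshriek f\<close> are the structures on \<open>f\<^sup>*\<close>, \<open>f\<^sub>*\<close> and \<open>f\<^sup>!\<close>.\<close>

record ('x, 'b, 'o, 'm) suspensions =
  sfib :: "'x \<Rightarrow> ('o, 'm) susp"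
  sten_l :: "'x \<Rightarrow> 'o \<times> 'o \<Rightarrow> 'm"
  sten_r :: "'x \<Rightarrow> 'o \<times> 'o \<Rightarrow> 'm"
  spull :: "'b \<Rightarrow> 'o \<Rightarrow> 'm"
  spush :: "'b \<Rightarrow> 'o \<Rightarrow> 'm"
  sshriek :: "'b \<Rightarrow> 'o \<Rightarrow> 'm"

definition suspended_pseudo :: "('x, 'b, 'o, 'm) pseudo \<Rightarrow> ('x, 'b, 'o, 'm) suspensions \<Rightarrow> bool" where
  "suspended_pseudo P Q \<longleftrightarrow>
     (\<forall>X\<in>Obj (base P). suspended_smc (fib P X) (fmon P X) (sfib Q X) (sten_l Q X) (sten_r Q X)) \<and>
     (\<forall>X Y f. f \<in> homs (base P) X Y \<longrightarrow>
        suspended_functor (fib P Y) (sfib Q Y) (fib P X) (sfib Q X) (pull P f) (spull Q f)) \<and>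
     (\<forall>X\<in>Obj (base P). \<forall>A\<in>Obj (fib P X).
        spull Q (Ident (base P) X) A = sus_id (fib P X) (sfib Q X) A) \<and>
     (\<forall>X Y Z f g. f \<in> homs (base P) X Y \<longrightarrow> g \<in> homs (base P) Y Z \<longrightarrow>
        suspended_transformation (fib P Z) (sfib Q Z) (fib P X) (sfib Q X)
          (pull P f \<circ>\<^sub>F pull P g) (sus_comp (fib P X) (pull P f) (spull Q f) (pull P g) (spull Q g))
          (pull P (g \<cdot>\<^bsub>base P\<^esub> f)) (spull Q (g \<cdot>\<^bsub>base P\<^esub> f)) (pcomp P g f)) \<and>
     (\<forall>X Y f. f \<in> homs (base P) X Y \<longrightarrow> (\<forall>A\<in>Obj (fib P Y). \<forall>B\<in>Obj (fib P Y).
        spull Q f (A \<odot>\<^bsub>fmon P Y\<^esub> B) \<cdot>\<^bsub>fib P X\<^esub> far (pull P f) (sten_l Q Y (A, B))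
          \<cdot>\<^bsub>fib P X\<^esub> pten P f (fob (shift (sfib Q Y)) A, B)
        = far (shift (sfib Q X)) (pten P f (A, B))
          \<cdot>\<^bsub>fib P X\<^esub> sten_l Q X (fob (pull P f) A, fob (pull P f) B)
          \<cdot>\<^bsub>fib P X\<^esub> (spull Q f A \<star>\<^bsub>fmon P X\<^esub> Ident (fib P X) (fob (pull P f) B)) \<and>
        spull Q f (A \<odot>\<^bsub>fmon P Y\<^esub> B) \<cdot>\<^bsub>fib P X\<^esub> far (pull P f) (sten_r Q Y (A, B))
          \<cdot>\<^bsub>fib P X\<^esub> pten P f (A, fob (shift (sfib Q Y)) B)
        = far (shift (sfib Q X)) (pten P f (A, B))
          \<cdot>\<^bsub>fib P X\<^esub> sten_r Q X (fob (pull P f) A, fob (pull P f) B)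
          \<cdot>\<^bsub>fib P X\<^esub> (Ident (fib P X) (fob (pull P f) A) \<star>\<^bsub>fmon P X\<^esub> spull Q f B)))"

text \<open>The structures on \<open>f\<^sub>*\<close> and \<open>f\<^sup>!\<close> are those for which units and counits are suspended;
  this determines them.\<close>

definition suspended_adjoints :: "('x, 'b, 'o, 'm) pseudo \<Rightarrow> ('b, 'o, 'm) adjoints \<Rightarrow>
    ('x, 'b, 'o, 'm) suspensions \<Rightarrow> bool" where
  "suspended_adjoints P J Q \<longleftrightarrow>
     (\<forall>X Y f. f \<in> homs (base' P) X Y \<longrightarrow>
        (let CX = fib P X; SX = sfib Q X; CY = fib P Y; SY = sfib Q Y in
         suspended_transformation CY SY CY SY id_fun (sus_id CY SY)
           (push J f \<circ>\<^sub>F pull P f) (sus_comp CY (push J f) (spush Q f) (pull P f) (spull Q f)) (eta_ps J f) \<and>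
         suspended_transformation CX SX CX SX
           (pull P f \<circ>\<^sub>F push J f) (sus_comp CX (pull P f) (spull Q f) (push J f) (spush Q f))
           id_fun (sus_id CX SX) (eps_ps J f) \<and>
         suspended_transformation CX SX CX SX id_fun (sus_id CX SX)
           (shriek J f \<circ>\<^sub>F push J f) (sus_comp CX (shriek J f) (sshriek Q f) (push J f) (spush Q f)) (eta_sh J f) \<and>
         suspended_transformation CY SY CY SY
           (push J f \<circ>\<^sub>F shriek J f) (sus_comp CY (push J f) (spush Q f) (shriek J f) (sshriek Q f))
           id_fun (sus_id CY SY) (eps_sh J f) \<and>
         suspended_functor CX SX CY SY (push J f) (spush Q f) \<and>
         suspended_functor CY SY CX SX (shriek J f) (sshriek Q f)))"

abbreviation dual_sus_at :: "('x, 'b, 'o, 'm) pseudo \<Rightarrow> ('x, 'b, 'o, 'm) suspensions \<Rightarrow> 'x \<Rightarrow> 'o \<Rightarrow> 'o \<Rightarrow> 'm" where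
  "dual_sus_at P Q X K \<equiv> dual_sus (fib P X) (fmon P X) (sfib Q X) (sten_l Q X) (sten_r Q X) K"

section \<open>Triangulated categories\<close>

definition triangle :: "('o, 'm) cat \<Rightarrow> ('o, 'm) susp \<Rightarrow> 'm \<times> 'm \<times> 'm \<Rightarrow> bool" where
  "triangle C S = (\<lambda>(u, v, w). \<exists>A B E.
     u \<in> homs C A B \<and> v \<in> homs C B E \<and> w \<in> homs C E (fob (shift S) A))"

definition triangulated_category :: "('o, 'm) cat \<Rightarrow> ('o, 'm) susp \<Rightarrow> ('m \<times> 'm \<times> 'm) set \<Rightarrow> bool" where
  "triangulated_category C S \<Delta> \<longleftrightarrow> suspended_category C S \<and>
     (\<forall>t\<in>\<Delta>. triangle C S t) \<and>
     (\<forall>u v w u' v' w' a b e. (u, v, w) \<in> \<Delta> \<longrightarrow> triangle C S (u', v', w') \<longrightarrow>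
        a \<in> homs C (Dom C u) (Dom C u') \<longrightarrow> b \<in> homs C (Cod C u) (Cod C u') \<longrightarrow>
        e \<in> homs C (Cod C v) (Cod C v') \<longrightarrow> iso_arrow C a \<longrightarrow> iso_arrow C b \<longrightarrow> iso_arrow C e \<longrightarrow>
        b \<cdot>\<^bsub>C\<^esub> u = u' \<cdot>\<^bsub>C\<^esub> a \<longrightarrow> e \<cdot>\<^bsub>C\<^esub> v = v' \<cdot>\<^bsub>C\<^esub> b \<longrightarrow> far (shift S) a \<cdot>\<^bsub>C\<^esub> w = w' \<cdot>\<^bsub>C\<^esub> e \<longrightarrow>
        (u', v', w') \<in> \<Delta>) \<and>
     (\<forall>A\<in>Obj C. \<forall>Z. zero_object C Z \<longrightarrow>
        (Ident C A, zero_ar S A Z, zero_ar S Z (fob (shift S) A)) \<in> \<Delta>) \<and>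
     (\<forall>u\<in>Arr C. \<exists>v w. (u, v, w) \<in> \<Delta>) \<and>
     (\<forall>u v w. triangle C S (u, v, w) \<longrightarrow>
        ((u, v, w) \<in> \<Delta> \<longleftrightarrow> (v, w, neg_ar C S (far (shift S) u)) \<in> \<Delta>)) \<and>
     (\<forall>u v w u' v' w' a b. (u, v, w) \<in> \<Delta> \<longrightarrow> (u', v', w') \<in> \<Delta> \<longrightarrow>
        a \<in> homs C (Dom C u) (Dom C u') \<longrightarrow> b \<in> homs C (Cod C u) (Cod C u') \<longrightarrow>
        b \<cdot>\<^bsub>C\<^esub> u = u' \<cdot>\<^bsub>C\<^esub> a \<longrightarrow>
        (\<exists>e\<in>homs C (Cod C v) (Cod C v').
           e \<cdot>\<^bsub>C\<^esub> v = v' \<cdot>\<^bsub>C\<^esub> b \<and> far (shift S) a \<cdot>\<^bsub>C\<^esub> w = w' \<cdot>\<^bsub>C\<^esub> e)) \<and>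
     (\<forall>u v i p j q k r. Cod C u = Dom C v \<longrightarrow>
        (u, i, p) \<in> \<Delta> \<longrightarrow> (v, j, q) \<in> \<Delta> \<longrightarrow> (v \<cdot>\<^bsub>C\<^esub> u, k, r) \<in> \<Delta> \<longrightarrow>
        (\<exists>m n. (m, n, far (shift S) i \<cdot>\<^bsub>C\<^esub> q) \<in> \<Delta> \<and>
           m \<in> homs C (Cod C i) (Cod C k) \<and> n \<in> homs C (Cod C k) (Cod C j) \<and>
           m \<cdot>\<^bsub>C\<^esub> i = k \<cdot>\<^bsub>C\<^esub> v \<and> r \<cdot>\<^bsub>C\<^esub> m = p \<and> n \<cdot>\<^bsub>C\<^esub> k = j \<and> q \<cdot>\<^bsub>C\<^esub> n = far (shift S) u \<cdot>\<^bsub>C\<^esub> r))"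

text \<open>The opposite triangulation is taken without a sign.  With the structure of
  \<^const>\<open>dual_sus\<close> and the usual conventions for chain complexes, this is the choice for which
  \<open>[-, K]\<close> is exact on homotopy categories of complexes.\<close>

definition op_tri :: "('o, 'm) susp \<Rightarrow> ('m \<times> 'm \<times> 'm) set \<Rightarrow> ('m \<times> 'm \<times> 'm) set" where
  "op_tri S \<Delta> = {(u, v, w). (v, u, far (shift S) w) \<in> \<Delta>}"

definition exact_functor :: "('o, 'm) cat \<Rightarrow> ('o, 'm) susp \<Rightarrow> ('m \<times> 'm \<times> 'm) set \<Rightarrow>
    ('p, 'n) cat \<Rightarrow> ('p, 'n) susp \<Rightarrow> ('n \<times> 'n \<times> 'n) set \<Rightarrow>
    ('o, 'm, 'p, 'n) func \<Rightarrow> ('o \<Rightarrow> 'n) \<Rightarrow> bool" where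
  "exact_functor C S \<Delta> D R \<Gamma> F t \<longleftrightarrow> suspended_functor C S D R F t \<and>
     (\<forall>u v w. (u, v, w) \<in> \<Delta> \<longrightarrow> (far F u, far F v, t (Dom C u) \<cdot>\<^bsub>D\<^esub> far F w) \<in> \<Gamma>)"

definition triangulated_with_duality ::
  "('o, 'm) catdual \<Rightarrow> ('o, 'm) susp \<Rightarrow> ('m \<times> 'm \<times> 'm) set \<Rightarrow> ('o \<Rightarrow> 'm) \<Rightarrow> bool" where
  "triangulated_with_duality W S \<Delta> d \<longleftrightarrow> suspended_with_duality W S d \<and>
     triangulated_category (ucat W) S \<Delta> \<and>
     exact_functor (ucat W) S \<Delta> (op_cat (ucat W)) (op_susp S) (op_tri S \<Delta>) (dual W) d"

definition triangulated_duality_morphism :: "('o, 'm) catdual \<Rightarrow> ('o, 'm) susp \<Rightarrow> ('m \<times> 'm \<times> 'm) set \<Rightarrow>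
    ('o \<Rightarrow> 'm) \<Rightarrow> ('p, 'n) catdual \<Rightarrow> ('p, 'n) susp \<Rightarrow> ('n \<times> 'n \<times> 'n) set \<Rightarrow> ('p \<Rightarrow> 'n) \<Rightarrow>
    ('o, 'm, 'p, 'n) dualpair \<Rightarrow> ('o \<Rightarrow> 'n) \<Rightarrow>
    ('o, 'm, 'p, 'n) dualpair \<Rightarrow> ('o \<Rightarrow> 'n) \<Rightarrow> ('o \<Rightarrow> 'n) \<Rightarrow> bool" where
  "triangulated_duality_morphism W1 S1 \<Delta>1 d1 W2 S2 \<Delta>2 d2 P t P' t' \<rho> \<longleftrightarrow>
     suspended_duality_morphism W1 S1 d1 W2 S2 d2 P t P' t' \<rho> \<and>
     triangulated_with_duality W1 S1 \<Delta>1 d1 \<and> triangulated_with_duality W2 S2 \<Delta>2 d2 \<and>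
     exact_functor (ucat W1) S1 \<Delta>1 (ucat W2) S2 \<Delta>2 (dfun P) t \<and>
     exact_functor (ucat W1) S1 \<Delta>1 (ucat W2) S2 \<Delta>2 (dfun P') t'"

definition triangulated_pseudo :: "('x, 'b, 'o, 'm) pseudo \<Rightarrow> ('x, 'b, 'o, 'm) suspensions \<Rightarrow>
    ('x \<Rightarrow> ('m \<times> 'm \<times> 'm) set) \<Rightarrow> bool" where
  "triangulated_pseudo P Q \<Delta> \<longleftrightarrow> suspended_pseudo P Q \<and>
     (\<forall>X\<in>Obj (base P). triangulated_category (fib P X) (sfib Q X) (\<Delta> X)) \<and>
     (\<forall>X\<in>Obj (base P). \<forall>A\<in>Obj (fib P X).
        exact_functor (fib P X) (sfib Q X) (\<Delta> X) (fib P X) (sfib Q X) (\<Delta> X)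
          (tens_right (fib P X) (fmon P X) A) (\<lambda>B. sten_l Q X (B, A)) \<and>
        exact_functor (fib P X) (sfib Q X) (\<Delta> X) (fib P X) (sfib Q X) (\<Delta> X)
          (tens_left (fib P X) (fmon P X) A) (\<lambda>B. sten_r Q X (A, B)) \<and>
        exact_functor (fib P X) (sfib Q X) (\<Delta> X)
          (op_cat (fib P X)) (op_susp (sfib Q X)) (op_tri (sfib Q X) (\<Delta> X))
          (dual_fun (fib P X) (fmon P X) A) (dual_sus_at P Q X A)) \<and>
     (\<forall>X Y f. f \<in> homs (base P) X Y \<longrightarrow>
        exact_functor (fib P Y) (sfib Q Y) (\<Delta> Y) (fib P X) (sfib Q X) (\<Delta> X) (pull P f) (spull Q f))"

end

theory Submission
  imports Defs
begin

text \<open>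
  The push-forward \<open>f\<^sub>*\<close> with \<open>\<lambda>\<close> is a lax symmetric functor, and \<open>\<zeta>\<^sub>K\<close> is determined by the arrow
  \<open>\<epsilon>\<^sup>! : f\<^sub>* f\<^sup>! K \<rightarrow> K\<close>.  More generally, a lax symmetric functor \<open>F\<close> and an arrow \<open>e : F L \<rightarrow> K\<close> give a
  duality preserving functor from \<open>D\<^sub>L\<close> to \<open>D\<^sub>K\<close>.  The functor \<open>I\<^sub>\<iota>\<close> is of this kind, with \<open>F\<close> the identity
  and \<open>e = \<iota>\<close>, and the construction is compatible with composition.  A transformation \<open>\<rho> : F \<rightarrow> F'\<close> that
  respects the lax structures and satisfies \<open>e = e' \<rho>\<^sub>L\<close> is a morphism of duality preserving functors.
  For \<open>\<rho> = b\<close>, the first condition is conjugate to the monoidality of \<open>a\<close>, and the second one is the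
  definition of \<open>c\<close>.  The suspended case follows the same pattern, with the isomorphism
  \<open>Y \<otimes> T A \<simeq> T Y \<otimes> A\<close> as the only additional structure; in the triangulated case one also needs that a
  right adjoint of an exact functor is exact.
\<close>

section \<open>Categories\<close>

text \<open>The identities to be proved concern arrows into an internal Hom or into the value of a
  right adjoint, and \<open>\<zeta>\<close>, \<open>\<lambda>\<close>, \<open>b\<close> and
  \<open>c\<close> are given by long composites built from units. Such an arrow is determined by its
  transpose, and the transposes are short: that of \<open>\<phi>\<close> is \<open>e\<close> after
  evaluation, that of \<open>\<lambda>\<close> is \<open>\<epsilon> \<otimes> \<epsilon>\<close> up
  to \<open>\<alpha>\<close>, that of a conjugate is \<open>\<epsilon>' \<cdot> a\<close>. Each
  construction is therefore pinned down by the equation for its transpose, and later arguments use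
  that equation instead of the defining formula. The obstacle is that the adjoints of
  \<open>gf\<close> are chosen independently of those of \<open>f\<close> and \<open>g\<close>. The
  composites \<open>g_* f_*\<close> and \<open>f^! g^!\<close> thus need adjunctions and lax
  structures of their own, to be compared with the chosen ones. A single construction, the conjugate
  of an isomorphism of left adjoints, makes both comparisons: applied to \<open>a\<close> it gives
  \<open>b\<close>, and applied to \<open>b\<close> it gives \<open>c\<close>. Typing conditions are
  always split into conditions on \<open>Arr\<close>, \<open>Dom\<close> and \<open>Cod\<close>, and
  composites are bracketed to the right.\<close>

lemma in_homs [simp]: "f \<in> homs C A B \<longleftrightarrow> f \<in> Arr C \<and> Dom C f = A \<and> Cod C f = B"
  by (auto simp: homs_def)

lemma op_cat_simps [simp]:
  "Obj (op_cat C) = Obj C" "Arr (op_cat C) = Arr C" "Dom (op_cat C) = Cod C" "Cod (op_cat C) = Dom C"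
  "Ident (op_cat C) = Ident C" "g \<cdot>\<^bsub>op_cat C\<^esub> f = f \<cdot>\<^bsub>C\<^esub> g"
  by (simp_all add: op_cat_def)

lemma prod_cat_simps [simp]:
  "Obj (prod_cat C D) = Obj C \<times> Obj D" "Arr (prod_cat C D) = Arr C \<times> Arr D"
  "Dom (prod_cat C D) (f, g) = (Dom C f, Dom D g)" "Cod (prod_cat C D) (f, g) = (Cod C f, Cod D g)"
  "Ident (prod_cat C D) (A, B) = (Ident C A, Ident D B)"
  "(f', g') \<cdot>\<^bsub>prod_cat C D\<^esub> (f, g) = (f' \<cdot>\<^bsub>C\<^esub> f, g' \<cdot>\<^bsub>D\<^esub> g)"
  by (simp_all add: prod_cat_def)

lemma func_simps [simp]:
  "fob id_fun A = A" "far id_fun f = f"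
  "fob (G \<circ>\<^sub>F F) A = fob G (fob F A)" "far (G \<circ>\<^sub>F F) f = far G (far F f)"
  "fob (F \<times>\<^sub>F F') (A, B) = (fob F A, fob F' B)" "far (F \<times>\<^sub>F F') (f, g) = (far F f, far F' g)"
  by (simp_all add: id_fun_def comp_fun_def prod_fun_def)

text \<open>Functors are pairs of total maps, so the unit laws are equalities of records, and
  composing with \<open>I_\<iota>\<close> leaves the underlying functor \<open>(gf)_*\<close>
  literally unchanged.\<close>

lemma comp_fun_id [simp]: "F \<circ>\<^sub>F id_fun = F" "id_fun \<circ>\<^sub>F F = F"
  by (simp_all add: id_fun_def comp_fun_def)

locale cat =
  fixes C :: "('o, 'm) cat" (structure)
  assumes category: "category C"
begin

lemma Dom_Obj [simp]: "f \<in> Arr C \<Longrightarrow> Dom C f \<in> Obj C"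
  and Cod_Obj [simp]: "f \<in> Arr C \<Longrightarrow> Cod C f \<in> Obj C"
  and Ident_Arr [simp]: "A \<in> Obj C \<Longrightarrow> Ident C A \<in> Arr C"
  and Dom_Ident [simp]: "A \<in> Obj C \<Longrightarrow> Dom C (Ident C A) = A"
  and Cod_Ident [simp]: "A \<in> Obj C \<Longrightarrow> Cod C (Ident C A) = A"
  using category by (auto simp: category_def)

lemma cmp_Arr [simp]: "f \<in> Arr C \<Longrightarrow> g \<in> Arr C \<Longrightarrow> Dom C g = Cod C f \<Longrightarrow> g \<cdot> f \<in> Arr C"
  and Dom_cmp [simp]: "f \<in> Arr C \<Longrightarrow> g \<in> Arr C \<Longrightarrow> Dom C g = Cod C f \<Longrightarrow> Dom C (g \<cdot> f) = Dom C f"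
  and Cod_cmp [simp]: "f \<in> Arr C \<Longrightarrow> g \<in> Arr C \<Longrightarrow> Dom C g = Cod C f \<Longrightarrow> Cod C (g \<cdot> f) = Cod C g"
  using category by (auto simp: category_def)

lemma cmp_Ident [simp]:
  "f \<in> Arr C \<Longrightarrow> Dom C f = A \<Longrightarrow> f \<cdot> Ident C A = f"
  "f \<in> Arr C \<Longrightarrow> Cod C f = A \<Longrightarrow> Ident C A \<cdot> f = f"
  using category by (auto simp: category_def)

lemma assoc [simp]:
  assumes "f \<in> Arr C" "g \<in> Arr C" "h \<in> Arr C" "Dom C g = Cod C f" "Dom C h = Cod C g"
  shows "(h \<cdot> g) \<cdot> f = h \<cdot> (g \<cdot> f)"
  using category assms by (auto simp: category_def)

text \<open>Variants of an equation for use inside a composite that is bracketed to the right.\<close>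

lemma chain:
  assumes "a \<cdot> b = c \<cdot> d" "a \<in> Arr C" "b \<in> Arr C" "c \<in> Arr C" "d \<in> Arr C" "x \<in> Arr C"
    "Dom C a = Cod C b" "Dom C c = Cod C d" "Dom C b = Cod C x" "Dom C d = Cod C x"
  shows "a \<cdot> (b \<cdot> x) = c \<cdot> (d \<cdot> x)"
  by (metis assms assoc)

lemma chain1:
  assumes "a \<cdot> b = c" "a \<in> Arr C" "b \<in> Arr C" "x \<in> Arr C"
    "Dom C a = Cod C b" "Dom C b = Cod C x"
  shows "a \<cdot> (b \<cdot> x) = c \<cdot> x"
  by (metis assms assoc)

lemma chain3:
  assumes "a \<cdot> (b \<cdot> b') = c" "a \<in> Arr C" "b \<in> Arr C" "b' \<in> Arr C" "x \<in> Arr C"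
    "Dom C a = Cod C b" "Dom C b = Cod C b'" "Dom C b' = Cod C x"
  shows "a \<cdot> (b \<cdot> (b' \<cdot> x)) = c \<cdot> x"
  using assms by (simp flip: assms(1))

section \<open>Inverse arrows and isomorphisms\<close>

lemma inverse_arrowsD:
  assumes "inverse_arrows C f g"
  shows "f \<in> Arr C" "g \<in> Arr C" "Dom C g = Cod C f" "Cod C g = Dom C f"
    "g \<cdot> f = Ident C (Dom C f)" "f \<cdot> g = Ident C (Cod C f)"
  using assms by (auto simp: inverse_arrows_def)

lemma inverse_arrows_unique:
  assumes "inverse_arrows C f g" "inverse_arrows C f h"
  shows "g = h"
proof -
  note g = inverse_arrowsD[OF assms(1)] and h = inverse_arrowsD[OF assms(2)]
  have "g = g \<cdot> (f \<cdot> h)" using g h by simp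
  also have "\<dots> = (g \<cdot> f) \<cdot> h" using g(1-4) h(1-4) by simp
  finally show ?thesis using g h by simp
qed

lemma iso_inv: "iso_arrow C f \<Longrightarrow> inverse_arrows C f (inv_arrow C f)"
  unfolding iso_arrow_def inv_arrow_def by (metis inverse_arrows_unique theI)

lemma iso_Arr: "iso_arrow C f \<Longrightarrow> f \<in> Arr C"
  by (auto simp: iso_arrow_def inverse_arrows_def)

lemma inv_simps [simp]:
  assumes "iso_arrow C f"
  shows "inv_arrow C f \<in> Arr C" "Dom C (inv_arrow C f) = Cod C f" "Cod C (inv_arrow C f) = Dom C f"
    "inv_arrow C f \<cdot> f = Ident C (Dom C f)" "f \<cdot> inv_arrow C f = Ident C (Cod C f)"
  using inverse_arrowsD[OF iso_inv[OF assms]] by simp_all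

lemma inv_chain [simp]:
  assumes "iso_arrow C f" "x \<in> Arr C"
  shows "Dom C f = Cod C x \<Longrightarrow> inv_arrow C f \<cdot> (f \<cdot> x) = x"
    "Cod C f = Cod C x \<Longrightarrow> f \<cdot> (inv_arrow C f \<cdot> x) = x"
  using assms iso_Arr[OF assms(1)] inv_simps[OF assms(1)]
  by (simp_all flip: assoc)

lemma iso_arrowI:
  assumes "f \<in> Arr C" "g \<in> Arr C" "Dom C g = Cod C f" "Cod C g = Dom C f"
    "g \<cdot> f = Ident C (Dom C f)" "f \<cdot> g = Ident C (Cod C f)"
  shows "iso_arrow C f"
  using assms by (auto simp: iso_arrow_def inverse_arrows_def)

lemma iso_epi:
  assumes "iso_arrow C a" "f \<in> Arr C" "g \<in> Arr C" "Dom C f = Cod C a" "Dom C g = Cod C a"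
    and "f \<cdot> a = g \<cdot> a"
  shows "f = g"
proof -
  note a = iso_Arr[OF assms(1)]
  have "f = (f \<cdot> a) \<cdot> inv_arrow C a" using a assms(1-5) by simp
  also have "\<dots> = g" using a assms(1-5) unfolding assms(6) by simp
  finally show ?thesis .
qed

lemma iso_mono:
  assumes "iso_arrow C a" "f \<in> Arr C" "g \<in> Arr C" "Cod C f = Dom C a" "Cod C g = Dom C a"
    and "a \<cdot> f = a \<cdot> g"
  shows "f = g"
proof -
  have "f = inv_arrow C a \<cdot> (a \<cdot> f)" using assms(1-5) by simp
  also have "\<dots> = g" using assms(1-5) unfolding assms(6) by simp
  finally show ?thesis .
qed

lemma iso_cmp:
  assumes "iso_arrow C f" "iso_arrow C g" "Dom C g = Cod C f"
  shows "iso_arrow C (g \<cdot> f)"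
  using assms iso_Arr[OF assms(1)] iso_Arr[OF assms(2)]
  by (intro iso_arrowI[where g = "inv_arrow C f \<cdot> inv_arrow C g"]) simp_all

lemma iso_Ident: "A \<in> Obj C \<Longrightarrow> iso_arrow C (Ident C A)"
  by (intro iso_arrowI[where g = "Ident C A"]) simp_all

lemma iso_op: "iso_arrow C f \<Longrightarrow> iso_arrow (op_cat C) f"
  by (auto simp: iso_arrow_def inverse_arrows_def)

lemma category_op: "category (op_cat C)"
  unfolding category_def by auto

end

lemma category_prod:
  assumes "category C" "category D"
  shows "category (prod_cat C D)"
proof -
  interpret C: cat C by unfold_locales fact
  interpret D: cat D by unfold_locales fact
  show ?thesis unfolding category_def by auto
qed

section \<open>Functors and natural transformations\<close>

lemma is_functorI:
  assumes "category C" "category D"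
    "\<And>A. A \<in> Obj C \<Longrightarrow> fob F A \<in> Obj D" "\<And>A. A \<in> Obj C \<Longrightarrow> far F (Ident C A) = Ident D (fob F A)"
    "\<And>f. f \<in> Arr C \<Longrightarrow> far F f \<in> Arr D"
    "\<And>f. f \<in> Arr C \<Longrightarrow> Dom D (far F f) = fob F (Dom C f)"
    "\<And>f. f \<in> Arr C \<Longrightarrow> Cod D (far F f) = fob F (Cod C f)"
    "\<And>f g. f \<in> Arr C \<Longrightarrow> g \<in> Arr C \<Longrightarrow> Dom C g = Cod C f \<Longrightarrow>
       far F (g \<cdot>\<^bsub>C\<^esub> f) = far F g \<cdot>\<^bsub>D\<^esub> far F f"
  shows "is_functor C D F"
  using assms unfolding is_functor_def by auto

locale ftor = C: cat C + D: cat D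
  for C :: "('o, 'm) cat" and D :: "('p, 'n) cat" (structure) +
  fixes F :: "('o, 'm, 'p, 'n) func"
  assumes is_functor: "is_functor C D F"
begin

lemma fob_Obj [simp]: "A \<in> Obj C \<Longrightarrow> fob F A \<in> Obj D"
  and far_Ident [simp]: "A \<in> Obj C \<Longrightarrow> far F (Ident C A) = Ident D (fob F A)"
  and far_Arr [simp]: "f \<in> Arr C \<Longrightarrow> far F f \<in> Arr D"
  and Dom_far [simp]: "f \<in> Arr C \<Longrightarrow> Dom D (far F f) = fob F (Dom C f)"
  and Cod_far [simp]: "f \<in> Arr C \<Longrightarrow> Cod D (far F f) = fob F (Cod C f)"
  and far_cmp [simp]: "f \<in> Arr C \<Longrightarrow> g \<in> Arr C \<Longrightarrow> Dom C g = Cod C f \<Longrightarrow>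
       far F (g \<cdot>\<^bsub>C\<^esub> f) = far F g \<cdot> far F f"
  using is_functor by (auto simp: is_functor_def)

lemma iso_far [simp]:
  assumes "iso_arrow C f"
  shows "iso_arrow D (far F f)"
proof -
  note f = C.iso_Arr[OF assms]
  have "far F (inv_arrow C f) \<cdot> far F f = far F (inv_arrow C f \<cdot>\<^bsub>C\<^esub> f)"
    "far F f \<cdot> far F (inv_arrow C f) = far F (f \<cdot>\<^bsub>C\<^esub> inv_arrow C f)"
    using f C.inv_simps(1-3)[OF assms] by simp_all
  then show ?thesis
    using f C.inv_simps[OF assms] by (intro D.iso_arrowI[where g = "far F (inv_arrow C f)"]) simp_all
qed

lemma functor_op: "is_functor (op_cat C) (op_cat D) F"
  by (rule is_functorI) (simp_all add: C.category_op D.category_op)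

lemma commute:
  assumes "a \<cdot>\<^bsub>C\<^esub> b = c \<cdot>\<^bsub>C\<^esub> d" "a \<in> Arr C" "b \<in> Arr C" "c \<in> Arr C" "d \<in> Arr C"
    "Dom C a = Cod C b" "Dom C c = Cod C d"
  shows "far F a \<cdot> far F b = far F c \<cdot> far F d"
  by (metis assms far_cmp)

end

lemma ftor_of: "is_functor C D F \<Longrightarrow> ftor C D F"
  by (simp add: ftor_def ftor_axioms_def cat_def is_functor_def)

lemma functor_id: "category C \<Longrightarrow> is_functor C C id_fun"
  by (rule is_functorI) simp_all

lemma functor_comp:
  assumes "is_functor C D F" "is_functor D E G"
  shows "is_functor C E (G \<circ>\<^sub>F F)"
proof -
  interpret F: ftor C D F using assms(1) by (rule ftor_of)
  interpret G: ftor D E G using assms(2) by (rule ftor_of)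
  show ?thesis by (rule is_functorI) (simp_all add: F.C.category G.D.category)
qed

lemma nat_transI:
  assumes "is_functor C D F" "is_functor C D G"
    "\<And>A. A \<in> Obj C \<Longrightarrow> \<tau> A \<in> Arr D" "\<And>A. A \<in> Obj C \<Longrightarrow> Dom D (\<tau> A) = fob F A"
    "\<And>A. A \<in> Obj C \<Longrightarrow> Cod D (\<tau> A) = fob G A"
    "\<And>f. f \<in> Arr C \<Longrightarrow> \<tau> (Cod C f) \<cdot>\<^bsub>D\<^esub> far F f = far G f \<cdot>\<^bsub>D\<^esub> \<tau> (Dom C f)"
  shows "nat_trans C D F G \<tau>"
  using assms unfolding nat_trans_def by auto

lemma nat_transD:
  assumes "nat_trans C D F G \<tau>"
  shows "is_functor C D F" "is_functor C D G"
    "A \<in> Obj C \<Longrightarrow> \<tau> A \<in> Arr D" "A \<in> Obj C \<Longrightarrow> Dom D (\<tau> A) = fob F A" "A \<in> Obj C \<Longrightarrow> Cod D (\<tau> A) = fob G A"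
    "f \<in> Arr C \<Longrightarrow> \<tau> (Cod C f) \<cdot>\<^bsub>D\<^esub> far F f = far G f \<cdot>\<^bsub>D\<^esub> \<tau> (Dom C f)"
  using assms unfolding nat_trans_def by auto

section \<open>Adjunctions\<close>

locale adj = F: ftor C D F + G: ftor D C G
  for C :: "('o, 'm) cat" and D :: "('p, 'n) cat" (structure) and F G +
  fixes \<eta> \<epsilon>
  assumes adjunction: "adjunction C D F G \<eta> \<epsilon>"
begin

lemma unit_Arr [simp]: "A \<in> Obj C \<Longrightarrow> \<eta> A \<in> Arr C"
  and Dom_unit [simp]: "A \<in> Obj C \<Longrightarrow> Dom C (\<eta> A) = A"
  and Cod_unit [simp]: "A \<in> Obj C \<Longrightarrow> Cod C (\<eta> A) = fob G (fob F A)"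
  and counit_Arr [simp]: "B \<in> Obj D \<Longrightarrow> \<epsilon> B \<in> Arr D"
  and Dom_counit [simp]: "B \<in> Obj D \<Longrightarrow> Dom D (\<epsilon> B) = fob F (fob G B)"
  and Cod_counit [simp]: "B \<in> Obj D \<Longrightarrow> Cod D (\<epsilon> B) = B"
  and unit_nat: "f \<in> Arr C \<Longrightarrow> \<eta> (Cod C f) \<cdot>\<^bsub>C\<^esub> f = far G (far F f) \<cdot>\<^bsub>C\<^esub> \<eta> (Dom C f)"
  and counit_nat: "g \<in> Arr D \<Longrightarrow> \<epsilon> (Cod D g) \<cdot> far F (far G g) = g \<cdot> \<epsilon> (Dom D g)"
  and triangle1: "A \<in> Obj C \<Longrightarrow> \<epsilon> (fob F A) \<cdot> far F (\<eta> A) = Ident D (fob F A)"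
  and triangle2: "B \<in> Obj D \<Longrightarrow> far G (\<epsilon> B) \<cdot>\<^bsub>C\<^esub> \<eta> (fob G B) = Ident C (fob G B)"
  using adjunction by (auto simp: adjunction_def nat_trans_def)

text \<open>Read from left to right, a counit travels to the right and strips \<open>F G\<close>
  from each arrow that it passes; this brings transposed composites into a normal form.\<close>

lemma counit_nat' [simp]:
  assumes "g \<in> Arr D" "Cod D g = B"
  shows "\<epsilon> B \<cdot> far F (far G g) = g \<cdot> \<epsilon> (Dom D g)"
    "x \<in> Arr D \<Longrightarrow> Cod D x = fob F (fob G (Dom D g)) \<Longrightarrow>
       \<epsilon> B \<cdot> (far F (far G g) \<cdot> x) = g \<cdot> (\<epsilon> (Dom D g) \<cdot> x)"
proof -
  have B: "B \<in> Obj D" using assms F.D.Cod_Obj by blast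
  note n = counit_nat[OF assms(1), unfolded assms(2)]
  show "\<epsilon> B \<cdot> far F (far G g) = g \<cdot> \<epsilon> (Dom D g)" by (rule n)
  show "\<epsilon> B \<cdot> (far F (far G g) \<cdot> x) = g \<cdot> (\<epsilon> (Dom D g) \<cdot> x)"
    if "x \<in> Arr D" "Cod D x = fob F (fob G (Dom D g))"
    using assms B that by (intro F.D.chain n) simp_all
qed

lemma counit_unit [simp]:
  assumes "A \<in> Obj C"
  shows "\<epsilon> (fob F A) \<cdot> far F (\<eta> A) = Ident D (fob F A)"
    "x \<in> Arr D \<Longrightarrow> Cod D x = fob F A \<Longrightarrow> \<epsilon> (fob F A) \<cdot> (far F (\<eta> A) \<cdot> x) = x"
  using assms by (simp_all add: triangle1 F.D.chain1[OF triangle1])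

text \<open>Transposition \<open>Hom (A, G B) -> Hom (F A, B)\<close> is injective. This is the test
  for equality of arrows into a right adjoint used throughout.\<close>

lemma sharp_inject:
  assumes "k \<in> Arr C" "k' \<in> Arr C" "Cod C k = fob G B" "Cod C k' = fob G B" "Dom C k = Dom C k'"
    and "B \<in> Obj D" and eq: "\<epsilon> B \<cdot> far F k = \<epsilon> B \<cdot> far F k'"
  shows "k = k'"
proof -
  \<comment> \<open>An arrow is recovered from its transpose by applying \<open>G\<close> and
    precomposing with the unit: naturality of \<open>\<eta>\<close> and the second triangle
    identity.\<close>
  have *: "h = far G (\<epsilon> B \<cdot> far F h) \<cdot>\<^bsub>C\<^esub> \<eta> (Dom C h)"
    if h: "h \<in> Arr C" "Cod C h = fob G B" for h
  proof -
    have "far G (\<epsilon> B) \<cdot>\<^bsub>C\<^esub> (\<eta> (fob G B) \<cdot>\<^bsub>C\<^esub> h) = h"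
      using h \<open>B \<in> Obj D\<close> by (simp add: F.C.chain1[OF triangle2])
    then show ?thesis using h \<open>B \<in> Obj D\<close> unit_nat[OF h(1)] by simp
  qed
  show ?thesis using *[of k] *[of k'] assms by simp
qed

lemma sharp_flat:
  assumes "A \<in> Obj C" "h \<in> Arr D" "Dom D h = fob F A" "Cod D h = B"
  shows "\<epsilon> B \<cdot> far F (far G h \<cdot>\<^bsub>C\<^esub> \<eta> A) = h"
  using assms by simp

end

lemma adj_of: "adjunction C D F G \<eta> \<epsilon> \<Longrightarrow> adj C D F G \<eta> \<epsilon>"
  by (simp add: adj_def adj_axioms_def adjunction_def ftor_of)

lemma adjunctionI:
  assumes "is_functor C D F" "is_functor D C G"
    "\<And>A. A \<in> Obj C \<Longrightarrow> \<eta> A \<in> homs C A (fob G (fob F A))"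
    "\<And>B. B \<in> Obj D \<Longrightarrow> \<epsilon> B \<in> homs D (fob F (fob G B)) B"
    "\<And>f. f \<in> Arr C \<Longrightarrow> \<eta> (Cod C f) \<cdot>\<^bsub>C\<^esub> f = far G (far F f) \<cdot>\<^bsub>C\<^esub> \<eta> (Dom C f)"
    "\<And>g. g \<in> Arr D \<Longrightarrow> \<epsilon> (Cod D g) \<cdot>\<^bsub>D\<^esub> far F (far G g) = g \<cdot>\<^bsub>D\<^esub> \<epsilon> (Dom D g)"
    "\<And>A. A \<in> Obj C \<Longrightarrow> \<epsilon> (fob F A) \<cdot>\<^bsub>D\<^esub> far F (\<eta> A) = Ident D (fob F A)"
    "\<And>B. B \<in> Obj D \<Longrightarrow> far G (\<epsilon> B) \<cdot>\<^bsub>C\<^esub> \<eta> (fob G B) = Ident C (fob G B)"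
  shows "adjunction C D F G \<eta> \<epsilon>"
  using assms unfolding adjunction_def
  by (auto intro!: nat_transI functor_comp functor_id simp: is_functor_def)

lemma adjunction_comp:
  fixes E :: "('q, 'k) cat" (structure)
  assumes "adjunction C D F G \<eta> \<epsilon>" "adjunction D E F' G' \<eta>' \<epsilon>'"
  shows "adjunction C E (F' \<circ>\<^sub>F F) (G \<circ>\<^sub>F G')
    (\<lambda>A. far G (\<eta>' (fob F A)) \<cdot>\<^bsub>C\<^esub> \<eta> A) (\<lambda>B. \<epsilon>' B \<cdot> far F' (\<epsilon> (fob G' B)))"
proof -
  interpret A: adj C D F G \<eta> \<epsilon> using assms(1) by (rule adj_of)
  interpret B: adj D E F' G' \<eta>' \<epsilon>' using assms(2) by (rule adj_of)
  show ?thesis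
  proof (rule adjunctionI)
    show "is_functor C E (F' \<circ>\<^sub>F F)" "is_functor E C (G \<circ>\<^sub>F G')"
      by (rule functor_comp[OF A.F.is_functor B.F.is_functor] functor_comp[OF B.G.is_functor A.G.is_functor])+
  next
    fix f assume f: "f \<in> Arr C"
    have "far G (\<eta>' (fob F (Cod C f))) \<cdot>\<^bsub>C\<^esub> (far G (far F f) \<cdot>\<^bsub>C\<^esub> \<eta> (Dom C f))
      = far G (far G' (far F' (far F f))) \<cdot>\<^bsub>C\<^esub> (far G (\<eta>' (fob F (Dom C f))) \<cdot>\<^bsub>C\<^esub> \<eta> (Dom C f))"
      using f B.unit_nat[of "far F f"] by (intro A.F.C.chain A.G.commute) simp_all
    then show "(far G (\<eta>' (fob F (Cod C f))) \<cdot>\<^bsub>C\<^esub> \<eta> (Cod C f)) \<cdot>\<^bsub>C\<^esub> f =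
      far (G \<circ>\<^sub>F G') (far (F' \<circ>\<^sub>F F) f) \<cdot>\<^bsub>C\<^esub> (far G (\<eta>' (fob F (Dom C f))) \<cdot>\<^bsub>C\<^esub> \<eta> (Dom C f))"
      using f A.unit_nat[OF f] by simp
  next
    fix g assume g: "g \<in> Arr E"
    have "far F' (\<epsilon> (fob G' (Cod E g))) \<cdot> far F' (far F (far G (far G' g)))
      = far F' (far G' g) \<cdot> far F' (\<epsilon> (fob G' (Dom E g)))"
      using g by (intro B.F.commute) simp_all
    then show "(\<epsilon>' (Cod E g) \<cdot> far F' (\<epsilon> (fob G' (Cod E g)))) \<cdot> far (F' \<circ>\<^sub>F F) (far (G \<circ>\<^sub>F G') g)
      = g \<cdot> (\<epsilon>' (Dom E g) \<cdot> far F' (\<epsilon> (fob G' (Dom E g))))"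
      using g by simp
  next
    fix A assume A: "A \<in> Obj C"
    have "far F' (\<epsilon> (fob G' (fob F' (fob F A)))) \<cdot> far F' (far F (far G (\<eta>' (fob F A))))
      = far F' (\<eta>' (fob F A)) \<cdot> far F' (\<epsilon> (fob F A))"
      using A by (intro B.F.commute) simp_all
    moreover have "far F' (\<epsilon> (fob F A)) \<cdot> far F' (far F (\<eta> A)) = far F' (Ident D (fob F A))"
      using A by (simp flip: B.F.far_cmp)
    ultimately show "(\<epsilon>' (fob (F' \<circ>\<^sub>F F) A) \<cdot> far F' (\<epsilon> (fob G' (fob (F' \<circ>\<^sub>F F) A)))) \<cdot>
         far (F' \<circ>\<^sub>F F) (far G (\<eta>' (fob F A)) \<cdot>\<^bsub>C\<^esub> \<eta> A) = Ident E (fob (F' \<circ>\<^sub>F F) A)"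
      using A by (simp add: B.F.D.chain)
  next
    fix B assume B: "B \<in> Obj E"
    have "far G (\<eta>' (fob G' B)) \<cdot>\<^bsub>C\<^esub> far G (\<epsilon> (fob G' B))
      = far G (far G' (far F' (\<epsilon> (fob G' B)))) \<cdot>\<^bsub>C\<^esub> far G (\<eta>' (fob F (fob G (fob G' B))))"
      using B B.unit_nat[of "\<epsilon> (fob G' B)"] by (intro A.G.commute) simp_all
    then have "far G (far G' (far F' (\<epsilon> (fob G' B)))) \<cdot>\<^bsub>C\<^esub> (far G (\<eta>' (fob F (fob G (fob G' B)))) \<cdot>\<^bsub>C\<^esub> \<eta> (fob G (fob G' B)))
      = far G (\<eta>' (fob G' B)) \<cdot>\<^bsub>C\<^esub> (far G (\<epsilon> (fob G' B)) \<cdot>\<^bsub>C\<^esub> \<eta> (fob G (fob G' B)))"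
      using B by (intro A.F.C.chain) simp_all
    moreover have "far G (far G' (\<epsilon>' B)) \<cdot>\<^bsub>C\<^esub> far G (\<eta>' (fob G' B)) = far G (Ident D (fob G' B))"
      using B B.triangle2 by (simp flip: A.G.far_cmp)
    ultimately show "far (G \<circ>\<^sub>F G') (\<epsilon>' B \<cdot> far F' (\<epsilon> (fob G' B))) \<cdot>\<^bsub>C\<^esub>
         (far G (\<eta>' (fob F (fob (G \<circ>\<^sub>F G') B))) \<cdot>\<^bsub>C\<^esub> \<eta> (fob (G \<circ>\<^sub>F G') B)) = Ident C (fob (G \<circ>\<^sub>F G') B)"
      using B A.triangle2 by simp
  qed simp_all
qed

text \<open>The functor \<open>(gf)^*\<close> is only isomorphic to \<open>f^* g^*\<close>;
  transporting the composite adjunction along \<open>a\<close> shows that \<open>(gf)^*\<close> has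
  a right adjoint too, as closure of \<open>base'\<close> under composition requires.\<close>

lemma adjunction_iso:
  fixes D :: "('p, 'n) cat" (structure)
  assumes "adjunction C D F G \<eta> \<epsilon>" "nat_iso C D F F' a"
  shows "adjunction C D F' G (\<lambda>A. far G (a A) \<cdot>\<^bsub>C\<^esub> \<eta> A) (\<lambda>B. \<epsilon> B \<cdot> inv_arrow D (a (fob G B)))"
proof -
  interpret A: adj C D F G \<eta> \<epsilon> using assms(1) by (rule adj_of)
  have nt: "nat_trans C D F F' a" and iso: "\<And>A. A \<in> Obj C \<Longrightarrow> iso_arrow D (a A)"
    using assms(2) by (auto simp: nat_iso_def)
  note a [simp] = nat_transD(3-5)[OF nt] and anat = nat_transD(6)[OF nt]
  interpret F': ftor C D F' using nat_transD(2)[OF nt] by (rule ftor_of)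
  have inat: "inv_arrow D (a (Cod C f)) \<cdot> far F' f = far F f \<cdot> inv_arrow D (a (Dom C f))"
    if f: "f \<in> Arr C" for f
  proof (rule A.F.D.iso_mono[OF iso[of "Cod C f"]])
    have "far F' f = (far F' f \<cdot> a (Dom C f)) \<cdot> inv_arrow D (a (Dom C f))"
      using f iso by simp
    also have "\<dots> = a (Cod C f) \<cdot> (far F f \<cdot> inv_arrow D (a (Dom C f)))"
      using f iso unfolding anat[OF f, symmetric] by simp
    finally show "a (Cod C f) \<cdot> (inv_arrow D (a (Cod C f)) \<cdot> far F' f) =
      a (Cod C f) \<cdot> (far F f \<cdot> inv_arrow D (a (Dom C f)))"
      using f iso by simp
  qed (use that iso in simp_all)
  show ?thesis
  proof (rule adjunctionI)
    show "is_functor C D F'" "is_functor D C G" by (rule F'.is_functor A.G.is_functor)+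
  next
    fix f assume f: "f \<in> Arr C"
    have "far G (a (Cod C f)) \<cdot>\<^bsub>C\<^esub> (far G (far F f) \<cdot>\<^bsub>C\<^esub> \<eta> (Dom C f))
      = far G (far F' f) \<cdot>\<^bsub>C\<^esub> (far G (a (Dom C f)) \<cdot>\<^bsub>C\<^esub> \<eta> (Dom C f))"
      using f anat[OF f] by (intro A.F.C.chain A.G.commute) simp_all
    then show "(far G (a (Cod C f)) \<cdot>\<^bsub>C\<^esub> \<eta> (Cod C f)) \<cdot>\<^bsub>C\<^esub> f =
         far G (far F' f) \<cdot>\<^bsub>C\<^esub> (far G (a (Dom C f)) \<cdot>\<^bsub>C\<^esub> \<eta> (Dom C f))"
      using f A.unit_nat[OF f] by simp
  next
    fix g assume g: "g \<in> Arr D"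
    then show "(\<epsilon> (Cod D g) \<cdot> inv_arrow D (a (fob G (Cod D g)))) \<cdot> far F' (far G g) =
         g \<cdot> (\<epsilon> (Dom D g) \<cdot> inv_arrow D (a (fob G (Dom D g))))"
      using inat[of "far G g"] iso by simp
  next
    fix A assume A: "A \<in> Obj C"
    have "inv_arrow D (a (fob G (fob F' A))) \<cdot> (far F' (far G (a A)) \<cdot> far F' (\<eta> A))
      = far F (far G (a A)) \<cdot> (inv_arrow D (a (fob G (fob F A))) \<cdot> far F' (\<eta> A))"
      using A inat[of "far G (a A)"] iso by (intro A.F.D.chain) simp_all
    moreover have "inv_arrow D (a (fob G (fob F A))) \<cdot> far F' (\<eta> A) = far F (\<eta> A) \<cdot> inv_arrow D (a A)"
      using A inat[of "\<eta> A"] by simp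
    ultimately show "(\<epsilon> (fob F' A) \<cdot> inv_arrow D (a (fob G (fob F' A)))) \<cdot>
         far F' (far G (a A) \<cdot>\<^bsub>C\<^esub> \<eta> A) = Ident D (fob F' A)"
      using A iso by simp
  next
    fix B assume B: "B \<in> Obj D"
    have "far G (inv_arrow D (a (fob G B))) \<cdot>\<^bsub>C\<^esub> far G (a (fob G B)) = far G (Ident D (fob F (fob G B)))"
      using B iso by (simp flip: A.G.far_cmp)
    then have "far G (inv_arrow D (a (fob G B))) \<cdot>\<^bsub>C\<^esub> (far G (a (fob G B)) \<cdot>\<^bsub>C\<^esub> \<eta> (fob G B))
      = Ident C (fob G (fob F (fob G B))) \<cdot>\<^bsub>C\<^esub> \<eta> (fob G B)"
      using B iso by (intro A.F.C.chain1) simp_all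
    then show "far G (\<epsilon> B \<cdot> inv_arrow D (a (fob G B))) \<cdot>\<^bsub>C\<^esub>
        (far G (a (fob G B)) \<cdot>\<^bsub>C\<^esub> \<eta> (fob G B)) = Ident C (fob G B)"
      using B iso A.triangle2 by simp
  qed (use iso in simp_all)
qed

section \<open>Symmetric monoidal closed categories\<close>

locale smclosed =
  fixes C :: "('o, 'm) cat" (structure) and M :: "('o, 'm) smc"
  assumes smc: "symmetric_monoidal_closed C M"

sublocale smclosed \<subseteq> cat C
  using smc by unfold_locales
    (auto simp: symmetric_monoidal_closed_def symmetric_monoidal_def is_functor_def)

context smclosed
begin

lemma tens_functor: "is_functor (prod_cat C C) C (tens M)"
  using smc by (simp add: symmetric_monoidal_closed_def symmetric_monoidal_def)

lemma symm_iso: "nat_iso (prod_cat C C) C (tens M)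
    \<lparr>fob = (\<lambda>(A, B). B \<odot>\<^bsub>M\<^esub> A), far = (\<lambda>(f, g). g \<star>\<^bsub>M\<^esub> f)\<rparr> (symm M)"
  using smc by (simp add: symmetric_monoidal_closed_def symmetric_monoidal_def)

lemma ihom_functor: "is_functor (prod_cat (op_cat C) C) C (ihom M)"
  using smc by (simp add: symmetric_monoidal_closed_def)

lemma closed_adjunction:
  "X \<in> Obj C \<Longrightarrow> adjunction C C (tens_right C M X) (ihom_from C M X) (coev M X) (ev M X)"
  using smc by (simp add: symmetric_monoidal_closed_def)

lemma tob_Obj [simp]: "A \<in> Obj C \<Longrightarrow> B \<in> Obj C \<Longrightarrow> A \<odot>\<^bsub>M\<^esub> B \<in> Obj C"
  and tar_Ident [simp]: "A \<in> Obj C \<Longrightarrow> B \<in> Obj C \<Longrightarrow> Ident C A \<star>\<^bsub>M\<^esub> Ident C B = Ident C (A \<odot>\<^bsub>M\<^esub> B)"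
  and tar_Arr [simp]: "f \<in> Arr C \<Longrightarrow> g \<in> Arr C \<Longrightarrow> f \<star>\<^bsub>M\<^esub> g \<in> Arr C"
  and Dom_tar [simp]: "f \<in> Arr C \<Longrightarrow> g \<in> Arr C \<Longrightarrow> Dom C (f \<star>\<^bsub>M\<^esub> g) = Dom C f \<odot>\<^bsub>M\<^esub> Dom C g"
  and Cod_tar [simp]: "f \<in> Arr C \<Longrightarrow> g \<in> Arr C \<Longrightarrow> Cod C (f \<star>\<^bsub>M\<^esub> g) = Cod C f \<odot>\<^bsub>M\<^esub> Cod C g"
  using ftor.fob_Obj[OF ftor_of[OF tens_functor], of "(A, B)"] ftor.far_Ident[OF ftor_of[OF tens_functor], of "(A, B)"]
    ftor.far_Arr[OF ftor_of[OF tens_functor], of "(f, g)"] ftor.Dom_far[OF ftor_of[OF tens_functor], of "(f, g)"]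
    ftor.Cod_far[OF ftor_of[OF tens_functor], of "(f, g)"] by simp_all
lemma tar_cmp [simp]:
  assumes "f \<in> Arr C" "f' \<in> Arr C" "g \<in> Arr C" "g' \<in> Arr C" "Dom C f' = Cod C f" "Dom C g' = Cod C g"
  shows "(f' \<star>\<^bsub>M\<^esub> g') \<cdot> (f \<star>\<^bsub>M\<^esub> g) = (f' \<cdot> f) \<star>\<^bsub>M\<^esub> (g' \<cdot> g)"
proof -
  interpret ftor "prod_cat C C" C "tens M" by (rule ftor_of[OF tens_functor])
  show ?thesis using far_cmp[of "(f, g)" "(f', g')"] assms by simp
qed

lemma tar_chain [simp]:
  assumes "f \<in> Arr C" "f' \<in> Arr C" "g \<in> Arr C" "g' \<in> Arr C" "Dom C f' = Cod C f" "Dom C g' = Cod C g"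
    "x \<in> Arr C" "Cod C x = Dom C f \<odot>\<^bsub>M\<^esub> Dom C g"
  shows "(f' \<star>\<^bsub>M\<^esub> g') \<cdot> ((f \<star>\<^bsub>M\<^esub> g) \<cdot> x) = ((f' \<cdot> f) \<star>\<^bsub>M\<^esub> (g' \<cdot> g)) \<cdot> x"
  using assms by (intro chain1 tar_cmp) simp_all

lemma symm_Arr [simp]: "A \<in> Obj C \<Longrightarrow> B \<in> Obj C \<Longrightarrow> symm M (A, B) \<in> Arr C"
  and Dom_symm [simp]: "A \<in> Obj C \<Longrightarrow> B \<in> Obj C \<Longrightarrow> Dom C (symm M (A, B)) = A \<odot>\<^bsub>M\<^esub> B"
  and Cod_symm [simp]: "A \<in> Obj C \<Longrightarrow> B \<in> Obj C \<Longrightarrow> Cod C (symm M (A, B)) = B \<odot>\<^bsub>M\<^esub> A"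
  and symm_nat: "f \<in> Arr C \<Longrightarrow> g \<in> Arr C \<Longrightarrow>
    symm M (Cod C f, Cod C g) \<cdot> (f \<star>\<^bsub>M\<^esub> g) = (g \<star>\<^bsub>M\<^esub> f) \<cdot> symm M (Dom C f, Dom C g)"
  using nat_transD(3-5)[OF symm_iso[unfolded nat_iso_def, THEN conjunct1], of "(A, B)"]
    nat_transD(6)[OF symm_iso[unfolded nat_iso_def, THEN conjunct1], of "(f, g)"]
  by simp_all
lemma symm_symm [simp]:
  assumes "A \<in> Obj C" "B \<in> Obj C"
  shows "symm M (B, A) \<cdot> symm M (A, B) = Ident C (A \<odot>\<^bsub>M\<^esub> B)"
    "x \<in> Arr C \<Longrightarrow> Cod C x = A \<odot>\<^bsub>M\<^esub> B \<Longrightarrow> symm M (B, A) \<cdot> (symm M (A, B) \<cdot> x) = x"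
proof -
  show *: "symm M (B, A) \<cdot> symm M (A, B) = Ident C (A \<odot>\<^bsub>M\<^esub> B)"
    using smc assms by (auto simp: symmetric_monoidal_closed_def symmetric_monoidal_def)
  show "x \<in> Arr C \<Longrightarrow> Cod C x = A \<odot>\<^bsub>M\<^esub> B \<Longrightarrow> symm M (B, A) \<cdot> (symm M (A, B) \<cdot> x) = x"
    using assms by (simp add: chain1[OF *])
qed

lemma hob_Obj [simp]: "A \<in> Obj C \<Longrightarrow> B \<in> Obj C \<Longrightarrow> hob M A B \<in> Obj C"
  and har_Ident [simp]: "A \<in> Obj C \<Longrightarrow> B \<in> Obj C \<Longrightarrow> har M (Ident C A) (Ident C B) = Ident C (hob M A B)"
  and har_Arr [simp]: "f \<in> Arr C \<Longrightarrow> g \<in> Arr C \<Longrightarrow> har M f g \<in> Arr C"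
  and Dom_har [simp]: "f \<in> Arr C \<Longrightarrow> g \<in> Arr C \<Longrightarrow> Dom C (har M f g) = hob M (Cod C f) (Dom C g)"
  and Cod_har [simp]: "f \<in> Arr C \<Longrightarrow> g \<in> Arr C \<Longrightarrow> Cod C (har M f g) = hob M (Dom C f) (Cod C g)"
  using ftor.fob_Obj[OF ftor_of[OF ihom_functor], of "(A, B)"] ftor.far_Ident[OF ftor_of[OF ihom_functor], of "(A, B)"]
    ftor.far_Arr[OF ftor_of[OF ihom_functor], of "(f, g)"] ftor.Dom_far[OF ftor_of[OF ihom_functor], of "(f, g)"]
    ftor.Cod_far[OF ftor_of[OF ihom_functor], of "(f, g)"] by simp_all
lemma har_cmp:
  assumes "f \<in> Arr C" "f' \<in> Arr C" "g \<in> Arr C" "g' \<in> Arr C" "Dom C f = Cod C f'" "Dom C g' = Cod C g"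
  shows "har M f' g' \<cdot> har M f g = har M (f \<cdot> f') (g' \<cdot> g)"
proof -
  interpret ftor "prod_cat (op_cat C) C" C "ihom M" by (rule ftor_of[OF ihom_functor])
  show ?thesis using far_cmp[of "(f, g)" "(f', g')"] assms by simp
qed

lemma ev_Arr [simp]: "X \<in> Obj C \<Longrightarrow> A \<in> Obj C \<Longrightarrow> ev M X A \<in> Arr C"
  and Dom_ev [simp]: "X \<in> Obj C \<Longrightarrow> A \<in> Obj C \<Longrightarrow> Dom C (ev M X A) = hob M X A \<odot>\<^bsub>M\<^esub> X"
  and Cod_ev [simp]: "X \<in> Obj C \<Longrightarrow> A \<in> Obj C \<Longrightarrow> Cod C (ev M X A) = A"
  and coev_Arr [simp]: "X \<in> Obj C \<Longrightarrow> A \<in> Obj C \<Longrightarrow> coev M X A \<in> Arr C"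
  and Dom_coev [simp]: "X \<in> Obj C \<Longrightarrow> A \<in> Obj C \<Longrightarrow> Dom C (coev M X A) = A"
  and Cod_coev [simp]: "X \<in> Obj C \<Longrightarrow> A \<in> Obj C \<Longrightarrow> Cod C (coev M X A) = hob M X (A \<odot>\<^bsub>M\<^esub> X)"
proof -
  assume X: "X \<in> Obj C" and A: "A \<in> Obj C"
  interpret adj C C "tens_right C M X" "ihom_from C M X" "coev M X" "ev M X"
    by (rule adj_of[OF closed_adjunction[OF X]])
  show "ev M X A \<in> Arr C" "Dom C (ev M X A) = hob M X A \<odot>\<^bsub>M\<^esub> X" "Cod C (ev M X A) = A"
    "coev M X A \<in> Arr C" "Dom C (coev M X A) = A" "Cod C (coev M X A) = hob M X (A \<odot>\<^bsub>M\<^esub> X)"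
    using A unit_Arr Dom_unit Cod_unit counit_Arr Dom_counit Cod_counit
    by (auto simp: tens_right_def ihom_from_def)
qed

lemma curry_Arr [simp]:
  assumes "A \<in> Obj C" "X \<in> Obj C" "h \<in> Arr C" "Dom C h = A \<odot>\<^bsub>M\<^esub> X"
  shows "curry_ar C M A X h \<in> Arr C" "Dom C (curry_ar C M A X h) = A"
    "Cod C (curry_ar C M A X h) = hob M X (Cod C h)"
  using assms by (auto simp: curry_ar_def)

lemma curry_nat:
  assumes "A \<in> Obj C" "x \<in> Arr C" "h \<in> Arr C" "Dom C h = A \<odot>\<^bsub>M\<^esub> Cod C x"
  shows "curry_ar C M A (Dom C x) (h \<cdot> (Ident C A \<star>\<^bsub>M\<^esub> x))
    = har M x (Ident C (Cod C h)) \<cdot> curry_ar C M A (Cod C x) h"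
  using smc assms unfolding symmetric_monoidal_closed_def in_homs by blast

lemma ev_ext:
  assumes "k \<in> Arr C" "k' \<in> Arr C" "Cod C k = hob M X B" "Cod C k' = hob M X B" "Dom C k = Dom C k'"
    "X \<in> Obj C" "B \<in> Obj C"
    and "ev M X B \<cdot> (k \<star>\<^bsub>M\<^esub> Ident C X) = ev M X B \<cdot> (k' \<star>\<^bsub>M\<^esub> Ident C X)"
  shows "k = k'"
proof -
  interpret adj C C "tens_right C M X" "ihom_from C M X" "coev M X" "ev M X"
    by (rule adj_of[OF closed_adjunction]) fact
  show ?thesis
    by (rule sharp_inject[of k k' B]) (use assms in \<open>simp_all add: tens_right_def ihom_from_def\<close>)
qed

lemma ev_curry [simp]:
  assumes "A \<in> Obj C" "X \<in> Obj C" "h \<in> Arr C" "Dom C h = A \<odot>\<^bsub>M\<^esub> X" "Cod C h = B"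
  shows "ev M X B \<cdot> (curry_ar C M A X h \<star>\<^bsub>M\<^esub> Ident C X) = h"
proof -
  interpret adj C C "tens_right C M X" "ihom_from C M X" "coev M X" "ev M X"
    by (rule adj_of[OF closed_adjunction]) fact
  show ?thesis
    using sharp_flat[of A h B] assms by (simp add: tens_right_def ihom_from_def curry_ar_def)
qed

text \<open>Dinaturality of evaluation. The contravariant action of the internal Hom is specified
  only through \<open>curry_ar\<close>, so it has to be extracted by currying \<open>ev\<close>
  itself.\<close>

lemma ev_har:
  assumes "x \<in> Arr C" "h \<in> Arr C" "Cod C x = X" "Dom C x = X'" "Dom C h = B" "Cod C h = B'"
  shows "ev M X' B' \<cdot> (har M x h \<star>\<^bsub>M\<^esub> Ident C X') = h \<cdot> (ev M X B \<cdot> (Ident C (hob M X B) \<star>\<^bsub>M\<^esub> x))"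
proof -
  have o [simp]: "X \<in> Obj C" "X' \<in> Obj C" "B \<in> Obj C" "B' \<in> Obj C" using assms by auto
  interpret adj C C "tens_right C M X'" "ihom_from C M X'" "coev M X'" "ev M X'"
    by (rule adj_of[OF closed_adjunction]) fact
  \<comment> \<open>Since \<open>ev\<close> curries to the identity, naturality of
    \<open>curry_ar\<close> at \<open>ev\<close> isolates the arrow
    \<open>har M x (Ident C B)\<close>.\<close>
  have cu: "curry_ar C M (hob M X B) X (ev M X B) = Ident C (hob M X B)"
    by (rule ev_ext[where X = X and B = B]) simp_all
  have "curry_ar C M (hob M X B) X' (ev M X B \<cdot> (Ident C (hob M X B) \<star>\<^bsub>M\<^esub> x))
    = har M x (Ident C B) \<cdot> curry_ar C M (hob M X B) X (ev M X B)"
    using curry_nat[of "hob M X B" x "ev M X B"] assms by simp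
  then have 1: "curry_ar C M (hob M X B) X' (ev M X B \<cdot> (Ident C (hob M X B) \<star>\<^bsub>M\<^esub> x)) = har M x (Ident C B)"
    using assms by (simp add: cu)
  have 2: "ev M X' B \<cdot> (har M x (Ident C B) \<star>\<^bsub>M\<^esub> Ident C X') = ev M X B \<cdot> (Ident C (hob M X B) \<star>\<^bsub>M\<^esub> x)"
    unfolding 1[symmetric] using assms by (intro ev_curry) simp_all
  \<comment> \<open>The arrow splits into its contravariant part, treated above, and its covariant
    part, for which the claim is naturality of the counit.\<close>
  have 3: "har M x h = har M (Ident C X') h \<cdot> har M x (Ident C B)"
    using assms by (simp add: har_cmp)
  have "ev M X' B' \<cdot> (har M (Ident C X') h \<star>\<^bsub>M\<^esub> Ident C X') = h \<cdot> ev M X' B"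
    using counit_nat[OF assms(2)] assms by (simp add: tens_right_def ihom_from_def)
  then have "ev M X' B' \<cdot> ((har M (Ident C X') h \<star>\<^bsub>M\<^esub> Ident C X') \<cdot> (har M x (Ident C B) \<star>\<^bsub>M\<^esub> Ident C X'))
    = h \<cdot> (ev M X' B \<cdot> (har M x (Ident C B) \<star>\<^bsub>M\<^esub> Ident C X'))"
    using assms by (intro chain) simp_all
  then show ?thesis using assms by (simp add: 3 2)
qed

lemma dual_simps [simp]:
  "fob (dual_fun C M K) A = hob M A K" "far (dual_fun C M K) f = har M f (Ident C K)"
  by (simp_all add: dual_fun_def)

lemma dual_functor:
  assumes "K \<in> Obj C"
  shows "is_functor C (op_cat C) (dual_fun C M K)"
  by (rule is_functorI) (use assms in \<open>simp_all add: category category_op har_cmp\<close>)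

lemma dual_functor':
  assumes "K \<in> Obj C"
  shows "is_functor (op_cat C) C (dual_fun C M K)"
  by (rule is_functorI) (use assms in \<open>simp_all add: category category_op har_cmp\<close>)

lemma varpi_Arr [simp]:
  assumes "A \<in> Obj C" "K \<in> Obj C"
  shows "varpi C M K A \<in> Arr C" "Dom C (varpi C M K A) = A"
    "Cod C (varpi C M K A) = hob M (hob M A K) K"
  using assms by (simp_all add: varpi_def ev_r_def)

lemma ev_varpi:
  assumes "A \<in> Obj C" "K \<in> Obj C"
  shows "ev M (hob M A K) K \<cdot> (varpi C M K A \<star>\<^bsub>M\<^esub> Ident C (hob M A K)) = ev M A K \<cdot> symm M (A, hob M A K)"
  using assms by (simp add: varpi_def ev_r_def)

text \<open>Inverse of \<open>curry_ar\<close>. Equations between arrows into \<open>[X, K]\<close>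
  are tested through it, as equations into a right adjoint are tested through the counit.\<close>

definition uncurry :: "'o \<Rightarrow> 'o \<Rightarrow> 'm \<Rightarrow> 'm" where
  "uncurry X K k = ev M X K \<cdot> (k \<star>\<^bsub>M\<^esub> Ident C X)"

lemma uncurry_Arr [simp]:
  assumes "k \<in> Arr C" "Cod C k = hob M X K" "X \<in> Obj C" "K \<in> Obj C"
  shows "uncurry X K k \<in> Arr C" "Dom C (uncurry X K k) = Dom C k \<odot>\<^bsub>M\<^esub> X" "Cod C (uncurry X K k) = K"
  using assms by (simp_all add: uncurry_def)

lemma uncurry_inject:
  assumes "uncurry X K k = uncurry X K k'" "k \<in> Arr C" "k' \<in> Arr C" "Cod C k = hob M X K"
    "Cod C k' = hob M X K" "Dom C k = Dom C k'" "X \<in> Obj C" "K \<in> Obj C"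
  shows "k = k'"
  using ev_ext[of k k' X K] assms by (simp add: uncurry_def)

lemma uncurry_cmp:
  assumes "k \<in> Arr C" "Cod C k = hob M X K" "h \<in> Arr C" "Cod C h = Dom C k" "X \<in> Obj C" "K \<in> Obj C"
  shows "uncurry X K (k \<cdot> h) = uncurry X K k \<cdot> (h \<star>\<^bsub>M\<^esub> Ident C X)"
  using assms by (simp add: uncurry_def)

text \<open>By dinaturality of evaluation, \<open>x\<close> acts on the second argument of the
  transpose and \<open>h\<close> on its value.\<close>

lemma uncurry_har:
  assumes "k \<in> Arr C" "Cod C k = hob M X K" "x \<in> Arr C" "h \<in> Arr C" "Dom C x = X'" "Cod C x = X"
    "Dom C h = K" "Cod C h = K'"
  shows "uncurry X' K' (har M x h \<cdot> k) = h \<cdot> (uncurry X K k \<cdot> (Ident C (Dom C k) \<star>\<^bsub>M\<^esub> x))"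
proof -
  have [simp]: "X \<in> Obj C" "X' \<in> Obj C" "K \<in> Obj C" "K' \<in> Obj C" using assms by auto
  have "uncurry X' K' (har M x h \<cdot> k)
    = ev M X' K' \<cdot> ((har M x h \<star>\<^bsub>M\<^esub> Ident C X') \<cdot> (k \<star>\<^bsub>M\<^esub> Ident C X'))"
    using assms by (simp add: uncurry_def)
  also have "\<dots> = h \<cdot> (ev M X K \<cdot> (k \<star>\<^bsub>M\<^esub> x))"
    using assms ev_har[of x h X X' K K']
    by (subst chain1[of _ _ "h \<cdot> (ev M X K \<cdot> (Ident C (hob M X K) \<star>\<^bsub>M\<^esub> x))"]) simp_all
  finally show ?thesis using assms by (simp add: uncurry_def)
qed

lemma uncurry_dual:
  assumes "k \<in> Arr C" "Cod C k = hob M X K" "x \<in> Arr C" "Dom C x = X'" "Cod C x = X" "K \<in> Obj C"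
  shows "uncurry X' K (har M x (Ident C K) \<cdot> k) = uncurry X K k \<cdot> (Ident C (Dom C k) \<star>\<^bsub>M\<^esub> x)"
  using uncurry_har[of k X K x "Ident C K" X' K] assms by (auto simp: dest: sym)

lemma uncurry_har_Arr:
  assumes "x \<in> Arr C" "h \<in> Arr C" "Dom C x = X'" "Cod C x = X" "Dom C h = K" "Cod C h = K'"
  shows "uncurry X' K' (har M x h) = h \<cdot> (ev M X K \<cdot> (Ident C (hob M X K) \<star>\<^bsub>M\<^esub> x))"
  using assms by (simp add: uncurry_def ev_har)

lemma uncurry_varpi:
  assumes "A \<in> Obj C" "K \<in> Obj C"
  shows "uncurry (hob M A K) K (varpi C M K A) = ev M A K \<cdot> symm M (A, hob M A K)"
  using assms by (simp add: uncurry_def ev_varpi)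

lemma uncurry_curry [simp]:
  assumes "A \<in> Obj C" "X \<in> Obj C" "h \<in> Arr C" "Dom C h = A \<odot>\<^bsub>M\<^esub> X" "Cod C h = B"
  shows "uncurry X B (curry_ar C M A X h) = h"
  using assms by (simp add: uncurry_def)

section \<open>The biduality morphism and the dualities \<open>D_K\<close>\<close>

lemma dual_at_simps [simp]:
  "ucat (dual_at C M K) = C" "dual (dual_at C M K) = dual_fun C M K" "bidual (dual_at C M K) = varpi C M K"
  by (simp_all add: dual_at_def)

text \<open>Both sides transpose to arrows on \<open>Dom C f \<otimes> [Cod C f, K]\<close>.
  Naturality of the symmetry and dinaturality of evaluation carry \<open>f\<close> from one factor
  to the other.\<close>

lemma varpi_nat:
  assumes "K \<in> Obj C" "f \<in> Arr C"
  shows "varpi C M K (Cod C f) \<cdot> f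
    = har M (har M f (Ident C K)) (Ident C K) \<cdot> varpi C M K (Dom C f)"
proof (rule uncurry_inject[where X = "hob M (Cod C f) K" and K = K])
  let ?A = "Dom C f" and ?B = "Cod C f"
  have "uncurry (hob M ?B K) K (varpi C M K ?B \<cdot> f)
    = ev M ?B K \<cdot> (symm M (?B, hob M ?B K) \<cdot> (f \<star>\<^bsub>M\<^esub> Ident C (hob M ?B K)))"
    using assms by (simp add: uncurry_cmp uncurry_varpi)
  also have "\<dots> = ev M ?B K \<cdot> ((Ident C (hob M ?B K) \<star>\<^bsub>M\<^esub> f) \<cdot> symm M (?A, hob M ?B K))"
    using symm_nat[of f "Ident C (hob M ?B K)"] assms by simp
  also have "\<dots> = ev M ?A K \<cdot> ((har M f (Ident C K) \<star>\<^bsub>M\<^esub> Ident C ?A) \<cdot> symm M (?A, hob M ?B K))"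
    using assms ev_har[of f "Ident C K" ?B ?A K K] by (intro chain[symmetric]) simp_all
  also have "\<dots> = ev M ?A K \<cdot> (symm M (?A, hob M ?A K) \<cdot> (Ident C ?A \<star>\<^bsub>M\<^esub> har M f (Ident C K)))"
    using symm_nat[of "Ident C ?A" "har M f (Ident C K)"] assms by simp
  finally show "uncurry (hob M ?B K) K (varpi C M K ?B \<cdot> f)
    = uncurry (hob M ?B K) K (har M (har M f (Ident C K)) (Ident C K) \<cdot> varpi C M K ?A)"
    using assms by (simp add: uncurry_dual uncurry_varpi)
qed (use assms in simp_all)

lemma category_with_duality_dual_at:
  assumes K: "K \<in> Obj C"
  shows "category_with_duality (dual_at C M K)"
proof -
  have "nat_trans C C id_fun (dual_fun C M K \<circ>\<^sub>F dual_fun C M K) (varpi C M K)"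
  proof (rule nat_transI)
    show "is_functor C C (dual_fun C M K \<circ>\<^sub>F dual_fun C M K)"
      by (rule is_functorI) (use K in \<open>simp_all add: category har_cmp\<close>)
  qed (use K varpi_nat in \<open>simp_all add: functor_id category\<close>)
  \<comment> \<open>The triangle identity: in the transpose each \<open>varpi\<close> contributes
    one symmetry, and the two cancel.\<close>
  moreover have "har M (varpi C M K A) (Ident C K) \<cdot> varpi C M K (hob M A K) = Ident C (hob M A K)"
    if A: "A \<in> Obj C" for A
  proof (rule uncurry_inject[where X = A and K = K])
    let ?D = "hob M A K"
    have "ev M ?D K \<cdot> (symm M (?D, hob M ?D K) \<cdot> (Ident C ?D \<star>\<^bsub>M\<^esub> varpi C M K A))
      = ev M ?D K \<cdot> ((varpi C M K A \<star>\<^bsub>M\<^esub> Ident C ?D) \<cdot> symm M (?D, A))"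
      using symm_nat[of "Ident C ?D" "varpi C M K A"] A K by simp
    also have "\<dots> = ev M A K"
      using A K by (subst chain1[OF ev_varpi]) simp_all
    finally show "uncurry A K (har M (varpi C M K A) (Ident C K) \<cdot> varpi C M K ?D) = uncurry A K (Ident C ?D)"
      using A K by (simp add: uncurry_dual uncurry_varpi) (simp add: uncurry_def)
  qed (use A K in simp_all)
  ultimately show ?thesis
    unfolding category_with_duality_def using dual_functor[OF K] by simp
qed

end

section \<open>Dualities and lax symmetric functors\<close>

locale lax = C: smclosed C M + D: smclosed D N + F: ftor C D F
  for C :: "('o, 'm) cat" and M and D :: "('p, 'n) cat" (structure) and N and F +
  fixes l :: "'o \<Rightarrow> 'o \<Rightarrow> 'n"
  assumes lam_Arr [simp]: "A \<in> Obj C \<Longrightarrow> B \<in> Obj C \<Longrightarrow> l A B \<in> Arr D"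
    and Dom_lam [simp]: "A \<in> Obj C \<Longrightarrow> B \<in> Obj C \<Longrightarrow> Dom D (l A B) = fob F A \<odot>\<^bsub>N\<^esub> fob F B"
    and Cod_lam [simp]: "A \<in> Obj C \<Longrightarrow> B \<in> Obj C \<Longrightarrow> Cod D (l A B) = fob F (A \<odot>\<^bsub>M\<^esub> B)"
    and lam_nat: "f \<in> Arr C \<Longrightarrow> g \<in> Arr C \<Longrightarrow>
      l (Cod C f) (Cod C g) \<cdot> (far F f \<star>\<^bsub>N\<^esub> far F g) = far F (f \<star>\<^bsub>M\<^esub> g) \<cdot> l (Dom C f) (Dom C g)"
    and lam_symm: "A \<in> Obj C \<Longrightarrow> B \<in> Obj C \<Longrightarrow>
      far F (symm M (A, B)) \<cdot> l A B = l B A \<cdot> symm N (fob F A, fob F B)"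

text \<open>An arrow \<open>e : F L \<rightarrow> K\<close> induces \<open>\<phi>\<^sub>A : F [A, L] \<rightarrow> [F A, K]\<close> corresponding to
  \<open>F [A, L] \<otimes> F A \<rightarrow> F ([A, L] \<otimes> A) \<rightarrow> F L \<rightarrow> K\<close>.\<close>

locale lax_dual = lax C M D N F l
  for C :: "('o, 'm) cat" and M and D :: "('p, 'n) cat" (structure) and N and F and l +
  fixes L :: 'o and K :: 'p and e :: 'n and \<phi> :: "'o \<Rightarrow> 'n"
  assumes L [simp]: "L \<in> Obj C" and K [simp]: "K \<in> Obj D"
    and e [simp]: "e \<in> Arr D" "Dom D e = fob F L" "Cod D e = K"
    and phi_Arr [simp]: "A \<in> Obj C \<Longrightarrow> \<phi> A \<in> Arr D"
    and Dom_phi [simp]: "A \<in> Obj C \<Longrightarrow> Dom D (\<phi> A) = fob F (hob M A L)"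
    and Cod_phi [simp]: "A \<in> Obj C \<Longrightarrow> Cod D (\<phi> A) = hob N (fob F A) K"
    and uncurry_phi: "A \<in> Obj C \<Longrightarrow>
      D.uncurry (fob F A) K (\<phi> A) = e \<cdot> (far F (ev M A L) \<cdot> l (hob M A L) A)"
begin

text \<open>Under \<open>F\<close> this is dinaturality of \<open>ev\<close> in the source category;
  naturality of \<open>l\<close> in one variable brings \<open>f\<close> under \<open>F\<close>, and
  naturality in the other brings it out again.\<close>

lemma phi_nat:
  assumes f: "f \<in> Arr C"
  shows "\<phi> (Dom C f) \<cdot> far F (har M f (Ident C L)) = har N (far F f) (Ident D K) \<cdot> \<phi> (Cod C f)"
proof (rule D.uncurry_inject[where X = "fob F (Dom C f)" and K = K])
  let ?A = "Dom C f" and ?B = "Cod C f" and ?f' = "har M f (Ident C L)"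
  have "D.uncurry (fob F ?A) K (\<phi> ?A \<cdot> far F ?f')
    = e \<cdot> (far F (ev M ?A L) \<cdot> (l (hob M ?A L) ?A \<cdot> (far F ?f' \<star>\<^bsub>N\<^esub> far F (Ident C ?A))))"
    using f by (simp add: D.uncurry_cmp uncurry_phi)
  also have "l (hob M ?A L) ?A \<cdot> (far F ?f' \<star>\<^bsub>N\<^esub> far F (Ident C ?A))
    = far F (?f' \<star>\<^bsub>M\<^esub> Ident C ?A) \<cdot> l (hob M ?B L) ?A"
    using f lam_nat[of ?f' "Ident C ?A"] by simp
  also have "far F (ev M ?A L) \<cdot> (far F (?f' \<star>\<^bsub>M\<^esub> Ident C ?A) \<cdot> l (hob M ?B L) ?A)
    = far F (ev M ?B L) \<cdot> (far F (Ident C (hob M ?B L) \<star>\<^bsub>M\<^esub> f) \<cdot> l (hob M ?B L) ?A)"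
    using f C.ev_har[of f "Ident C L" ?B ?A L L] by (intro D.chain F.commute) simp_all
  also have "far F (Ident C (hob M ?B L) \<star>\<^bsub>M\<^esub> f) \<cdot> l (hob M ?B L) ?A
    = l (hob M ?B L) ?B \<cdot> (Ident D (fob F (hob M ?B L)) \<star>\<^bsub>N\<^esub> far F f)"
    using f lam_nat[of "Ident C (hob M ?B L)" f] by simp
  also have "e \<cdot> (far F (ev M ?B L) \<cdot> (l (hob M ?B L) ?B \<cdot> (Ident D (fob F (hob M ?B L)) \<star>\<^bsub>N\<^esub> far F f)))
    = D.uncurry (fob F ?A) K (har N (far F f) (Ident D K) \<cdot> \<phi> ?B)"
    using f by (simp add: D.uncurry_dual uncurry_phi)
  finally show "D.uncurry (fob F ?A) K (\<phi> ?A \<cdot> far F ?f')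
    = D.uncurry (fob F ?A) K (har N (far F f) (Ident D K) \<cdot> \<phi> ?B)" .
qed (use f in simp_all)

text \<open>Transposition turns each \<open>varpi\<close> into evaluation after a symmetry, one of
  them in the source under \<open>F\<close> and one in the target. What remains is
  \<open>lam_symm\<close>.\<close>

lemma phi_varpi:
  assumes A: "A \<in> Obj C"
  shows "\<phi> (hob M A L) \<cdot> far F (varpi C M L A) = har N (\<phi> A) (Ident D K) \<cdot> varpi D N K (fob F A)"
proof (rule D.uncurry_inject[where X = "fob F (hob M A L)" and K = K])
  let ?D = "hob M A L" and ?v = "varpi C M L A"
  have "D.uncurry (fob F ?D) K (\<phi> ?D \<cdot> far F ?v)
    = e \<cdot> (far F (ev M ?D L) \<cdot> (l (hob M ?D L) ?D \<cdot> (far F ?v \<star>\<^bsub>N\<^esub> far F (Ident C ?D))))"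
    using A by (simp add: D.uncurry_cmp uncurry_phi)
  also have "l (hob M ?D L) ?D \<cdot> (far F ?v \<star>\<^bsub>N\<^esub> far F (Ident C ?D))
    = far F (?v \<star>\<^bsub>M\<^esub> Ident C ?D) \<cdot> l A ?D"
    using A lam_nat[of ?v "Ident C ?D"] by simp
  also have "far F (ev M ?D L) \<cdot> (far F (?v \<star>\<^bsub>M\<^esub> Ident C ?D) \<cdot> l A ?D)
    = far F (ev M A L) \<cdot> (far F (symm M (A, ?D)) \<cdot> l A ?D)"
    using A by (intro D.chain F.commute C.ev_varpi) simp_all
  also have "far F (symm M (A, ?D)) \<cdot> l A ?D = l ?D A \<cdot> symm N (fob F A, fob F ?D)"
    using A by (simp add: lam_symm)
  also have "e \<cdot> (far F (ev M A L) \<cdot> (l ?D A \<cdot> symm N (fob F A, fob F ?D)))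
    = D.uncurry (fob F A) K (\<phi> A) \<cdot> symm N (fob F A, fob F ?D)"
    using A by (simp add: uncurry_phi)
  also have "\<dots> = ev N (fob F A) K \<cdot> ((\<phi> A \<star>\<^bsub>N\<^esub> Ident D (fob F A)) \<cdot> symm N (fob F A, fob F ?D))"
    using A by (simp add: D.uncurry_def)
  also have "(\<phi> A \<star>\<^bsub>N\<^esub> Ident D (fob F A)) \<cdot> symm N (fob F A, fob F ?D)
    = symm N (fob F A, hob N (fob F A) K) \<cdot> (Ident D (fob F A) \<star>\<^bsub>N\<^esub> \<phi> A)"
    using A D.symm_nat[of "Ident D (fob F A)" "\<phi> A"] by simp
  finally show "D.uncurry (fob F ?D) K (\<phi> ?D \<cdot> far F ?v)
    = D.uncurry (fob F ?D) K (har N (\<phi> A) (Ident D K) \<cdot> varpi D N K (fob F A))"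
    using A by (simp add: D.uncurry_dual D.uncurry_varpi)
qed (use A in simp_all)

lemma phi_nat_trans:
  "nat_trans (op_cat C) D (F \<circ>\<^sub>F dual_fun C M L) (dual_fun D N K \<circ>\<^sub>F F) \<phi>"
proof (rule nat_transI)
  show "is_functor (op_cat C) D (F \<circ>\<^sub>F dual_fun C M L)" "is_functor (op_cat C) D (dual_fun D N K \<circ>\<^sub>F F)"
    by (rule functor_comp[OF C.dual_functor' F.is_functor] functor_comp[OF F.functor_op D.dual_functor'];
        simp)+
qed (simp_all add: phi_nat)

lemma duality_preserving:
  "duality_preserving (dual_at C M L) (dual_at D N K) \<lparr>dfun = F, dphi = \<phi>\<rparr>"
  unfolding duality_preserving_def
  by (simp add: C.category_with_duality_dual_at D.category_with_duality_dual_at F.is_functor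
      phi_nat_trans phi_varpi)

end

lemma lax_comp:
  fixes E :: "('q, 'k) cat" (structure)
  assumes "lax C M D N F l" "lax D N E R G l'"
  shows "lax C M E R (G \<circ>\<^sub>F F) (\<lambda>A B. far G (l A B) \<cdot> l' (fob F A) (fob F B))"
proof -
  interpret F: lax C M D N F l by fact
  interpret G: lax D N E R G l' by fact
  show ?thesis
  proof (intro lax.intro lax_axioms.intro)
    show "smclosed C M" "smclosed E R" by unfold_locales
    show "ftor C E (G \<circ>\<^sub>F F)" by (rule ftor_of[OF functor_comp[OF F.F.is_functor G.F.is_functor]])
  next
    fix f g assume f: "f \<in> Arr C" and g: "g \<in> Arr C"
    have "far G (l (Cod C f) (Cod C g)) \<cdot> (far G (far F f \<star>\<^bsub>N\<^esub> far F g) \<cdot> l' (fob F (Dom C f)) (fob F (Dom C g)))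
      = far G (far F (f \<star>\<^bsub>M\<^esub> g)) \<cdot> (far G (l (Dom C f) (Dom C g)) \<cdot> l' (fob F (Dom C f)) (fob F (Dom C g)))"
      using f g by (intro G.D.chain G.F.commute F.lam_nat) simp_all
    then show "(far G (l (Cod C f) (Cod C g)) \<cdot> l' (fob F (Cod C f)) (fob F (Cod C g))) \<cdot>
         (far (G \<circ>\<^sub>F F) f \<star>\<^bsub>R\<^esub> far (G \<circ>\<^sub>F F) g) =
         far (G \<circ>\<^sub>F F) (f \<star>\<^bsub>M\<^esub> g) \<cdot> (far G (l (Dom C f) (Dom C g)) \<cdot> l' (fob F (Dom C f)) (fob F (Dom C g)))"
      using f g G.lam_nat[of "far F f" "far F g"] by simp
  next
    fix A B assume A: "A \<in> Obj C" and B: "B \<in> Obj C"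
    have "far G (far F (symm M (A, B))) \<cdot> (far G (l A B) \<cdot> l' (fob F A) (fob F B))
      = far G (l B A) \<cdot> (far G (symm N (fob F A, fob F B)) \<cdot> l' (fob F A) (fob F B))"
      using A B by (intro G.D.chain G.F.commute F.lam_symm) simp_all
    then show "far (G \<circ>\<^sub>F F) (symm M (A, B)) \<cdot> (far G (l A B) \<cdot> l' (fob F A) (fob F B)) =
         (far G (l B A) \<cdot> l' (fob F B) (fob F A)) \<cdot> symm R (fob (G \<circ>\<^sub>F F) A, fob (G \<circ>\<^sub>F F) B)"
      using A B by (simp add: G.lam_symm)
  qed simp_all
qed

text \<open>Naturality of \<open>l'\<close> brings \<open>far G (\<phi> A)\<close> under
  \<open>G\<close> next to evaluation, where it becomes \<open>G\<close> of the transpose of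
  \<open>\<phi> A\<close>. Both composites in the theorem are instances.\<close>

lemma lax_dual_comp:
  fixes E :: "('q, 'k) cat" (structure)
  assumes "lax_dual C M D N F l L K e \<phi>" "lax_dual D N E R G l' K H e' \<phi>'"
  shows "lax_dual C M E R (G \<circ>\<^sub>F F) (\<lambda>A B. far G (l A B) \<cdot> l' (fob F A) (fob F B)) L H
    (e' \<cdot> far G e) (\<lambda>A. \<phi>' (fob F A) \<cdot> far G (\<phi> A))"
proof -
  interpret F: lax_dual C M D N F l L K e \<phi> by fact
  interpret G: lax_dual D N E R G l' K H e' \<phi>' by fact
  show ?thesis
  proof (intro lax_dual.intro lax_comp lax_dual_axioms.intro)
    fix A assume A: "A \<in> Obj C"
    let ?D = "hob M A L" and ?FA = "fob F A"
    have "G.D.uncurry (fob G ?FA) H (\<phi>' ?FA \<cdot> far G (\<phi> A))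
      = e' \<cdot> (far G (ev N ?FA K) \<cdot> (l' (hob N ?FA K) ?FA \<cdot> (far G (\<phi> A) \<star>\<^bsub>R\<^esub> far G (Ident D ?FA))))"
      using A by (simp add: G.D.uncurry_cmp G.uncurry_phi)
    also have "l' (hob N ?FA K) ?FA \<cdot> (far G (\<phi> A) \<star>\<^bsub>R\<^esub> far G (Ident D ?FA))
      = far G (\<phi> A \<star>\<^bsub>N\<^esub> Ident D ?FA) \<cdot> l' (fob F ?D) ?FA"
      using A G.lam_nat[of "\<phi> A" "Ident D ?FA"] by simp
    also have "far G (ev N ?FA K) \<cdot> (far G (\<phi> A \<star>\<^bsub>N\<^esub> Ident D ?FA) \<cdot> l' (fob F ?D) ?FA)
      = far G (F.D.uncurry ?FA K (\<phi> A)) \<cdot> l' (fob F ?D) ?FA"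
      using A by (simp add: F.D.uncurry_def)
    finally show "G.D.uncurry (fob (G \<circ>\<^sub>F F) A) H (\<phi>' ?FA \<cdot> far G (\<phi> A)) =
       (e' \<cdot> far G e) \<cdot> (far (G \<circ>\<^sub>F F) (ev M A L) \<cdot> (far G (l ?D A) \<cdot> l' (fob F ?D) ?FA))"
      using A by (simp add: F.uncurry_phi)
  qed (use F.lax_axioms G.lax_axioms in simp_all)
qed

lemma lax_id:
  assumes "symmetric_monoidal_closed C M"
  shows "lax C M C M id_fun (\<lambda>A B. Ident C (A \<odot>\<^bsub>M\<^esub> B))"
proof -
  interpret smclosed C M by unfold_locales fact
  show ?thesis
    by (intro lax.intro lax_axioms.intro ftor_of functor_id category smclosed_axioms) simp_all
qed

lemma lax_dual_change:
  assumes "symmetric_monoidal_closed C M" "\<iota> \<in> homs C L L'"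
  shows "lax_dual C M C M id_fun (\<lambda>A B. Ident C (A \<odot>\<^bsub>M\<^esub> B)) L L' \<iota> (\<lambda>A. har M (Ident C A) \<iota>)"
proof -
  interpret smclosed C M by unfold_locales fact
  show ?thesis
    using assms
    by (intro lax_dual.intro lax_id lax_dual_axioms.intro) (auto simp: uncurry_har_Arr)
qed

locale lax_transformation =
  F: lax_dual C M D N F l L K e \<phi> + F': lax_dual C M D N F' l' L K e' \<phi>'
  for C :: "('o, 'm) cat" and M and D :: "('p, 'n) cat" (structure) and N and F l F' l' L K e \<phi> e' \<phi>' +
  fixes \<rho> :: "'o \<Rightarrow> 'n"
  assumes rho: "nat_trans C D F F' \<rho>"
    and rho_tens: "A \<in> Obj C \<Longrightarrow> B \<in> Obj C \<Longrightarrow>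
      l' A B \<cdot> (\<rho> A \<star>\<^bsub>N\<^esub> \<rho> B) = \<rho> (A \<odot>\<^bsub>M\<^esub> B) \<cdot> l A B"
    and e_rho: "e = e' \<cdot> \<rho> L"
begin

lemmas rho_simps [simp] = nat_transD(3-5)[OF rho]
  and rho_nat = nat_transD(6)[OF rho]

text \<open>In the transpose of the right-hand side, \<open>\<rho> A\<close> acts on the second
  factor and \<open>\<rho>\<close> at the dual of \<open>A\<close> on the first, so that
  \<open>\<rho> \<otimes> \<rho>\<close> appears. The left-hand side reaches the same arrow by
  \<open>e_rho\<close>, naturality of \<open>\<rho>\<close> at \<open>ev\<close>, and
  \<open>rho_tens\<close>.\<close>

lemma duality_morphism:
  "duality_morphism (dual_at C M L) (dual_at D N K) \<lparr>dfun = F, dphi = \<phi>\<rparr> \<lparr>dfun = F', dphi = \<phi>'\<rparr> \<rho>"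
proof -
  have "\<phi> A = har N (\<rho> A) (Ident D K) \<cdot> (\<phi>' A \<cdot> \<rho> (hob M A L))" if A: "A \<in> Obj C" for A
  proof (rule F.D.uncurry_inject[where X = "fob F A" and K = K])
    let ?D = "hob M A L"
    have "F.D.uncurry (fob F A) K (\<phi> A)
      = e' \<cdot> (\<rho> L \<cdot> (far F (ev M A L) \<cdot> l ?D A))"
      using A by (simp add: F.uncurry_phi e_rho)
    also have "\<rho> L \<cdot> (far F (ev M A L) \<cdot> l ?D A)
      = far F' (ev M A L) \<cdot> (\<rho> (?D \<odot>\<^bsub>M\<^esub> A) \<cdot> l ?D A)"
      using A rho_nat[of "ev M A L"] by (intro F.D.chain) simp_all
    also have "\<rho> (?D \<odot>\<^bsub>M\<^esub> A) \<cdot> l ?D A = l' ?D A \<cdot> (\<rho> ?D \<star>\<^bsub>N\<^esub> \<rho> A)"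
      using A by (simp add: rho_tens)
    finally show "F.D.uncurry (fob F A) K (\<phi> A)
      = F.D.uncurry (fob F A) K (har N (\<rho> A) (Ident D K) \<cdot> (\<phi>' A \<cdot> \<rho> ?D))"
      using A by (subst F.D.uncurry_dual[where X = "fob F' A"]) (simp_all add: F.D.uncurry_cmp F'.uncurry_phi)
  qed (use A in simp_all)
  then show ?thesis
    unfolding duality_morphism_def
    using F.duality_preserving F'.duality_preserving rho by simp
qed

end

section \<open>Conjugate transformations\<close>

text \<open>Used twice. With left adjoints \<open>f^* g^*\<close> and \<open>(gf)^*\<close> and the
  isomorphism \<open>a\<close> it gives \<open>b\<close>; with left adjoints \<open>(gf)_*\<close>
  and \<open>g_* f_*\<close> and the isomorphism \<open>b\<close> it gives \<open>c\<close>.\<close>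

locale conjugate = A: adj C D F G \<eta> \<epsilon> + A': adj C D F' G' \<eta>' \<epsilon>'
  for C :: "('o, 'm) cat" and D :: "('p, 'n) cat" (structure) and F G \<eta> \<epsilon> F' G' \<eta>' \<epsilon>' +
  fixes a :: "'o \<Rightarrow> 'n"
  assumes a: "nat_iso C D F F' a"
begin

lemma a_iso [simp]: "A \<in> Obj C \<Longrightarrow> iso_arrow D (a A)"
  using a by (simp add: nat_iso_def)

lemmas a_simps [simp] = nat_transD(3-5)[OF conjunct1[OF a[unfolded nat_iso_def]]]
  and a_nat = nat_transD(6)[OF conjunct1[OF a[unfolded nat_iso_def]]]

text \<open>The Yoneda element of
  \<open>Hom (A, G' B) = Hom (F' A, B) -> Hom (F A, B) = Hom (A, G B)\<close>, where the middle map
  is composition with \<open>a\<close>: it is the image of the identity of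
  \<open>G' B\<close>.\<close>

definition conj_ar :: "'p \<Rightarrow> 'm" where
  "conj_ar B = far G (\<epsilon>' B \<cdot> a (fob G' B)) \<cdot>\<^bsub>C\<^esub> \<eta> (fob G' B)"

lemma conj_simps [simp]:
  assumes "B \<in> Obj D"
  shows "conj_ar B \<in> Arr C" "Dom C (conj_ar B) = fob G' B" "Cod C (conj_ar B) = fob G B"
  using assms by (simp_all add: conj_ar_def)

text \<open>The characterization of the conjugate by its transpose. For \<open>c\<close> this
  equation is the condition \<open>e_rho\<close>.\<close>

lemma counit_conj:
  assumes "B \<in> Obj D"
  shows "\<epsilon> B \<cdot> far F (conj_ar B) = \<epsilon>' B \<cdot> a (fob G' B)"
  using assms unfolding conj_ar_def by (intro A.sharp_flat) simp_all

lemma counit_conj_cmp: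
  assumes "B \<in> Obj D" "h \<in> Arr C" "Cod C h = fob G' B"
  shows "\<epsilon> B \<cdot> (far F (conj_ar B) \<cdot> far F h) = \<epsilon>' B \<cdot> (far F' h \<cdot> a (Dom C h))"
proof -
  have "\<epsilon> B \<cdot> (far F (conj_ar B) \<cdot> far F h) = \<epsilon>' B \<cdot> (a (fob G' B) \<cdot> far F h)"
    using assms by (intro A.F.D.chain counit_conj) simp_all
  then show ?thesis using assms a_nat[OF assms(2)] by simp
qed

text \<open>The right-hand side is the value at \<open>h\<close> of the composite of Hom bijections
  that specifies \<open>b\<close> or \<open>c\<close>; the lemma is what identifies
  \<open>b_ar\<close> and \<open>c_ar\<close> with \<open>conj_ar\<close>.\<close>

lemma conj_cmp:
  assumes "B \<in> Obj D" "h \<in> Arr C" "Cod C h = fob G' B"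
  shows "conj_ar B \<cdot>\<^bsub>C\<^esub> h = far G (\<epsilon>' B \<cdot> (far F' h \<cdot> a (Dom C h))) \<cdot>\<^bsub>C\<^esub> \<eta> (Dom C h)"
proof (rule A.sharp_inject[where B = B])
  have "\<epsilon> B \<cdot> far F (conj_ar B \<cdot>\<^bsub>C\<^esub> h) = \<epsilon>' B \<cdot> (far F' h \<cdot> a (Dom C h))"
    using assms by (simp add: counit_conj_cmp)
  then show "\<epsilon> B \<cdot> far F (conj_ar B \<cdot>\<^bsub>C\<^esub> h)
    = \<epsilon> B \<cdot> far F (far G (\<epsilon>' B \<cdot> (far F' h \<cdot> a (Dom C h))) \<cdot>\<^bsub>C\<^esub> \<eta> (Dom C h))"
    using assms by (subst A.sharp_flat) simp_all
qed (use assms in simp_all)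

lemma conj_nat_iso: "nat_iso D C G' G conj_ar"
  unfolding nat_iso_def
proof (intro conjI ballI nat_transI)
  show "is_functor D C G'" "is_functor D C G" by (rule A'.G.is_functor A.G.is_functor)+
next
  fix f assume f: "f \<in> Arr D"
  show "conj_ar (Cod D f) \<cdot>\<^bsub>C\<^esub> far G' f = far G f \<cdot>\<^bsub>C\<^esub> conj_ar (Dom D f)"
    by (rule A.sharp_inject[where B = "Cod D f"]) (use f in \<open>simp_all add: counit_conj_cmp counit_conj\<close>)
next
  fix B assume B: "B \<in> Obj D"
  let ?i = "inv_arrow D (a (fob G B))"
  \<comment> \<open>The conjugate of the inverse of \<open>a\<close>, that is, the same formula with
    the two adjunctions exchanged; it is the inverse of \<open>conj_ar B\<close>.\<close>
  let ?c = "far G' (\<epsilon> B \<cdot> ?i) \<cdot>\<^bsub>C\<^esub> \<eta>' (fob G B)"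
  have c: "\<epsilon>' B \<cdot> far F' ?c = \<epsilon> B \<cdot> ?i"
    using B by (intro A'.sharp_flat) simp_all
  have [simp]: "?c \<in> Arr C" "Dom C ?c = fob G B" "Cod C ?c = fob G' B" using B by simp_all
  show "iso_arrow C (conj_ar B)"
  proof (rule A.F.C.iso_arrowI[where g = ?c])
    show "?c \<cdot>\<^bsub>C\<^esub> conj_ar B = Ident C (Dom C (conj_ar B))"
    proof (rule A'.sharp_inject[where B = B])
      have "\<epsilon>' B \<cdot> (far F' ?c \<cdot> far F' (conj_ar B)) = \<epsilon> B \<cdot> (?i \<cdot> far F' (conj_ar B))"
        using B by (intro A.F.D.chain c) simp_all
      \<comment> \<open>Naturality of the inverse of \<open>a\<close> at \<open>conj_ar B\<close>,
        obtained by cancelling \<open>a\<close> on the right.\<close>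
      also have "?i \<cdot> far F' (conj_ar B) = far F (conj_ar B) \<cdot> inv_arrow D (a (fob G' B))"
      proof (rule A.F.D.iso_epi[of "a (fob G' B)"])
        have "?i \<cdot> (far F' (conj_ar B) \<cdot> a (fob G' B)) = ?i \<cdot> (a (fob G B) \<cdot> far F (conj_ar B))"
          using B a_nat[of "conj_ar B"] by simp
        then show "(?i \<cdot> far F' (conj_ar B)) \<cdot> a (fob G' B)
          = (far F (conj_ar B) \<cdot> inv_arrow D (a (fob G' B))) \<cdot> a (fob G' B)"
          using B by simp
      qed (use B in simp_all)
      also have "\<epsilon> B \<cdot> (far F (conj_ar B) \<cdot> inv_arrow D (a (fob G' B)))
        = \<epsilon>' B \<cdot> (a (fob G' B) \<cdot> inv_arrow D (a (fob G' B)))"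
        using B by (intro A.F.D.chain counit_conj) simp_all
      finally show "\<epsilon>' B \<cdot> far F' (?c \<cdot>\<^bsub>C\<^esub> conj_ar B) = \<epsilon>' B \<cdot> far F' (Ident C (Dom C (conj_ar B)))"
        using B by (simp add: A'.F.far_cmp[of "conj_ar B" ?c])
    qed (use B in simp_all)
    show "conj_ar B \<cdot>\<^bsub>C\<^esub> ?c = Ident C (Cod C (conj_ar B))"
    proof (rule A.sharp_inject[where B = B])
      have "\<epsilon> B \<cdot> (far F (conj_ar B) \<cdot> far F ?c) = \<epsilon>' B \<cdot> (far F' ?c \<cdot> a (fob G B))"
        using B counit_conj_cmp[of B ?c] by simp
      also have "\<dots> = \<epsilon> B \<cdot> (?i \<cdot> a (fob G B))"
        using B by (intro A.F.D.chain c) simp_all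
      finally show "\<epsilon> B \<cdot> far F (conj_ar B \<cdot>\<^bsub>C\<^esub> ?c) = \<epsilon> B \<cdot> far F (Ident C (Cod C (conj_ar B)))"
        using B by (simp add: A.F.far_cmp[of ?c "conj_ar B"])
    qed (use B in simp_all)
  qed (use B in simp_all)
qed (simp_all)

end

section \<open>Right adjoints of symmetric monoidal functors\<close>

locale monoidal_adj = C: smclosed C M + D: smclosed D N + adj C D F G \<eta> \<epsilon>
  for C :: "('o, 'm) cat" and M and D :: "('p, 'n) cat" (structure) and N and F G \<eta> \<epsilon> +
  fixes \<alpha> :: "'o \<times> 'o \<Rightarrow> 'n"
  assumes alpha_iso: "nat_iso (prod_cat C C) D (tens N \<circ>\<^sub>F (F \<times>\<^sub>F F)) (F \<circ>\<^sub>F tens M) \<alpha>"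
    and alpha_symm: "A \<in> Obj C \<Longrightarrow> B \<in> Obj C \<Longrightarrow>
      far F (symm M (A, B)) \<cdot> \<alpha> (A, B) = \<alpha> (B, A) \<cdot> symm N (fob F A, fob F B)"
begin

lemma alpha_iso_arrow [simp]: "A \<in> Obj C \<Longrightarrow> B \<in> Obj C \<Longrightarrow> iso_arrow D (\<alpha> (A, B))"
  and alpha_Arr [simp]: "A \<in> Obj C \<Longrightarrow> B \<in> Obj C \<Longrightarrow> \<alpha> (A, B) \<in> Arr D"
  and Dom_alpha [simp]: "A \<in> Obj C \<Longrightarrow> B \<in> Obj C \<Longrightarrow> Dom D (\<alpha> (A, B)) = fob F A \<odot>\<^bsub>N\<^esub> fob F B"
  and Cod_alpha [simp]: "A \<in> Obj C \<Longrightarrow> B \<in> Obj C \<Longrightarrow> Cod D (\<alpha> (A, B)) = fob F (A \<odot>\<^bsub>M\<^esub> B)"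
  and alpha_nat: "f \<in> Arr C \<Longrightarrow> g \<in> Arr C \<Longrightarrow>
    \<alpha> (Cod C f, Cod C g) \<cdot> (far F f \<star>\<^bsub>N\<^esub> far F g) = far F (f \<star>\<^bsub>M\<^esub> g) \<cdot> \<alpha> (Dom C f, Dom C g)"
  using nat_transD(3-5)[OF alpha_iso[unfolded nat_iso_def, THEN conjunct1], of "(A, B)"]
    nat_transD(6)[OF alpha_iso[unfolded nat_iso_def, THEN conjunct1], of "(f, g)"] alpha_iso[unfolded nat_iso_def]
  by simp_all
definition lam :: "'p \<Rightarrow> 'p \<Rightarrow> 'm" where
  "lam A B = far G (\<epsilon> A \<star>\<^bsub>N\<^esub> \<epsilon> B) \<cdot>\<^bsub>C\<^esub> far G (inv_arrow D (\<alpha> (fob G A, fob G B)))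
     \<cdot>\<^bsub>C\<^esub> \<eta> (fob G A \<odot>\<^bsub>M\<^esub> fob G B)"

lemma lam_simps [simp]:
  assumes "A \<in> Obj D" "B \<in> Obj D"
  shows "lam A B \<in> Arr C" "Dom C (lam A B) = fob G A \<odot>\<^bsub>M\<^esub> fob G B" "Cod C (lam A B) = fob G (A \<odot>\<^bsub>N\<^esub> B)"
  using assms by (simp_all add: lam_def)

text \<open>Precomposing the transpose with \<open>\<alpha>\<close> cancels the inverse that occurs
  in \<open>lam\<close>. Later computations use this equation, which contains no inverse
  arrow.\<close>

lemma lam_alpha:
  assumes "A \<in> Obj D" "B \<in> Obj D"
  shows "\<epsilon> (A \<odot>\<^bsub>N\<^esub> B) \<cdot> (far F (lam A B) \<cdot> \<alpha> (fob G A, fob G B)) = \<epsilon> A \<star>\<^bsub>N\<^esub> \<epsilon> B"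
proof -
  have "\<epsilon> (A \<odot>\<^bsub>N\<^esub> B) \<cdot> far F (lam A B) = (\<epsilon> A \<star>\<^bsub>N\<^esub> \<epsilon> B) \<cdot> inv_arrow D (\<alpha> (fob G A, fob G B))"
    using assms by (simp add: lam_def)
  from D.chain[OF this, of "\<alpha> (fob G A, fob G B)"] assms show ?thesis by simp
qed

lemma lam_alpha_chain:
  assumes "A \<in> Obj D" "B \<in> Obj D" "x \<in> Arr D" "Cod D x = fob F (fob G A) \<odot>\<^bsub>N\<^esub> fob F (fob G B)"
  shows "\<epsilon> (A \<odot>\<^bsub>N\<^esub> B) \<cdot> (far F (lam A B) \<cdot> (\<alpha> (fob G A, fob G B) \<cdot> x)) = (\<epsilon> A \<star>\<^bsub>N\<^esub> \<epsilon> B) \<cdot> x"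
  using assms by (intro D.chain3 lam_alpha) simp_all

text \<open>Transposition is injective and \<open>\<alpha>\<close> is epi, so arrows from a tensor
  product into \<open>G E\<close> may be compared after both operations.\<close>

lemma tens_inject:
  assumes "k \<in> Arr C" "k' \<in> Arr C" "Cod C k = fob G E" "Cod C k' = fob G E" "Dom C k' = Dom C k"
    "E \<in> Obj D" "A \<in> Obj C" "B \<in> Obj C" "Dom C k = A \<odot>\<^bsub>M\<^esub> B"
    and "\<epsilon> E \<cdot> (far F k \<cdot> \<alpha> (A, B)) = \<epsilon> E \<cdot> (far F k' \<cdot> \<alpha> (A, B))"
  shows "k = k'"
proof (rule sharp_inject[where B = E])
  show "\<epsilon> E \<cdot> far F k = \<epsilon> E \<cdot> far F k'"
    by (rule D.iso_epi[of "\<alpha> (A, B)"]) (use assms in simp_all)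
qed (use assms in simp_all)

text \<open>The test \<open>tens_inject\<close> reduces naturality of \<open>lam\<close> to that of
  \<open>\<alpha>\<close> and of the counit, and its symmetry to \<open>alpha_symm\<close> and
  naturality of the symmetry at a pair of counits.\<close>

lemma lax_lam: "lax D N C M G lam"
proof (intro lax.intro lax_axioms.intro)
  show "smclosed C M" "smclosed D N" "ftor D C G" by unfold_locales
next
  fix f g assume f: "f \<in> Arr D" and g: "g \<in> Arr D"
  show "lam (Cod D f) (Cod D g) \<cdot>\<^bsub>C\<^esub> (far G f \<star>\<^bsub>M\<^esub> far G g) = far G (f \<star>\<^bsub>N\<^esub> g) \<cdot>\<^bsub>C\<^esub> lam (Dom D f) (Dom D g)"
  proof (rule tens_inject[where E = "Cod D f \<odot>\<^bsub>N\<^esub> Cod D g" and A = "fob G (Dom D f)" and B = "fob G (Dom D g)"])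
    show "\<epsilon> (Cod D f \<odot>\<^bsub>N\<^esub> Cod D g) \<cdot> (far F (lam (Cod D f) (Cod D g) \<cdot>\<^bsub>C\<^esub> (far G f \<star>\<^bsub>M\<^esub> far G g)) \<cdot>
        \<alpha> (fob G (Dom D f), fob G (Dom D g))) =
      \<epsilon> (Cod D f \<odot>\<^bsub>N\<^esub> Cod D g) \<cdot> (far F (far G (f \<star>\<^bsub>N\<^esub> g) \<cdot>\<^bsub>C\<^esub> lam (Dom D f) (Dom D g)) \<cdot>
        \<alpha> (fob G (Dom D f), fob G (Dom D g)))"
      using f g alpha_nat[of "far G f" "far G g", symmetric] by (simp add: lam_alpha lam_alpha_chain)
  qed (use f g in simp_all)
next
  fix A B assume A: "A \<in> Obj D" and B: "B \<in> Obj D"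
  show "far G (symm N (A, B)) \<cdot>\<^bsub>C\<^esub> lam A B = lam B A \<cdot>\<^bsub>C\<^esub> symm M (fob G A, fob G B)"
  proof (rule tens_inject[where E = "B \<odot>\<^bsub>N\<^esub> A" and A = "fob G A" and B = "fob G B"])
    show "\<epsilon> (B \<odot>\<^bsub>N\<^esub> A) \<cdot> (far F (far G (symm N (A, B)) \<cdot>\<^bsub>C\<^esub> lam A B) \<cdot> \<alpha> (fob G A, fob G B)) =
      \<epsilon> (B \<odot>\<^bsub>N\<^esub> A) \<cdot> (far F (lam B A \<cdot>\<^bsub>C\<^esub> symm M (fob G A, fob G B)) \<cdot> \<alpha> (fob G A, fob G B))"
      using A B D.symm_nat[of "\<epsilon> A" "\<epsilon> B"] by (simp add: lam_alpha lam_alpha_chain alpha_symm)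
  qed (use A B in simp_all)
qed simp_all

end

text \<open>Puts \<open>f^* g^*\<close> with its right adjoint \<open>g_* f_*\<close> on the same
  footing as \<open>(gf)^*\<close> with \<open>(gf)_*\<close>, so that the two can be compared as
  conjugates.\<close>

lemma monoidal_adj_comp:
  fixes E :: "('q, 'k) cat" (structure)
  assumes "monoidal_adj C M D N F G \<eta> \<epsilon> \<alpha>" "monoidal_adj D N E R F' G' \<eta>' \<epsilon>' \<alpha>'"
  shows "monoidal_adj C M E R (F' \<circ>\<^sub>F F) (G \<circ>\<^sub>F G') (\<lambda>A. far G (\<eta>' (fob F A)) \<cdot>\<^bsub>C\<^esub> \<eta> A)
    (\<lambda>B. \<epsilon>' B \<cdot> far F' (\<epsilon> (fob G' B)))
    (\<lambda>(A, B). far F' (\<alpha> (A, B)) \<cdot> \<alpha>' (fob F A, fob F B))"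
proof -
  interpret A: monoidal_adj C M D N F G \<eta> \<epsilon> \<alpha> by fact
  interpret B: monoidal_adj D N E R F' G' \<eta>' \<epsilon>' \<alpha>' by fact
  show ?thesis
  proof (intro monoidal_adj.intro monoidal_adj_axioms.intro)
    show "smclosed C M" "smclosed E R" by unfold_locales
    show "adj C E (F' \<circ>\<^sub>F F) (G \<circ>\<^sub>F G') (\<lambda>A. far G (\<eta>' (fob F A)) \<cdot>\<^bsub>C\<^esub> \<eta> A)
      (\<lambda>B. \<epsilon>' B \<cdot> far F' (\<epsilon> (fob G' B)))"
      by (rule adj_of[OF adjunction_comp[OF A.adjunction B.adjunction]])
    have "(far F' (\<alpha> (Cod C f, Cod C g)) \<cdot> \<alpha>' (fob F (Cod C f), fob F (Cod C g))) \<cdot>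
        (far F' (far F f) \<star>\<^bsub>R\<^esub> far F' (far F g)) =
      far F' (far F (f \<star>\<^bsub>M\<^esub> g)) \<cdot> (far F' (\<alpha> (Dom C f, Dom C g)) \<cdot> \<alpha>' (fob F (Dom C f), fob F (Dom C g)))"
      if f: "f \<in> Arr C" and g: "g \<in> Arr C" for f g
    proof -
      have "far F' (far F (f \<star>\<^bsub>M\<^esub> g)) \<cdot> (far F' (\<alpha> (Dom C f, Dom C g)) \<cdot> \<alpha>' (fob F (Dom C f), fob F (Dom C g)))
       = far F' (\<alpha> (Cod C f, Cod C g)) \<cdot> (far F' (far F f \<star>\<^bsub>N\<^esub> far F g) \<cdot> \<alpha>' (fob F (Dom C f), fob F (Dom C g)))"
        using f g by (intro B.D.chain B.F.commute A.alpha_nat[symmetric]) simp_all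
      then show ?thesis using f g B.alpha_nat[of "far F f" "far F g"] by simp
    qed
    then show "nat_iso (prod_cat C C) E (tens R \<circ>\<^sub>F ((F' \<circ>\<^sub>F F) \<times>\<^sub>F (F' \<circ>\<^sub>F F))) ((F' \<circ>\<^sub>F F) \<circ>\<^sub>F tens M)
      (\<lambda>(A, B). far F' (\<alpha> (A, B)) \<cdot> \<alpha>' (fob F A, fob F B))"
      unfolding nat_iso_def
      by (intro conjI nat_transI functor_comp[OF A.C.tens_functor]
          functor_comp[OF A.F.is_functor B.F.is_functor] is_functorI[of _ _ "tens R \<circ>\<^sub>F _"] ballI)
        (auto simp: category_prod A.C.category B.D.category intro: B.D.iso_cmp)
  next
    fix A B assume A: "A \<in> Obj C" and B: "B \<in> Obj C"
    have "far F' (far F (symm M (A, B))) \<cdot> (far F' (\<alpha> (A, B)) \<cdot> \<alpha>' (fob F A, fob F B))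
      = far F' (\<alpha> (B, A)) \<cdot> (far F' (symm N (fob F A, fob F B)) \<cdot> \<alpha>' (fob F A, fob F B))"
      using A B by (intro B.D.chain B.F.commute A.alpha_symm) simp_all
    then show "far (F' \<circ>\<^sub>F F) (symm M (A, B)) \<cdot>
        (case (A, B) of (A, B) \<Rightarrow> far F' (\<alpha> (A, B)) \<cdot> \<alpha>' (fob F A, fob F B)) =
      (case (B, A) of (A, B) \<Rightarrow> far F' (\<alpha> (A, B)) \<cdot> \<alpha>' (fob F A, fob F B)) \<cdot>
        symm R (fob (F' \<circ>\<^sub>F F) A, fob (F' \<circ>\<^sub>F F) B)"
      using A B by (simp add: B.alpha_symm)
  qed
qed

text \<open>The functor \<open>g_* f_*\<close> carries two lax structures: the one that its
  composite adjunction induces, to which conjugation applies, and the composite one of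
  \<open>lax_comp\<close>, which enters the composed duality functor. They agree because both have
  the transpose that \<open>lam_alpha\<close> prescribes.\<close>

lemma lam_comp:
  fixes E :: "('q, 'k) cat" (structure)
  assumes "monoidal_adj C M D N F G \<eta> \<epsilon> \<alpha>" "monoidal_adj D N E R F' G' \<eta>' \<epsilon>' \<alpha>'"
    and A: "A \<in> Obj E" and B: "B \<in> Obj E"
  shows "monoidal_adj.lam C M E R (G \<circ>\<^sub>F G') (\<lambda>A. far G (\<eta>' (fob F A)) \<cdot>\<^bsub>C\<^esub> \<eta> A)
    (\<lambda>B. \<epsilon>' B \<cdot> far F' (\<epsilon> (fob G' B)))
    (\<lambda>(A, B). far F' (\<alpha> (A, B)) \<cdot> \<alpha>' (fob F A, fob F B)) A B
    = far G (monoidal_adj.lam D N E R G' \<eta>' \<epsilon>' \<alpha>' A B) \<cdot>\<^bsub>C\<^esub>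
      monoidal_adj.lam C M D N G \<eta> \<epsilon> \<alpha> (fob G' A) (fob G' B)"
proof -
  interpret A: monoidal_adj C M D N F G \<eta> \<epsilon> \<alpha> by fact
  interpret B: monoidal_adj D N E R F' G' \<eta>' \<epsilon>' \<alpha>' by fact
  interpret AB: monoidal_adj C M E R "F' \<circ>\<^sub>F F" "G \<circ>\<^sub>F G'" "\<lambda>A. far G (\<eta>' (fob F A)) \<cdot>\<^bsub>C\<^esub> \<eta> A"
    "\<lambda>B. \<epsilon>' B \<cdot> far F' (\<epsilon> (fob G' B))" "\<lambda>(A, B). far F' (\<alpha> (A, B)) \<cdot> \<alpha>' (fob F A, fob F B)"
    by (rule monoidal_adj_comp) fact+
  let ?A = "fob G' A" and ?B = "fob G' B"
  show ?thesis
  proof (rule AB.tens_inject[where E = "A \<odot>\<^bsub>R\<^esub> B" and A = "fob G ?A" and B = "fob G ?B"])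
    \<comment> \<open>The inner counit passes \<open>B.lam\<close>; then \<open>lam_alpha\<close>
      for the inner adjunction applies under \<open>F'\<close>, and naturality of
      \<open>\<alpha>'\<close> prepares the use of the outer one.\<close>
    have "far F' (\<epsilon> (fob G' (A \<odot>\<^bsub>R\<^esub> B))) \<cdot> far F' (far F (far G (B.lam A B)))
      = far F' (B.lam A B) \<cdot> far F' (\<epsilon> (?A \<odot>\<^bsub>N\<^esub> ?B))"
      using A B by (intro B.F.commute) simp_all
    then have "far F' (\<epsilon> (fob G' (A \<odot>\<^bsub>R\<^esub> B))) \<cdot> (far F' (far F (far G (B.lam A B))) \<cdot>
       (far F' (far F (A.lam ?A ?B)) \<cdot> (far F' (\<alpha> (fob G ?A, fob G ?B)) \<cdot> \<alpha>' (fob F (fob G ?A), fob F (fob G ?B)))))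
      = far F' (B.lam A B) \<cdot> (far F' (\<epsilon> (?A \<odot>\<^bsub>N\<^esub> ?B)) \<cdot>
       (far F' (far F (A.lam ?A ?B)) \<cdot> (far F' (\<alpha> (fob G ?A, fob G ?B)) \<cdot> \<alpha>' (fob F (fob G ?A), fob F (fob G ?B)))))"
      using A B by (intro B.D.chain) simp_all
    also have "far F' (\<epsilon> (?A \<odot>\<^bsub>N\<^esub> ?B)) \<cdot>
       (far F' (far F (A.lam ?A ?B)) \<cdot> (far F' (\<alpha> (fob G ?A, fob G ?B)) \<cdot> \<alpha>' (fob F (fob G ?A), fob F (fob G ?B))))
      = far F' (\<epsilon> ?A \<star>\<^bsub>N\<^esub> \<epsilon> ?B) \<cdot> \<alpha>' (fob F (fob G ?A), fob F (fob G ?B))"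
      using A B arg_cong[OF A.lam_alpha[of ?A ?B], of "far F'"] by (intro B.D.chain3) simp_all
    also have "\<dots> = \<alpha>' (?A, ?B) \<cdot> (far F' (\<epsilon> ?A) \<star>\<^bsub>R\<^esub> far F' (\<epsilon> ?B))"
      using A B B.alpha_nat[of "\<epsilon> ?A" "\<epsilon> ?B"] by simp
    finally show "(\<epsilon>' (A \<odot>\<^bsub>R\<^esub> B) \<cdot> far F' (\<epsilon> (fob G' (A \<odot>\<^bsub>R\<^esub> B)))) \<cdot>
        (far (F' \<circ>\<^sub>F F) (AB.lam A B) \<cdot>
         (case (fob G ?A, fob G ?B) of (A, B) \<Rightarrow> far F' (\<alpha> (A, B)) \<cdot> \<alpha>' (fob F A, fob F B))) =
      (\<epsilon>' (A \<odot>\<^bsub>R\<^esub> B) \<cdot> far F' (\<epsilon> (fob G' (A \<odot>\<^bsub>R\<^esub> B)))) \<cdot>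
        (far (F' \<circ>\<^sub>F F) (far G (B.lam A B) \<cdot>\<^bsub>C\<^esub> A.lam ?A ?B) \<cdot>
         (case (fob G ?A, fob G ?B) of (A, B) \<Rightarrow> far F' (\<alpha> (A, B)) \<cdot> \<alpha>' (fob F A, fob F B)))"
      using A B AB.lam_alpha[OF A B] by (simp add: B.lam_alpha_chain)
  qed (use A B in simp_all)
qed

locale monoidal_conjugate = A: monoidal_adj C M D N F G \<eta> \<epsilon> \<alpha> + A': monoidal_adj C M D N F' G' \<eta>' \<epsilon>' \<alpha>' +
  conjugate C D F G \<eta> \<epsilon> F' G' \<eta>' \<epsilon>' a
  for C :: "('o, 'm) cat" and M and D :: "('p, 'n) cat" (structure) and N F G \<eta> \<epsilon> \<alpha> F' G' \<eta>' \<epsilon>' \<alpha>' a +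
  assumes a_tens: "A \<in> Obj C \<Longrightarrow> B \<in> Obj C \<Longrightarrow>
    a (A \<odot>\<^bsub>M\<^esub> B) \<cdot> \<alpha> (A, B) = \<alpha>' (A, B) \<cdot> (a A \<star>\<^bsub>N\<^esub> a B)"
begin

text \<open>After \<open>tens_inject\<close> both sides become
  \<open>\<epsilon>' \<otimes> \<epsilon>'\<close> after \<open>a \<otimes> a\<close>: on the left
  by \<open>counit_conj\<close> in each factor, on the right by \<open>a_tens\<close>.\<close>

lemma conj_tens:
  assumes A: "A \<in> Obj D" and B: "B \<in> Obj D"
  shows "A.lam A B \<cdot>\<^bsub>C\<^esub> (conj_ar A \<star>\<^bsub>M\<^esub> conj_ar B) = conj_ar (A \<odot>\<^bsub>N\<^esub> B) \<cdot>\<^bsub>C\<^esub> A'.lam A B"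
proof (rule A.tens_inject[where E = "A \<odot>\<^bsub>N\<^esub> B" and A = "fob G' A" and B = "fob G' B"])
  let ?AB = "A \<odot>\<^bsub>N\<^esub> B"
  have "\<epsilon> ?AB \<cdot> (far F (A.lam A B \<cdot>\<^bsub>C\<^esub> (conj_ar A \<star>\<^bsub>M\<^esub> conj_ar B)) \<cdot> \<alpha> (fob G' A, fob G' B))
    = (\<epsilon> A \<cdot> far F (conj_ar A)) \<star>\<^bsub>N\<^esub> (\<epsilon> B \<cdot> far F (conj_ar B))"
    using A B A.alpha_nat[of "conj_ar A" "conj_ar B", symmetric] by (simp add: A.lam_alpha_chain)
  also have "\<dots> = (\<epsilon>' A \<star>\<^bsub>N\<^esub> \<epsilon>' B) \<cdot> (a (fob G' A) \<star>\<^bsub>N\<^esub> a (fob G' B))"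
    using A B by (simp add: counit_conj)
  also have "\<dots> = \<epsilon>' ?AB \<cdot> (far F' (A'.lam A B) \<cdot> (\<alpha>' (fob G' A, fob G' B) \<cdot> (a (fob G' A) \<star>\<^bsub>N\<^esub> a (fob G' B))))"
    using A B by (subst A'.lam_alpha_chain) simp_all
  also have "\<alpha>' (fob G' A, fob G' B) \<cdot> (a (fob G' A) \<star>\<^bsub>N\<^esub> a (fob G' B))
    = a (fob G' A \<odot>\<^bsub>M\<^esub> fob G' B) \<cdot> \<alpha> (fob G' A, fob G' B)"
    using A B by (simp add: a_tens)
  also have "\<epsilon>' ?AB \<cdot> (far F' (A'.lam A B) \<cdot> (a (fob G' A \<odot>\<^bsub>M\<^esub> fob G' B) \<cdot> \<alpha> (fob G' A, fob G' B)))
    = (\<epsilon> ?AB \<cdot> (far F (conj_ar ?AB) \<cdot> far F (A'.lam A B))) \<cdot> \<alpha> (fob G' A, fob G' B)"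
    using A B counit_conj_cmp[of ?AB "A'.lam A B"] by simp
  finally show "\<epsilon> ?AB \<cdot> (far F (A.lam A B \<cdot>\<^bsub>C\<^esub> (conj_ar A \<star>\<^bsub>M\<^esub> conj_ar B)) \<cdot> \<alpha> (fob G' A, fob G' B))
    = \<epsilon> ?AB \<cdot> (far F (conj_ar ?AB \<cdot>\<^bsub>C\<^esub> A'.lam A B) \<cdot> \<alpha> (fob G' A, fob G' B))"
    using A B by simp
qed (use A B in simp_all)

end

section \<open>Suspensions\<close>

text \<open>The opposite of \<open>D_K\<close> ends in the double opposite; these equalities of
  records make it a suspended functor into \<open>C\<close> itself.\<close>

lemma op_op [simp]: "op_cat (op_cat C) = C" "op_susp (op_susp S) = S"
  by (simp_all add: op_cat_def op_susp_def)

lemma op_susp_simps [simp]: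
  "add_ar (op_susp S) = add_ar S" "zero_ar (op_susp S) A B = zero_ar S B A"
  "shift (op_susp S) = unshift S" "unshift (op_susp S) = shift S"
  by (simp_all add: op_susp_def)

context cat
begin

lemma inv_eqI:
  assumes "f \<in> Arr C" "g \<in> Arr C" "Dom C g = Cod C f" "Cod C g = Dom C f"
    "g \<cdot> f = Ident C (Dom C f)" "f \<cdot> g = Ident C (Cod C f)"
  shows "inv_arrow C f = g"
  using assms inverse_arrows_unique[OF iso_inv] iso_arrowI[OF assms]
  by (auto simp: inverse_arrows_def)

lemma inv_cmp:
  assumes "iso_arrow C f" "iso_arrow C g" "Dom C g = Cod C f"
  shows "inv_arrow C (g \<cdot> f) = inv_arrow C f \<cdot> inv_arrow C g"
  using assms iso_Arr[OF assms(1)] iso_Arr[OF assms(2)] by (intro inv_eqI) simp_all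

lemma inv_Ident: "A \<in> Obj C \<Longrightarrow> inv_arrow C (Ident C A) = Ident C A"
  by (intro inv_eqI) simp_all

end

lemma (in ftor) inv_far:
  assumes "iso_arrow C f"
  shows "inv_arrow D (far F f) = far F (inv_arrow C f)"
proof -
  note f = C.iso_Arr[OF assms]
  have "far F (inv_arrow C f) \<cdot> far F f = far F (inv_arrow C f \<cdot>\<^bsub>C\<^esub> f)"
    "far F f \<cdot> far F (inv_arrow C f) = far F (f \<cdot>\<^bsub>C\<^esub> inv_arrow C f)"
    using f C.inv_simps(1-3)[OF assms] by simp_all
  then show ?thesis
    using f C.inv_simps[OF assms] by (intro D.inv_eqI) simp_all
qed

section \<open>Suspended categories and suspended functors\<close>

locale susp =
  fixes C :: "('o, 'm) cat" (structure) and S :: "('o, 'm) susp"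
  assumes suspended: "suspended_category C S"
begin

abbreviation "T \<equiv> shift S"
abbreviation "U \<equiv> unshift S"

end

sublocale susp \<subseteq> T: ftor C C "shift S"
  by (rule ftor_of) (use suspended in \<open>simp add: suspended_category_def\<close>)

sublocale susp \<subseteq> U: ftor C C "unshift S"
  by (rule ftor_of) (use suspended in \<open>simp add: suspended_category_def\<close>)

context susp
begin

lemma TU [simp]: "A \<in> Obj C \<Longrightarrow> fob T (fob U A) = A" "A \<in> Obj C \<Longrightarrow> fob U (fob T A) = A"
  "f \<in> Arr C \<Longrightarrow> far T (far U f) = f" "f \<in> Arr C \<Longrightarrow> far U (far T f) = f"
  using suspended by (auto simp: suspended_category_def func_eq_def)

lemma hom_group: "A \<in> Obj C \<Longrightarrow> B \<in> Obj C \<Longrightarrow> comm_group (hom_group C S A B)"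
  using suspended by (auto simp: suspended_category_def additive_category_def)

lemma add_simps [simp]:
  assumes "f \<in> Arr C" "g \<in> Arr C" "Dom C f = Dom C g" "Cod C f = Cod C g"
  shows "add_ar S f g \<in> Arr C" "Dom C (add_ar S f g) = Dom C g" "Cod C (add_ar S f g) = Cod C g"
proof -
  interpret comm_group "hom_group C S (Dom C g) (Cod C g)" using assms by (intro hom_group) simp_all
  show "add_ar S f g \<in> Arr C" "Dom C (add_ar S f g) = Dom C g" "Cod C (add_ar S f g) = Cod C g"
    using m_closed[of f g] assms by (simp_all add: hom_group_def)
qed

lemma add_right:
  assumes "f \<in> Arr C" "g \<in> Arr C" "h \<in> Arr C" "Dom C f = Dom C g" "Cod C f = Cod C g" "Dom C h = Cod C g"
  shows "h \<cdot> add_ar S f g = add_ar S (h \<cdot> f) (h \<cdot> g)"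
  using suspended assms unfolding suspended_category_def additive_category_def in_homs by blast

lemma add_left:
  assumes "f \<in> Arr C" "g \<in> Arr C" "h \<in> Arr C" "Dom C f = Dom C g" "Cod C f = Cod C g" "Cod C h = Dom C g"
  shows "add_ar S f g \<cdot> h = add_ar S (f \<cdot> h) (g \<cdot> h)"
  using suspended assms unfolding suspended_category_def additive_category_def in_homs by blast

lemma suspended_category_op: "suspended_category (op_cat C) (op_susp S)"
proof -
  have "additive_category (op_cat C) (op_susp S)"
    unfolding additive_category_def
  proof (intro conjI allI impI ballI)
    fix A B assume "A \<in> Obj (op_cat C)" "B \<in> Obj (op_cat C)"
    then have "comm_group (hom_group C S B A)" by (intro hom_group) simp_all
    moreover have "hom_group (op_cat C) (op_susp S) A B = hom_group C S B A"
      by (auto simp: hom_group_def homs_def)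
    ultimately show "comm_group (hom_group (op_cat C) (op_susp S) A B)" by simp
  next
    have "\<exists>Z. zero_object C Z"
      using suspended by (simp add: suspended_category_def additive_category_def)
    then show "\<exists>Z. zero_object (op_cat C) Z"
      by (elim exE, intro exI) (auto simp: zero_object_def conj_ac)
  next
    fix A B assume "A \<in> Obj (op_cat C)" "B \<in> Obj (op_cat C)"
    then obtain E i j p q where "biproduct C S A B E i j p q"
      using suspended unfolding suspended_category_def additive_category_def by fastforce
    then have "biproduct (op_cat C) (op_susp S) A B E p q i j"
      unfolding biproduct_def by auto
    then show "\<exists>E i j p q. biproduct (op_cat C) (op_susp S) A B E i j p q" by blast
  qed (auto simp: T.C.category_op add_left add_right)
  then show ?thesis
    unfolding suspended_category_def func_eq_def by (simp add: T.functor_op U.functor_op)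
qed

end

locale sftor =
  fixes C :: "('o, 'm) cat" and S and D :: "('p, 'n) cat" (structure) and R F t
  assumes suspended_functor: "suspended_functor C S D R F t"

sublocale sftor \<subseteq> S: susp C S
  by unfold_locales (use suspended_functor in \<open>simp add: suspended_functor_def\<close>)

sublocale sftor \<subseteq> R: susp D R
  by unfold_locales (use suspended_functor in \<open>simp add: suspended_functor_def\<close>)

sublocale sftor \<subseteq> F: ftor C D F
  by (rule ftor_of) (use suspended_functor in \<open>simp add: suspended_functor_def\<close>)

context sftor
begin

lemma t_nat_trans: "nat_trans C D (F \<circ>\<^sub>F S.T) (R.T \<circ>\<^sub>F F) t"
  using suspended_functor by (simp add: suspended_functor_def nat_iso_def)

lemma t_iso [simp]: "A \<in> Obj C \<Longrightarrow> iso_arrow D (t A)"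
  using suspended_functor by (simp add: suspended_functor_def nat_iso_def)

lemmas t_simps [simp] = nat_transD(3-5)[OF t_nat_trans, unfolded func_simps]
  and t_nat = nat_transD(6)[OF t_nat_trans, unfolded func_simps]

lemma far_add [simp]:
  "f \<in> Arr C \<Longrightarrow> g \<in> Arr C \<Longrightarrow> Dom C f = Dom C g \<Longrightarrow> Cod C f = Cod C g \<Longrightarrow>
    far F (add_ar S f g) = add_ar R (far F f) (far F g)"
  using suspended_functor by (simp add: suspended_functor_def)

lemma suspended_functor_op:
  "suspended_functor (op_cat C) (op_susp S) (op_cat D) (op_susp R) F (sus_op S R t)"
  unfolding suspended_functor_def nat_iso_def
proof (intro conjI nat_transI)
  show "is_functor (op_cat C) (op_cat D) (F \<circ>\<^sub>F shift (op_susp S))"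
    using functor_comp[OF S.U.functor_op F.functor_op] by simp
  show "is_functor (op_cat C) (op_cat D) (shift (op_susp R) \<circ>\<^sub>F F)"
    using functor_comp[OF F.functor_op R.U.functor_op] by simp
next
  fix f assume f: "f \<in> Arr (op_cat C)"
  then have "far R.U (far R.T (far F (far S.U f))) \<cdot> far R.U (t (fob S.U (Dom C f)))
    = far R.U (t (fob S.U (Cod C f))) \<cdot> far R.U (far F (far S.T (far S.U f)))"
    using t_nat[of "far S.U f"] by (intro R.U.commute) simp_all
  then show "sus_op S R t (Cod (op_cat C) f) \<cdot>\<^bsub>op_cat D\<^esub> far (F \<circ>\<^sub>F shift (op_susp S)) f =
      far (shift (op_susp R) \<circ>\<^sub>F F) f \<cdot>\<^bsub>op_cat D\<^esub> sus_op S R t (Dom (op_cat C) f)"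
    using f by (simp add: sus_op_def)
qed (auto simp: sus_op_def S.suspended_category_op R.suspended_category_op F.functor_op intro!: R.T.C.iso_op)

end

lemma suspended_functor_id:
  assumes "suspended_category C S"
  shows "suspended_functor C S C S id_fun (sus_id C S)"
proof -
  interpret susp C S by unfold_locales fact
  show ?thesis
    unfolding suspended_functor_def nat_iso_def
    by (intro conjI nat_transI)
      (auto simp: suspended T.is_functor functor_id T.C.category sus_id_def T.C.iso_Ident)
qed

lemma suspended_functor_comp:
  fixes E :: "('q, 'k) cat" (structure)
  assumes "suspended_functor C S D R F t" "suspended_functor D R E Q G u"
  shows "suspended_functor C S E Q (G \<circ>\<^sub>F F) (sus_comp E G u F t)"
proof -
  interpret F: sftor C S D R F t by unfold_locales fact
  interpret G: sftor D R E Q G u by unfold_locales fact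
  show ?thesis
    unfolding suspended_functor_def nat_iso_def
  proof (intro conjI nat_transI ballI)
    show "is_functor C E ((G \<circ>\<^sub>F F) \<circ>\<^sub>F shift S)" "is_functor C E (shift Q \<circ>\<^sub>F (G \<circ>\<^sub>F F))" "is_functor C E (G \<circ>\<^sub>F F)"
      by (rule functor_comp[OF F.S.T.is_functor functor_comp[OF F.F.is_functor G.F.is_functor]]
          functor_comp[OF functor_comp[OF F.F.is_functor G.F.is_functor] G.R.T.is_functor]
          functor_comp[OF F.F.is_functor G.F.is_functor])+
  next
    fix f assume f: "f \<in> Arr C"
    have "far G (t (Cod C f)) \<cdot> far G (far F (far F.S.T f)) = far G (far F.R.T (far F f)) \<cdot> far G (t (Dom C f))"
      using f F.t_nat[OF f] by (intro G.F.commute) simp_all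
    moreover have "u (fob F (Cod C f)) \<cdot> (far G (far F.R.T (far F f)) \<cdot> far G (t (Dom C f)))
      = far G.R.T (far G (far F f)) \<cdot> (u (fob F (Dom C f)) \<cdot> far G (t (Dom C f)))"
      using f G.t_nat[of "far F f"] by (intro G.R.T.C.chain) simp_all
    ultimately show "sus_comp E G u F t (Cod C f) \<cdot> far ((G \<circ>\<^sub>F F) \<circ>\<^sub>F shift S) f =
        far (shift Q \<circ>\<^sub>F (G \<circ>\<^sub>F F)) f \<cdot> sus_comp E G u F t (Dom C f)"
      using f by (simp add: sus_comp_def)
  qed (auto simp: sus_comp_def F.S.suspended G.R.suspended intro!: G.R.T.C.iso_cmp)
qed

section \<open>Suspended symmetric monoidal closed categories\<close>

locale susp_smc =
  fixes C :: "('o, 'm) cat" (structure) and M and S and l r :: "'o \<times> 'o \<Rightarrow> 'm"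
  assumes suspended_smc: "suspended_smc C M S l r"

sublocale susp_smc \<subseteq> smclosed C M
  by unfold_locales (use suspended_smc in \<open>simp add: suspended_smc_def\<close>)

sublocale susp_smc \<subseteq> susp C S
  by unfold_locales (use suspended_smc in \<open>simp add: suspended_smc_def\<close>)

context susp_smc
begin

lemma l_nat_iso: "nat_iso (prod_cat C C) C (tens M \<circ>\<^sub>F (T \<times>\<^sub>F id_fun)) (T \<circ>\<^sub>F tens M) l"
  using suspended_smc by (simp add: suspended_smc_def)

lemma r_nat_iso: "nat_iso (prod_cat C C) C (tens M \<circ>\<^sub>F (id_fun \<times>\<^sub>F T)) (T \<circ>\<^sub>F tens M) r"
  using suspended_smc by (simp add: suspended_smc_def)

lemma l_iso [simp]: "A \<in> Obj C \<Longrightarrow> B \<in> Obj C \<Longrightarrow> iso_arrow C (l (A, B))"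
  using l_nat_iso by (simp add: nat_iso_def)

lemma l_simps [simp]:
  assumes "A \<in> Obj C" "B \<in> Obj C"
  shows "l (A, B) \<in> Arr C" "Dom C (l (A, B)) = fob T A \<odot>\<^bsub>M\<^esub> B" "Cod C (l (A, B)) = fob T (A \<odot>\<^bsub>M\<^esub> B)"
  using nat_transD(3-5)[OF l_nat_iso[unfolded nat_iso_def, THEN conjunct1], of "(A, B)"] assms by simp_all

lemma l_nat:
  assumes "f \<in> Arr C" "g \<in> Arr C"
  shows "l (Cod C f, Cod C g) \<cdot> (far T f \<star>\<^bsub>M\<^esub> g) = far T (f \<star>\<^bsub>M\<^esub> g) \<cdot> l (Dom C f, Dom C g)"
  using nat_transD(6)[OF l_nat_iso[unfolded nat_iso_def, THEN conjunct1], of "(f, g)"] assms by simp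

lemma r_iso [simp]: "A \<in> Obj C \<Longrightarrow> B \<in> Obj C \<Longrightarrow> iso_arrow C (r (A, B))"
  using r_nat_iso by (simp add: nat_iso_def)

lemma r_simps [simp]:
  assumes "A \<in> Obj C" "B \<in> Obj C"
  shows "r (A, B) \<in> Arr C" "Dom C (r (A, B)) = A \<odot>\<^bsub>M\<^esub> fob T B" "Cod C (r (A, B)) = fob T (A \<odot>\<^bsub>M\<^esub> B)"
  using nat_transD(3-5)[OF r_nat_iso[unfolded nat_iso_def, THEN conjunct1], of "(A, B)"] assms by simp_all

lemma r_nat:
  assumes "f \<in> Arr C" "g \<in> Arr C"
  shows "r (Cod C f, Cod C g) \<cdot> (f \<star>\<^bsub>M\<^esub> far T g) = far T (f \<star>\<^bsub>M\<^esub> g) \<cdot> r (Dom C f, Dom C g)"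
  using nat_transD(6)[OF r_nat_iso[unfolded nat_iso_def, THEN conjunct1], of "(f, g)"] assms by simp

lemma l_symm:
  "A \<in> Obj C \<Longrightarrow> B \<in> Obj C \<Longrightarrow> far T (symm M (A, B)) \<cdot> l (A, B) = r (B, A) \<cdot> symm M (fob T A, B)"
  using suspended_smc unfolding suspended_smc_def by blast

text \<open>The arrows \<open>l\<close> and \<open>r\<close> enter \<open>dual_sus\<close> only in
  this combination, so their laws are recast as laws of the shuffle.\<close>

definition shuffle :: "'o \<Rightarrow> 'o \<Rightarrow> 'm" where
  "shuffle Y A = inv_arrow C (l (Y, A)) \<cdot> r (Y, A)"

lemma shuffle_simps [simp]:
  assumes "Y \<in> Obj C" "A \<in> Obj C"
  shows "shuffle Y A \<in> Arr C" "Dom C (shuffle Y A) = Y \<odot>\<^bsub>M\<^esub> fob T A" "Cod C (shuffle Y A) = fob T Y \<odot>\<^bsub>M\<^esub> A"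
  using assms by (simp_all add: shuffle_def)

lemma shuffle_iso [simp]: "Y \<in> Obj C \<Longrightarrow> A \<in> Obj C \<Longrightarrow> iso_arrow C (shuffle Y A)"
  unfolding shuffle_def
  by (intro iso_cmp r_iso iso_arrowI[of "inv_arrow C (l (Y, A))" "l (Y, A)"]) simp_all

lemma l_shuffle:
  assumes "Y \<in> Obj C" "A \<in> Obj C"
  shows "l (Y, A) \<cdot> shuffle Y A = r (Y, A)"
  using assms by (simp add: shuffle_def)

lemma shuffle_nat:
  assumes y: "y \<in> Arr C" and f: "f \<in> Arr C"
  shows "shuffle (Cod C y) (Cod C f) \<cdot> (y \<star>\<^bsub>M\<^esub> far T f) = (far T y \<star>\<^bsub>M\<^esub> f) \<cdot> shuffle (Dom C y) (Dom C f)"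
proof (rule iso_mono[OF l_iso[of "Cod C y" "Cod C f"]])
  have "l (Cod C y, Cod C f) \<cdot> ((far T y \<star>\<^bsub>M\<^esub> f) \<cdot> shuffle (Dom C y) (Dom C f))
    = far T (y \<star>\<^bsub>M\<^esub> f) \<cdot> (l (Dom C y, Dom C f) \<cdot> shuffle (Dom C y) (Dom C f))"
    using y f by (intro chain l_nat) simp_all
  also have "\<dots> = r (Cod C y, Cod C f) \<cdot> (y \<star>\<^bsub>M\<^esub> far T f)"
    using y f by (simp add: l_shuffle r_nat)
  also have "\<dots> = l (Cod C y, Cod C f) \<cdot> (shuffle (Cod C y) (Cod C f) \<cdot> (y \<star>\<^bsub>M\<^esub> far T f))"
    using y f by (intro chain1[symmetric] l_shuffle) simp_all
  finally show "l (Cod C y, Cod C f) \<cdot> (shuffle (Cod C y) (Cod C f) \<cdot> (y \<star>\<^bsub>M\<^esub> far T f))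
    = l (Cod C y, Cod C f) \<cdot> ((far T y \<star>\<^bsub>M\<^esub> f) \<cdot> shuffle (Dom C y) (Dom C f))" ..
qed (use y f in simp_all)

text \<open>The law \<open>l_symm\<close> exchanges \<open>l\<close> with \<open>r\<close>, so a
  shuffle conjugated by symmetries undoes the shuffle in the other order. In the double dual this
  removes two shuffles at once.\<close>

lemma shuffle_symm:
  assumes A: "A \<in> Obj C" and Y: "Y \<in> Obj C"
  shows "shuffle Y A \<cdot> (symm M (fob T A, Y) \<cdot> shuffle A Y) = symm M (A, fob T Y)"
proof (rule iso_mono[OF l_iso[of Y A]])
  have "l (Y, A) \<cdot> (shuffle Y A \<cdot> (symm M (fob T A, Y) \<cdot> shuffle A Y))
    = r (Y, A) \<cdot> (symm M (fob T A, Y) \<cdot> shuffle A Y)"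
    using A Y by (intro chain1 l_shuffle) simp_all
  also have "\<dots> = far T (symm M (A, Y)) \<cdot> (l (A, Y) \<cdot> shuffle A Y)"
    using A Y by (intro chain l_symm[symmetric]) simp_all
  \<comment> \<open>A cancelling pair of symmetries is inserted so that \<open>l_symm\<close> can be
    applied a second time, now to \<open>r (A, Y)\<close>.\<close>
  also have "\<dots> = far T (symm M (A, Y)) \<cdot> (r (A, Y) \<cdot> (symm M (fob T Y, A) \<cdot> symm M (A, fob T Y)))"
    using A Y by (simp add: l_shuffle)
  also have "r (A, Y) \<cdot> (symm M (fob T Y, A) \<cdot> symm M (A, fob T Y))
    = far T (symm M (Y, A)) \<cdot> (l (Y, A) \<cdot> symm M (A, fob T Y))"
    using A Y by (intro chain l_symm[symmetric]) simp_all
  also have "far T (symm M (A, Y)) \<cdot> (far T (symm M (Y, A)) \<cdot> (l (Y, A) \<cdot> symm M (A, fob T Y)))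
    = far T (symm M (A, Y) \<cdot> symm M (Y, A)) \<cdot> (l (Y, A) \<cdot> symm M (A, fob T Y))"
    using A Y by (intro chain1) (simp_all del: symm_symm)
  finally show "l (Y, A) \<cdot> (shuffle Y A \<cdot> (symm M (fob T A, Y) \<cdot> shuffle A Y))
    = l (Y, A) \<cdot> symm M (A, fob T Y)"
    using A Y by simp
qed (use A Y in simp_all)

lemma tens_right_add:
  assumes "A \<in> Obj C" "f \<in> Arr C" "g \<in> Arr C" "Dom C f = Dom C g" "Cod C f = Cod C g"
  shows "add_ar S f g \<star>\<^bsub>M\<^esub> Ident C A = add_ar S (f \<star>\<^bsub>M\<^esub> Ident C A) (g \<star>\<^bsub>M\<^esub> Ident C A)"
proof -
  have "suspended_functor C S C S (tens_right C M A) (\<lambda>B. l (B, A))"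
    using suspended_smc assms(1) by (simp add: suspended_smc_def)
  then interpret sftor C S C S "tens_right C M A" "\<lambda>B. l (B, A)" by unfold_locales
  show ?thesis using far_add[of f g] assms by (simp add: tens_right_def)
qed

lemma tens_left_add:
  assumes "A \<in> Obj C" "f \<in> Arr C" "g \<in> Arr C" "Dom C f = Dom C g" "Cod C f = Cod C g"
  shows "Ident C A \<star>\<^bsub>M\<^esub> add_ar S f g = add_ar S (Ident C A \<star>\<^bsub>M\<^esub> f) (Ident C A \<star>\<^bsub>M\<^esub> g)"
proof -
  have "suspended_functor C S C S (tens_left C M A) (\<lambda>B. r (A, B))"
    using suspended_smc assms(1) by (simp add: suspended_smc_def)
  then interpret sftor C S C S "tens_left C M A" "\<lambda>B. r (A, B)" by unfold_locales
  show ?thesis using far_add[of f g] assms by (simp add: tens_left_def)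
qed

text \<open>Additivity of \<open>[-, K]\<close> comes from the tensor product in both variables: in
  the transpose, \<open>f\<close> and \<open>g\<close> act on the second factor, while their images
  under \<open>har\<close> are added in the first.\<close>

lemma har_add:
  assumes K: "K \<in> Obj C" and fg: "f \<in> Arr C" "g \<in> Arr C" "Dom C f = Dom C g" "Cod C f = Cod C g"
  shows "har M (add_ar S f g) (Ident C K) = add_ar S (har M f (Ident C K)) (har M g (Ident C K))"
proof (rule uncurry_inject[where X = "Dom C g" and K = K])
  show "uncurry (Dom C g) K (har M (add_ar S f g) (Ident C K))
    = uncurry (Dom C g) K (add_ar S (har M f (Ident C K)) (har M g (Ident C K)))"
    using K fg ev_har[of f "Ident C K" "Cod C g" "Dom C g" K K] ev_har[of g "Ident C K" "Cod C g" "Dom C g" K K]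
      ev_har[of "add_ar S f g" "Ident C K" "Cod C g" "Dom C g" K K]
    by (simp add: uncurry_def tens_right_add tens_left_add add_right)
qed (use assms in simp_all)

section \<open>The suspended structure on \<open>D_K\<close>\<close>

abbreviation dsus :: "'o \<Rightarrow> 'o \<Rightarrow> 'm" where
  "dsus K A \<equiv> dual_sus C M S l r K A"

lemma dsus_simps [simp]:
  assumes "K \<in> Obj C" "A \<in> Obj C"
  shows "dsus K A \<in> Arr C" "Dom C (dsus K A) = fob U (hob M A K)" "Cod C (dsus K A) = hob M (fob T A) K"
  using assms by (simp_all add: dual_sus_def Let_def)

lemma uncurry_dsus:
  assumes "K \<in> Obj C" "A \<in> Obj C"
  shows "uncurry (fob T A) K (dsus K A) = ev M A K \<cdot> shuffle (fob U (hob M A K)) A"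
  using assms by (simp add: dual_sus_def Let_def shuffle_def)

text \<open>By naturality of the shuffle, \<open>far U p\<close> on one side of it becomes
  \<open>p\<close> on the other. All computations with \<open>dsus\<close> go through this
  form.\<close>

lemma uncurry_dsus_U:
  assumes "K \<in> Obj C" "A \<in> Obj C" "p \<in> Arr C" "Cod C p = hob M A K"
  shows "uncurry (fob T A) K (dsus K A \<cdot> far U p)
    = uncurry A K p \<cdot> shuffle (fob U (Dom C p)) A"
proof -
  have "uncurry (fob T A) K (dsus K A \<cdot> far U p)
    = ev M A K \<cdot> (shuffle (fob U (hob M A K)) A \<cdot> (far U p \<star>\<^bsub>M\<^esub> far T (Ident C A)))"
    using assms by (simp add: uncurry_cmp uncurry_dsus)
  also have "shuffle (fob U (hob M A K)) A \<cdot> (far U p \<star>\<^bsub>M\<^esub> far T (Ident C A))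
    = (p \<star>\<^bsub>M\<^esub> Ident C A) \<cdot> shuffle (fob U (Dom C p)) A"
    using shuffle_nat[of "far U p" "Ident C A"] assms by simp
  finally show ?thesis using assms by (simp add: uncurry_def)
qed

lemma dsus_nat:
  assumes K: "K \<in> Obj C" and f: "f \<in> Arr C"
  shows "har M (far T f) (Ident C K) \<cdot> dsus K (Cod C f)
    = dsus K (Dom C f) \<cdot> far U (har M f (Ident C K))"
proof (rule uncurry_inject[where X = "fob T (Dom C f)" and K = K])
  let ?D = "hob M (Cod C f) K"
  have "uncurry (fob T (Dom C f)) K (har M (far T f) (Ident C K) \<cdot> dsus K (Cod C f))
    = ev M (Cod C f) K \<cdot> (shuffle (fob U ?D) (Cod C f) \<cdot> (Ident C (fob U ?D) \<star>\<^bsub>M\<^esub> far T f))"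
    using K f by (simp add: uncurry_dual uncurry_dsus)
  also have "shuffle (fob U ?D) (Cod C f) \<cdot> (Ident C (fob U ?D) \<star>\<^bsub>M\<^esub> far T f)
    = (Ident C ?D \<star>\<^bsub>M\<^esub> f) \<cdot> shuffle (fob U ?D) (Dom C f)"
    using shuffle_nat[of "Ident C (fob U ?D)" f] K f by simp
  finally show "uncurry (fob T (Dom C f)) K (har M (far T f) (Ident C K) \<cdot> dsus K (Cod C f))
    = uncurry (fob T (Dom C f)) K (dsus K (Dom C f) \<cdot> far U (har M f (Ident C K)))"
    using K f by (simp add: uncurry_dsus_U uncurry_har_Arr)
qed (use K f in simp_all)

lemma dsus_iso:
  assumes K: "K \<in> Obj C" and A: "A \<in> Obj C"
  shows "iso_arrow C (dsus K A)"
proof -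
  let ?D = "hob M (fob T A) K" and ?Y = "fob U (hob M A K)"
  \<comment> \<open>The formula of \<open>dsus\<close> with the shuffle inverted; it gives an arrow
    \<open>T [T A, K] -> [A, K]\<close>, and \<open>far U m\<close> is the inverse sought.\<close>
  define m where "m = curry_ar C M (fob T ?D) A (ev M (fob T A) K \<cdot> inv_arrow C (shuffle ?D A))"
  have m [simp]: "m \<in> Arr C" "Dom C m = fob T ?D" "Cod C m = hob M A K"
    using K A by (simp_all add: m_def)
  have um: "uncurry A K m = ev M (fob T A) K \<cdot> inv_arrow C (shuffle ?D A)"
    unfolding m_def using K A by (intro uncurry_curry) simp_all
  \<comment> \<open>This composite is checked with \<open>T\<close> applied, since naturality of the
    shuffle produces \<open>far T (dsus K A)\<close>; applying \<open>U\<close> then gives the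
    statement about \<open>dsus K A\<close>.\<close>
  have "m \<cdot> far T (dsus K A) = Ident C (hob M A K)"
  proof (rule uncurry_inject[where X = A and K = K])
    have n: "(far T (dsus K A) \<star>\<^bsub>M\<^esub> Ident C A) \<cdot> shuffle ?Y A
      = shuffle ?D A \<cdot> (dsus K A \<star>\<^bsub>M\<^esub> Ident C (fob T A))"
      using shuffle_nat[of "dsus K A" "Ident C A"] K A by simp
    have "uncurry A K m \<cdot> ((far T (dsus K A) \<star>\<^bsub>M\<^esub> Ident C A) \<cdot> shuffle ?Y A)
      = ev M (fob T A) K \<cdot> (dsus K A \<star>\<^bsub>M\<^esub> Ident C (fob T A))"
      unfolding n um using K A by simp
    also have "\<dots> = ev M A K \<cdot> shuffle ?Y A"
      using uncurry_dsus[OF K A] by (simp add: uncurry_def)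
    finally have "(uncurry A K m \<cdot> (far T (dsus K A) \<star>\<^bsub>M\<^esub> Ident C A)) \<cdot> shuffle ?Y A
      = ev M A K \<cdot> shuffle ?Y A"
      using K A by simp
    note * = this
    have "uncurry A K m \<cdot> (far T (dsus K A) \<star>\<^bsub>M\<^esub> Ident C A) = ev M A K"
      by (rule iso_epi[OF _ _ _ _ _ *]) (use K A in simp_all)
    then show "uncurry A K (m \<cdot> far T (dsus K A)) = uncurry A K (Ident C (hob M A K))"
      using K A by (subst uncurry_cmp) (simp_all, simp add: uncurry_def)
  qed (use K A in simp_all)
  from arg_cong[OF this, of "far U"] have 1: "far U m \<cdot> dsus K A = Ident C (fob U (hob M A K))"
    using K A by simp
  have 2: "dsus K A \<cdot> far U m = Ident C ?D"
  proof (rule uncurry_inject[where X = "fob T A" and K = K])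
    show "uncurry (fob T A) K (dsus K A \<cdot> far U m) = uncurry (fob T A) K (Ident C ?D)"
      using K A by (simp add: uncurry_dsus_U um) (simp add: uncurry_def)
  qed (use K A in simp_all)
  show ?thesis
    by (rule iso_arrowI[where g = "far U m"]) (use K A 1 2 in simp_all)
qed

lemma suspended_functor_dual:
  assumes K: "K \<in> Obj C"
  shows "suspended_functor C S (op_cat C) (op_susp S) (dual_fun C M K) (dsus K)"
  unfolding suspended_functor_def nat_iso_def
proof (intro conjI nat_transI ballI)
  show "is_functor C (op_cat C) (dual_fun C M K \<circ>\<^sub>F T)"
    by (rule functor_comp[OF T.is_functor dual_functor[OF K]])
  show "is_functor C (op_cat C) (shift (op_susp S) \<circ>\<^sub>F dual_fun C M K)"
    using functor_comp[OF dual_functor[OF K] U.functor_op] by simp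
qed (use K in \<open>auto simp: suspended suspended_category_op dual_functor dsus_nat har_add intro!: iso_op dsus_iso\<close>)

lemma suspended_functor_bidual:
  assumes K: "K \<in> Obj C"
  shows "suspended_functor C S C S (dual_fun C M K \<circ>\<^sub>F dual_fun C M K)
    (sus_comp C (dual_fun C M K) (sus_op S (op_susp S) (dsus K)) (dual_fun C M K) (dsus K))"
proof -
  interpret dual: sftor C S "op_cat C" "op_susp S" "dual_fun C M K" "dsus K"
    by unfold_locales (rule suspended_functor_dual[OF K])
  show ?thesis
    using suspended_functor_comp[OF dual.suspended_functor dual.suspended_functor_op] by simp
qed

text \<open>Each of the two arrows \<open>dsus\<close> contributes a shuffle to the transpose, with
  the symmetry from \<open>varpi\<close> between them; \<open>shuffle_symm\<close> reduces the three
  to one symmetry.\<close>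

lemma varpi_dsus:
  assumes K: "K \<in> Obj C" and A: "A \<in> Obj C"
  shows "dsus K (fob U (hob M A K)) \<cdot> far U (har M (dsus K A) (Ident C K) \<cdot> varpi C M K (fob T A))
    = varpi C M K A"
proof (rule uncurry_inject[where X = "hob M A K" and K = K])
  let ?Y = "fob U (hob M A K)" and ?D = "hob M (fob T A) K"
  let ?p = "har M (dsus K A) (Ident C K) \<cdot> varpi C M K (fob T A)"
  have "uncurry (fob T ?Y) K (dsus K ?Y \<cdot> far U ?p) = uncurry ?Y K ?p \<cdot> shuffle A ?Y"
    using K A by (subst uncurry_dsus_U) simp_all
  also have "uncurry ?Y K ?p
    = ev M (fob T A) K \<cdot> (symm M (fob T A, ?D) \<cdot> (Ident C (fob T A) \<star>\<^bsub>M\<^esub> dsus K A))"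
    using K A by (simp add: uncurry_dual uncurry_varpi)
  also have "symm M (fob T A, ?D) \<cdot> (Ident C (fob T A) \<star>\<^bsub>M\<^esub> dsus K A)
    = (dsus K A \<star>\<^bsub>M\<^esub> Ident C (fob T A)) \<cdot> symm M (fob T A, ?Y)"
    using K A symm_nat[of "Ident C (fob T A)" "dsus K A"] by simp
  also have "ev M (fob T A) K \<cdot> ((dsus K A \<star>\<^bsub>M\<^esub> Ident C (fob T A)) \<cdot> symm M (fob T A, ?Y))
    = ev M A K \<cdot> (shuffle ?Y A \<cdot> symm M (fob T A, ?Y))"
    using K A uncurry_dsus[OF K A] by (intro chain) (simp_all add: uncurry_def)
  also have "(ev M A K \<cdot> (shuffle ?Y A \<cdot> symm M (fob T A, ?Y))) \<cdot> shuffle A ?Y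
    = ev M A K \<cdot> symm M (A, hob M A K)"
    using K A by (simp add: shuffle_symm)
  finally show "uncurry (hob M A K) K (dsus K ?Y \<cdot> far U ?p) = uncurry (hob M A K) K (varpi C M K A)"
    using K A by (simp add: uncurry_varpi)
qed (use K A in simp_all)

lemma suspended_with_duality:
  assumes K: "K \<in> Obj C"
  shows "suspended_with_duality (dual_at C M K) S (dsus K)"
proof -
  \<comment> \<open>The definition asks for this identity one suspension higher: it is
    \<open>T\<close> applied to \<open>varpi_dsus\<close>.\<close>
  have "far T (dsus K (fob U (hob M A K))) \<cdot> (har M (dsus K A) (Ident C K) \<cdot> varpi C M K (fob T A))
    = far T (varpi C M K A)" if A: "A \<in> Obj C" for A
    using arg_cong[OF varpi_dsus[OF K A], of "far T"] K A by simp
  moreover have "nat_trans C C id_fun (dual_fun C M K \<circ>\<^sub>F dual_fun C M K) (varpi C M K)"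
    using category_with_duality_dual_at[OF K] by (simp add: category_with_duality_def)
  ultimately show ?thesis
    unfolding suspended_with_duality_def suspended_transformation_def
    using K category_with_duality_dual_at[OF K] suspended_functor_dual[OF K] suspended_functor_bidual[OF K]
      suspended_functor_id[OF suspended]
    by (simp add: sus_comp_def sus_op_def sus_id_def)
qed

end

section \<open>Suspended lax functors\<close>

text \<open>Condition \<open>lam_shuffle\<close> joins the compatibilities of \<open>m\<close> with
  \<open>l\<close> and \<open>r\<close>: from \<open>F Y \<otimes> F T A\<close> one passes to
  \<open>F Y \<otimes> T F A\<close> by \<open>t\<close>, shuffles to
  \<open>T F Y \<otimes> F A\<close>, and returns to \<open>F T Y \<otimes> F A\<close> by the
  inverse of \<open>t\<close>.\<close>

locale slax = lax C M D N F m + S: susp_smc C M S l r + R: susp_smc D N R l' r' + sftor C S D R F t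
  for C :: "('o, 'm) cat" and M and D :: "('p, 'n) cat" (structure) and N and F and m S l r R l' r' t +
  assumes lam_shuffle: "Y \<in> Obj C \<Longrightarrow> A \<in> Obj C \<Longrightarrow>
    far F (S.shuffle Y A) \<cdot> m Y (fob (shift S) A)
    = m (fob (shift S) Y) A \<cdot> ((inv_arrow D (t Y) \<star>\<^bsub>N\<^esub> Ident D (fob F A)) \<cdot>
      (R.shuffle (fob F Y) (fob F A) \<cdot> (Ident D (fob F Y) \<star>\<^bsub>N\<^esub> t A)))"

locale slax_dual = lax_dual C M D N F m L K e \<phi> + slax C M D N F m S l r R l' r' t
  for C :: "('o, 'm) cat" and M and D :: "('p, 'n) cat" (structure) and N and F and m L K e \<phi> S l r R l' r' t
begin

text \<open>In the transpose of the right-hand side, \<open>lam_shuffle\<close> creates an inverse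
  of \<open>t\<close> on the first factor, and naturality of the shuffle turns
  \<open>far (unshift R) (t ..)\<close> into the \<open>t\<close> that cancels it.\<close>

lemma phi_dsus:
  assumes A: "A \<in> Obj C"
  shows "har N (t A) (Ident D K) \<cdot> (R.dsus K (fob F A) \<cdot> far (unshift R) (\<phi> A))
    = \<phi> (fob (shift S) A) \<cdot> (far F (S.dsus L A) \<cdot> far (unshift R) (t (fob (unshift S) (hob M A L))))"
    (is "?lhs = ?rhs")
proof (rule D.uncurry_inject[where X = "fob F (fob (shift S) A)" and K = K])
  let ?TA = "fob (shift S) A" and ?FA = "fob F A" and ?D = "hob M A L"
  let ?Y = "fob (unshift S) ?D"
  let ?FY = "fob F ?Y" and ?W = "fob (unshift R) (fob F ?D)"
  let ?Ut = "far (unshift R) (t ?Y)"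
  have "D.uncurry (fob F ?TA) K ?rhs
    = e \<cdot> (far F (ev M ?TA L) \<cdot> (m (hob M ?TA L) ?TA \<cdot>
        ((far F (S.dsus L A) \<star>\<^bsub>N\<^esub> far F (Ident C ?TA)) \<cdot> (?Ut \<star>\<^bsub>N\<^esub> Ident D (fob F ?TA)))))"
    using A by (simp add: D.uncurry_cmp uncurry_phi)
  also have "m (hob M ?TA L) ?TA \<cdot>
        ((far F (S.dsus L A) \<star>\<^bsub>N\<^esub> far F (Ident C ?TA)) \<cdot> (?Ut \<star>\<^bsub>N\<^esub> Ident D (fob F ?TA)))
    = far F (S.dsus L A \<star>\<^bsub>M\<^esub> Ident C ?TA) \<cdot> (m ?Y ?TA \<cdot> (?Ut \<star>\<^bsub>N\<^esub> Ident D (fob F ?TA)))"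
    using A lam_nat[of "S.dsus L A" "Ident C ?TA"] by (intro D.chain) simp_all
  also have "far F (ev M ?TA L) \<cdot>
      (far F (S.dsus L A \<star>\<^bsub>M\<^esub> Ident C ?TA) \<cdot> (m ?Y ?TA \<cdot> (?Ut \<star>\<^bsub>N\<^esub> Ident D (fob F ?TA))))
    = far F (ev M A L) \<cdot> (far F (S.shuffle ?Y A) \<cdot> (m ?Y ?TA \<cdot> (?Ut \<star>\<^bsub>N\<^esub> Ident D (fob F ?TA))))"
    using A S.uncurry_dsus[of L A] by (intro D.chain F.commute) (simp_all add: C.uncurry_def)
  also have "far F (S.shuffle ?Y A) \<cdot> (m ?Y ?TA \<cdot> (?Ut \<star>\<^bsub>N\<^esub> Ident D (fob F ?TA)))
    = (m ?D A \<cdot> ((inv_arrow D (t ?Y) \<star>\<^bsub>N\<^esub> Ident D ?FA) \<cdot>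
      (R.shuffle ?FY ?FA \<cdot> (Ident D ?FY \<star>\<^bsub>N\<^esub> t A)))) \<cdot> (?Ut \<star>\<^bsub>N\<^esub> Ident D (fob F ?TA))"
    using A lam_shuffle[of ?Y A] by (intro D.chain1) simp_all
  also have "\<dots> = m ?D A \<cdot> ((inv_arrow D (t ?Y) \<star>\<^bsub>N\<^esub> Ident D ?FA) \<cdot>
      (R.shuffle ?FY ?FA \<cdot> ((?Ut \<star>\<^bsub>N\<^esub> far (shift R) (Ident D ?FA)) \<cdot> (Ident D ?W \<star>\<^bsub>N\<^esub> t A))))"
    using A by simp
  also have "R.shuffle ?FY ?FA \<cdot> ((?Ut \<star>\<^bsub>N\<^esub> far (shift R) (Ident D ?FA)) \<cdot> (Ident D ?W \<star>\<^bsub>N\<^esub> t A))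
    = (t ?Y \<star>\<^bsub>N\<^esub> Ident D ?FA) \<cdot> (R.shuffle ?W ?FA \<cdot> (Ident D ?W \<star>\<^bsub>N\<^esub> t A))"
    using A R.shuffle_nat[of ?Ut "Ident D ?FA"] by (intro D.chain) simp_all
  also have "(inv_arrow D (t ?Y) \<star>\<^bsub>N\<^esub> Ident D ?FA) \<cdot>
       ((t ?Y \<star>\<^bsub>N\<^esub> Ident D ?FA) \<cdot> (R.shuffle ?W ?FA \<cdot> (Ident D ?W \<star>\<^bsub>N\<^esub> t A)))
    = R.shuffle ?W ?FA \<cdot> (Ident D ?W \<star>\<^bsub>N\<^esub> t A)"
    using A by simp
  also have "e \<cdot> (far F (ev M A L) \<cdot> (m ?D A \<cdot> (R.shuffle ?W ?FA \<cdot> (Ident D ?W \<star>\<^bsub>N\<^esub> t A))))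
    = D.uncurry (fob F ?TA) K ?lhs"
    using A by (subst D.uncurry_dual[where X = "fob (shift R) ?FA"]) (simp_all add: R.uncurry_dsus_U uncurry_phi)
  finally show "D.uncurry (fob F ?TA) K ?lhs = D.uncurry (fob F ?TA) K ?rhs" ..
qed (use A in simp_all)

lemma suspended_duality_preserving:
  "suspended_duality_preserving (dual_at C M L) S (S.dsus L) (dual_at D N K) R (R.dsus K)
    \<lparr>dfun = F, dphi = \<phi>\<rparr> t"
proof -
  interpret d1: sftor C S "op_cat C" "op_susp S" "dual_fun C M L" "S.dsus L"
    by unfold_locales (rule S.suspended_functor_dual[OF L])
  interpret d2: sftor D R "op_cat D" "op_susp R" "dual_fun D N K" "R.dsus K"
    by unfold_locales (rule R.suspended_functor_dual[OF K])
  have "suspended_functor (op_cat C) (op_susp S) D R (F \<circ>\<^sub>F dual_fun C M L)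
     (sus_comp D F t (dual_fun C M L) (sus_op S (op_susp S) (S.dsus L)))"
    using suspended_functor_comp[OF d1.suspended_functor_op, unfolded op_op, OF suspended_functor] .
  moreover have "suspended_functor (op_cat C) (op_susp S) D R (dual_fun D N K \<circ>\<^sub>F F)
     (sus_comp D (dual_fun D N K) (sus_op R (op_susp R) (R.dsus K)) F (sus_op S R t))"
    using suspended_functor_comp[OF suspended_functor_op d2.suspended_functor_op] by simp
  moreover have "far (shift R) (R.dsus K (fob (unshift R) (fob F A))) \<cdot>
        (har N (far (unshift R) (t (fob (unshift S) A))) (Ident D K) \<cdot> \<phi> (fob (unshift S) A))
      = far (shift R) (\<phi> A) \<cdot> (t (hob M A L) \<cdot> far F (far (shift S) (S.dsus L (fob (unshift S) A))))"
    if A: "A \<in> Obj C" for A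
  proof -
    let ?B = "fob (unshift S) A"
    let ?Y = "fob (unshift S) (hob M ?B L)"
    \<comment> \<open>Since \<open>T\<close> is invertible, every object has the form
      \<open>T B\<close>, and \<open>phi_dsus\<close> at \<open>B\<close> speaks about
      \<open>A\<close>.\<close>
    have B: "?B \<in> Obj C" "fob (shift S) ?B = A" using A by simp_all
    have "far (shift R) (\<phi> A) \<cdot> (t (hob M A L) \<cdot> far F (far (shift S) (S.dsus L ?B)))
      = far (shift R) (\<phi> A \<cdot> (far F (S.dsus L ?B) \<cdot> far (unshift R) (t ?Y)))"
      using A t_nat[of "S.dsus L ?B"] by simp
    also have "\<phi> A \<cdot> (far F (S.dsus L ?B) \<cdot> far (unshift R) (t ?Y))
      = har N (t ?B) (Ident D K) \<cdot> (R.dsus K (fob F ?B) \<cdot> far (unshift R) (\<phi> ?B))"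
      using phi_dsus[OF B(1)] by (simp add: B(2))
    also have "\<dots> = R.dsus K (fob (unshift R) (fob F A)) \<cdot>
      (far (unshift R) (har N (far (unshift R) (t ?B)) (Ident D K)) \<cdot> far (unshift R) (\<phi> ?B))"
      using A R.dsus_nat[of K "far (unshift R) (t ?B)"] by (intro D.chain) simp_all
    finally show ?thesis using A by simp
  qed
  ultimately show ?thesis
    unfolding suspended_duality_preserving_def suspended_transformation_def
    using duality_preserving S.suspended_with_duality[OF L] R.suspended_with_duality[OF K]
      suspended_functor phi_nat_trans
    by (simp add: sus_comp_def sus_op_def)
qed

end

text \<open>Applying \<open>G\<close> to the condition for \<open>F\<close> produces
  \<open>G\<close> of a shuffle in \<open>D\<close>, which the condition for \<open>G\<close>
  converts into a shuffle in \<open>E\<close>; the two inverses combine into the inverse of the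
  composite structure.\<close>

lemma slax_comp:
  fixes E :: "('q, 'k) cat" (structure)
  assumes "slax C M D N F m S l r R l' r' t" "slax D N E O' G m' R l' r' Q l'' r'' u"
  shows "slax C M E O' (G \<circ>\<^sub>F F) (\<lambda>A B. far G (m A B) \<cdot> m' (fob F A) (fob F B)) S l r Q l'' r''
    (sus_comp E G u F t)"
proof -
  interpret F: slax C M D N F m S l r R l' r' t by fact
  interpret G: slax D N E O' G m' R l' r' Q l'' r'' u by fact
  show ?thesis
  proof (intro slax.intro slax_axioms.intro)
    show "lax C M E O' (G \<circ>\<^sub>F F) (\<lambda>A B. far G (m A B) \<cdot> m' (fob F A) (fob F B))"
      by (rule lax_comp[OF F.lax_axioms G.lax_axioms])
    show "susp_smc C M S l r" "susp_smc E O' Q l'' r''" by unfold_locales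
    show "sftor C S E Q (G \<circ>\<^sub>F F) (sus_comp E G u F t)"
      by unfold_locales (rule suspended_functor_comp[OF F.suspended_functor G.suspended_functor])
  next
    fix Y A assume Y: "Y \<in> Obj C" and A: "A \<in> Obj C"
    let ?TY = "fob (shift S) Y" and ?TA = "fob (shift S) A"
    let ?FY = "fob F Y" and ?FA = "fob F A"
    let ?it = "inv_arrow D (t Y)" and ?iu = "inv_arrow E (u ?FY)"
    have "far G (far F (F.S.shuffle Y A)) \<cdot> far G (m Y ?TA)
      = far G (m ?TY A \<cdot>\<^bsub>D\<^esub> ((?it \<star>\<^bsub>N\<^esub> Ident D ?FA) \<cdot>\<^bsub>D\<^esub> (F.R.shuffle ?FY ?FA \<cdot>\<^bsub>D\<^esub> (Ident D ?FY \<star>\<^bsub>N\<^esub> t A))))"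
      using Y A by (simp add: F.lam_shuffle flip: G.F.far_cmp)
    then have "far G (far F (F.S.shuffle Y A)) \<cdot> (far G (m Y ?TA) \<cdot> m' ?FY (fob F ?TA))
      = far G (m ?TY A \<cdot>\<^bsub>D\<^esub> ((?it \<star>\<^bsub>N\<^esub> Ident D ?FA) \<cdot>\<^bsub>D\<^esub> (F.R.shuffle ?FY ?FA \<cdot>\<^bsub>D\<^esub> (Ident D ?FY \<star>\<^bsub>N\<^esub> t A))))
        \<cdot> m' ?FY (fob F ?TA)"
      using Y A by (intro G.D.chain1) simp_all
    also have "\<dots> = far G (m ?TY A) \<cdot> (far G (?it \<star>\<^bsub>N\<^esub> Ident D ?FA) \<cdot> (far G (F.R.shuffle ?FY ?FA) \<cdot>
        (far G (Ident D ?FY \<star>\<^bsub>N\<^esub> t A) \<cdot> m' ?FY (fob F ?TA))))"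
      using Y A by simp
    also have "far G (Ident D ?FY \<star>\<^bsub>N\<^esub> t A) \<cdot> m' ?FY (fob F ?TA)
      = m' ?FY (fob (shift R) ?FA) \<cdot> (Ident E (fob G ?FY) \<star>\<^bsub>O'\<^esub> far G (t A))"
      using Y A G.lam_nat[of "Ident D ?FY" "t A"] by simp
    also have "far G (F.R.shuffle ?FY ?FA) \<cdot>
        (m' ?FY (fob (shift R) ?FA) \<cdot> (Ident E (fob G ?FY) \<star>\<^bsub>O'\<^esub> far G (t A)))
      = (m' (fob (shift R) ?FY) ?FA \<cdot> ((?iu \<star>\<^bsub>O'\<^esub> Ident E (fob G ?FA)) \<cdot>
        (G.R.shuffle (fob G ?FY) (fob G ?FA) \<cdot> (Ident E (fob G ?FY) \<star>\<^bsub>O'\<^esub> u ?FA)))) \<cdot>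
        (Ident E (fob G ?FY) \<star>\<^bsub>O'\<^esub> far G (t A))"
      using Y A G.lam_shuffle[of ?FY ?FA] by (intro G.D.chain1) simp_all
    also have "\<dots> = m' (fob (shift R) ?FY) ?FA \<cdot> ((?iu \<star>\<^bsub>O'\<^esub> Ident E (fob G ?FA)) \<cdot>
        (G.R.shuffle (fob G ?FY) (fob G ?FA) \<cdot> (Ident E (fob G ?FY) \<star>\<^bsub>O'\<^esub> (u ?FA \<cdot> far G (t A)))))"
      using Y A by simp
    also have "far G (?it \<star>\<^bsub>N\<^esub> Ident D ?FA) \<cdot> (m' (fob (shift R) ?FY) ?FA \<cdot>
        ((?iu \<star>\<^bsub>O'\<^esub> Ident E (fob G ?FA)) \<cdot>
        (G.R.shuffle (fob G ?FY) (fob G ?FA) \<cdot> (Ident E (fob G ?FY) \<star>\<^bsub>O'\<^esub> (u ?FA \<cdot> far G (t A))))))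
      = m' (fob F ?TY) ?FA \<cdot> ((far G ?it \<star>\<^bsub>O'\<^esub> far G (Ident D ?FA)) \<cdot>
        ((?iu \<star>\<^bsub>O'\<^esub> Ident E (fob G ?FA)) \<cdot>
        (G.R.shuffle (fob G ?FY) (fob G ?FA) \<cdot> (Ident E (fob G ?FY) \<star>\<^bsub>O'\<^esub> (u ?FA \<cdot> far G (t A))))))"
      using Y A G.lam_nat[of ?it "Ident D ?FA", symmetric] by (intro G.D.chain) simp_all
    finally show "far (G \<circ>\<^sub>F F) (F.S.shuffle Y A) \<cdot> (far G (m Y ?TA) \<cdot> m' ?FY (fob F ?TA))
      = (far G (m ?TY A) \<cdot> m' (fob F ?TY) ?FA) \<cdot>
        ((inv_arrow E (sus_comp E G u F t Y) \<star>\<^bsub>O'\<^esub> Ident E (fob (G \<circ>\<^sub>F F) A)) \<cdot>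
        (G.R.shuffle (fob (G \<circ>\<^sub>F F) Y) (fob (G \<circ>\<^sub>F F) A) \<cdot>
        (Ident E (fob (G \<circ>\<^sub>F F) Y) \<star>\<^bsub>O'\<^esub> sus_comp E G u F t A)))"
      using Y A by (simp add: sus_comp_def G.D.inv_cmp G.F.inv_far)
  qed
qed

lemma slax_id:
  assumes "suspended_smc C M S l r"
  shows "slax C M C M id_fun (\<lambda>A B. Ident C (A \<odot>\<^bsub>M\<^esub> B)) S l r S l r (sus_id C S)"
proof -
  interpret susp_smc C M S l r by unfold_locales fact
  have *: "sftor C S C S id_fun (sus_id C S)" by unfold_locales (rule suspended_functor_id[OF suspended])
  show ?thesis
    by (intro slax.intro slax_axioms.intro lax_id smc susp_smc_axioms *) (simp_all add: sus_id_def inv_Ident)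
qed

section \<open>Suspended adjunctions\<close>

text \<open>Condition \<open>counit_susp\<close> says that the counit is a morphism of suspended
  functors; by transposition it expresses \<open>u\<close> through \<open>t\<close>.\<close>

locale susp_adj = adj C D F G \<eta> \<epsilon> + F: sftor C S D R F t + G: sftor D R C S G u
  for C :: "('o, 'm) cat" and S and D :: "('p, 'n) cat" (structure) and R and F t G u \<eta> \<epsilon> +
  assumes counit_susp: "B \<in> Obj D \<Longrightarrow>
    \<epsilon> (fob (shift R) B) = far (shift R) (\<epsilon> B) \<cdot> (t (fob G B) \<cdot> far F (u B))"
begin

lemma counit_susp_chain:
  assumes "B \<in> Obj D" "x \<in> Arr C" "Cod C x = fob (shift S) (fob G B)"
  shows "\<epsilon> (fob (shift R) B) \<cdot> far F (inv_arrow C (u B) \<cdot>\<^bsub>C\<^esub> x)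
    = far (shift R) (\<epsilon> B) \<cdot> (t (fob G B) \<cdot> far F x)"
proof -
  have "far F (u B) \<cdot> (far F (inv_arrow C (u B)) \<cdot> far F x)
    = far F (u B \<cdot>\<^bsub>C\<^esub> (inv_arrow C (u B) \<cdot>\<^bsub>C\<^esub> x))"
    using assms F.far_cmp[of "inv_arrow C (u B) \<cdot>\<^bsub>C\<^esub> x" "u B"] F.far_cmp[of x "inv_arrow C (u B)"]
    by (simp del: F.far_cmp F.C.inv_chain)
  then show ?thesis using assms by (simp add: counit_susp)
qed

text \<open>As \<open>u\<close> identifies \<open>G T B\<close> with \<open>T G B\<close>, arrows
  into \<open>T G B\<close> can be tested by transposition too; the transposes compared are written
  with \<open>t\<close> in place of \<open>u\<close>.\<close>

lemma susp_inject:
  assumes "k \<in> Arr C" "k' \<in> Arr C" "Cod C k = fob (shift S) (fob G B)" "Cod C k' = fob (shift S) (fob G B)"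
    "Dom C k = Dom C k'" "B \<in> Obj D"
    and eq: "far (shift R) (\<epsilon> B) \<cdot> (t (fob G B) \<cdot> far F k)
      = far (shift R) (\<epsilon> B) \<cdot> (t (fob G B) \<cdot> far F k')"
  shows "k = k'"
proof -
  have "inv_arrow C (u B) \<cdot>\<^bsub>C\<^esub> k = inv_arrow C (u B) \<cdot>\<^bsub>C\<^esub> k'"
    by (rule sharp_inject[where B = "fob (shift R) B"])
      (use assms in \<open>simp_all only: counit_susp_chain, simp_all\<close>)
  from arg_cong[OF this, of "\<lambda>x. u B \<cdot>\<^bsub>C\<^esub> x"] show ?thesis
    using assms by simp
qed

end

lemma counit_susp_comp:
  fixes E :: "('q, 'k) cat" (structure)
  assumes "susp_adj C S D R F t G u \<eta> \<epsilon>" "susp_adj D R E Q F' t' G' u' \<eta>' \<epsilon>'"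
  shows "susp_adj C S E Q (F' \<circ>\<^sub>F F) (sus_comp E F' t' F t) (G \<circ>\<^sub>F G') (sus_comp C G u G' u')
    (\<lambda>A. far G (\<eta>' (fob F A)) \<cdot>\<^bsub>C\<^esub> \<eta> A) (\<lambda>B. \<epsilon>' B \<cdot> far F' (\<epsilon> (fob G' B)))"
proof -
  interpret A: susp_adj C S D R F t G u \<eta> \<epsilon> by fact
  interpret B: susp_adj D R E Q F' t' G' u' \<eta>' \<epsilon>' by fact
  show ?thesis
  proof (intro susp_adj.intro susp_adj_axioms.intro)
    show "adj C E (F' \<circ>\<^sub>F F) (G \<circ>\<^sub>F G') (\<lambda>A. far G (\<eta>' (fob F A)) \<cdot>\<^bsub>C\<^esub> \<eta> A)
      (\<lambda>B. \<epsilon>' B \<cdot> far F' (\<epsilon> (fob G' B)))"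
      by (rule adj_of[OF adjunction_comp[OF A.adjunction B.adjunction]])
    show "sftor C S E Q (F' \<circ>\<^sub>F F) (sus_comp E F' t' F t)"
      by unfold_locales (rule suspended_functor_comp[OF A.F.suspended_functor B.F.suspended_functor])
    show "sftor E Q C S (G \<circ>\<^sub>F G') (sus_comp C G u G' u')"
      by unfold_locales (rule suspended_functor_comp[OF B.G.suspended_functor A.G.suspended_functor])
  next
    fix B assume B: "B \<in> Obj E"
    let ?G = "fob G' B" and ?T = "fob (shift Q) B"
    have "far (shift R) (\<epsilon> ?G) \<cdot>\<^bsub>D\<^esub> (t (fob G ?G) \<cdot>\<^bsub>D\<^esub> (far F (u ?G) \<cdot>\<^bsub>D\<^esub> far F (far G (u' B))))
      = \<epsilon> (fob (shift R) ?G) \<cdot>\<^bsub>D\<^esub> far F (far G (u' B))"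
      using B by (subst A.counit_susp) simp_all
    also have "\<dots> = u' B \<cdot>\<^bsub>D\<^esub> \<epsilon> (fob G' ?T)"
      using B by simp
    finally have 1: "far (shift R) (\<epsilon> ?G) \<cdot>\<^bsub>D\<^esub> (t (fob G ?G) \<cdot>\<^bsub>D\<^esub> (far F (u ?G) \<cdot>\<^bsub>D\<^esub> far F (far G (u' B))))
      = u' B \<cdot>\<^bsub>D\<^esub> \<epsilon> (fob G' ?T)" .
    have "far (shift Q) (far F' (\<epsilon> ?G)) \<cdot>
        (t' (fob F (fob G ?G)) \<cdot> far F' (t (fob G ?G) \<cdot>\<^bsub>D\<^esub> (far F (u ?G) \<cdot>\<^bsub>D\<^esub> far F (far G (u' B)))))
      = t' ?G \<cdot> (far F' (far (shift R) (\<epsilon> ?G)) \<cdot>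
        far F' (t (fob G ?G) \<cdot>\<^bsub>D\<^esub> (far F (u ?G) \<cdot>\<^bsub>D\<^esub> far F (far G (u' B)))))"
      using B B.F.t_nat[of "\<epsilon> ?G"] by (intro B.F.D.chain) simp_all
    also have "\<dots> = t' ?G \<cdot> far F' (far (shift R) (\<epsilon> ?G) \<cdot>\<^bsub>D\<^esub>
        (t (fob G ?G) \<cdot>\<^bsub>D\<^esub> (far F (u ?G) \<cdot>\<^bsub>D\<^esub> far F (far G (u' B)))))"
      using B by simp
    also have "\<dots> = t' ?G \<cdot> (far F' (u' B) \<cdot> far F' (\<epsilon> (fob G' ?T)))"
      unfolding 1 using B by simp
    finally show "\<epsilon>' ?T \<cdot> far F' (\<epsilon> (fob G' ?T)) =
         far (shift Q) (\<epsilon>' B \<cdot> far F' (\<epsilon> ?G)) \<cdot>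
         (sus_comp E F' t' F t (fob (G \<circ>\<^sub>F G') B) \<cdot> far (F' \<circ>\<^sub>F F) (sus_comp C G u G' u' B))"
      using B by (simp add: sus_comp_def B.counit_susp)
  qed
qed

locale susp_conjugate = conjugate C D F G \<eta> \<epsilon> F' G' \<eta>' \<epsilon>' a +
  P: susp_adj C S D R F t G u \<eta> \<epsilon> + P': susp_adj C S D R F' t' G' u' \<eta>' \<epsilon>'
  for C :: "('o, 'm) cat" and S and D :: "('p, 'n) cat" (structure) and R F t G u \<eta> \<epsilon> F' t' G' u' \<eta>' \<epsilon>' a +
  assumes a_susp: "A \<in> Obj C \<Longrightarrow>
    t' A \<cdot> a (fob (shift S) A) = far (shift R) (a A) \<cdot> t A"
begin

text \<open>Under the test \<open>susp_inject\<close>, suspendedness of the two counits converts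
  \<open>u\<close> and \<open>u'\<close> into \<open>t\<close> and \<open>t'\<close>, and the claim
  becomes \<open>a_susp\<close> combined with \<open>counit_conj\<close>.\<close>

lemma conj_susp:
  assumes B: "B \<in> Obj D"
  shows "u B \<cdot>\<^bsub>C\<^esub> conj_ar (fob (shift R) B) = far (shift S) (conj_ar B) \<cdot>\<^bsub>C\<^esub> u' B"
proof (rule P.susp_inject[where B = B])
  let ?T = "fob (shift R) B"
  have "far (shift R) (\<epsilon> B) \<cdot> (t (fob G B) \<cdot> (far F (u B) \<cdot> far F (conj_ar ?T)))
    = \<epsilon> ?T \<cdot> far F (conj_ar ?T)"
    using B by (simp add: P.counit_susp)
  also have "\<dots> = \<epsilon>' ?T \<cdot> a (fob G' ?T)"
    using B by (simp add: counit_conj)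
  also have "\<dots> = far (shift R) (\<epsilon>' B) \<cdot> (t' (fob G' B) \<cdot> (far F' (u' B) \<cdot> a (fob G' ?T)))"
    using B by (simp add: P'.counit_susp)
  also have "far F' (u' B) \<cdot> a (fob G' ?T) = a (fob (shift S) (fob G' B)) \<cdot> far F (u' B)"
    using B a_nat[of "u' B"] by simp
  also have "t' (fob G' B) \<cdot> (a (fob (shift S) (fob G' B)) \<cdot> far F (u' B))
    = far (shift R) (a (fob G' B)) \<cdot> (t (fob G' B) \<cdot> far F (u' B))"
    using B by (intro A.F.D.chain a_susp) simp_all
  also have "far (shift R) (\<epsilon>' B) \<cdot>
      (far (shift R) (a (fob G' B)) \<cdot> (t (fob G' B) \<cdot> far F (u' B)))
    = far (shift R) (\<epsilon> B) \<cdot>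
      (far (shift R) (far F (conj_ar B)) \<cdot> (t (fob G' B) \<cdot> far F (u' B)))"
    using B counit_conj[of B] by (intro A.F.D.chain P.F.R.T.commute) simp_all
  also have "far (shift R) (far F (conj_ar B)) \<cdot> (t (fob G' B) \<cdot> far F (u' B))
    = t (fob G B) \<cdot> (far F (far (shift S) (conj_ar B)) \<cdot> far F (u' B))"
    using B P.F.t_nat[of "conj_ar B"] by (intro A.F.D.chain) simp_all
  finally show "far (shift R) (\<epsilon> B) \<cdot> (t (fob G B) \<cdot> far F (u B \<cdot>\<^bsub>C\<^esub> conj_ar ?T))
    = far (shift R) (\<epsilon> B) \<cdot> (t (fob G B) \<cdot> far F (far (shift S) (conj_ar B) \<cdot>\<^bsub>C\<^esub> u' B))"
    using B by simp
qed (use B in simp_all)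

lemma suspended_conj: "suspended_transformation D R C S G' u' G u conj_ar"
  unfolding suspended_transformation_def
  using P.G.suspended_functor P'.G.suspended_functor conj_nat_iso conj_susp
  by (simp add: nat_iso_def)

end

locale susp_monoidal_adj = monoidal_adj C M D N F G \<eta> \<epsilon> \<alpha> + susp_adj C S D R F t G u \<eta> \<epsilon> +
  S: susp_smc C M S l r + R: susp_smc D N R l' r'
  for C :: "('o, 'm) cat" and M and D :: "('p, 'n) cat" (structure) and N and F G \<eta> \<epsilon> \<alpha> S l r R l' r' t u +
  assumes alpha_l: "A \<in> Obj C \<Longrightarrow> B \<in> Obj C \<Longrightarrow>
      t (A \<odot>\<^bsub>M\<^esub> B) \<cdot> (far F (l (A, B)) \<cdot> \<alpha> (fob (shift S) A, B))
      = far (shift R) (\<alpha> (A, B)) \<cdot> (l' (fob F A, fob F B) \<cdot> (t A \<star>\<^bsub>N\<^esub> Ident D (fob F B)))"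
    and alpha_r: "A \<in> Obj C \<Longrightarrow> B \<in> Obj C \<Longrightarrow>
      t (A \<odot>\<^bsub>M\<^esub> B) \<cdot> (far F (r (A, B)) \<cdot> \<alpha> (A, fob (shift S) B))
      = far (shift R) (\<alpha> (A, B)) \<cdot> (r' (fob F A, fob F B) \<cdot> (Ident D (fob F A) \<star>\<^bsub>N\<^esub> t B))"
begin

text \<open>This is the equation \<open>lam_shuffle\<close> for the left adjoint. Since
  \<open>r\<close> equals \<open>l\<close> after the shuffle, it results from \<open>alpha_r\<close>
  on cancelling the isomorphism \<open>t\<close> after \<open>F l\<close>, which
  \<open>alpha_l\<close> controls.\<close>

lemma alpha_shuffle:
  assumes A: "A \<in> Obj C" and B: "B \<in> Obj C"
  shows "far F (S.shuffle A B) \<cdot> \<alpha> (A, fob (shift S) B)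
    = \<alpha> (fob (shift S) A, B) \<cdot> ((inv_arrow D (t A) \<star>\<^bsub>N\<^esub> Ident D (fob F B)) \<cdot>
      (R.shuffle (fob F A) (fob F B) \<cdot> (Ident D (fob F A) \<star>\<^bsub>N\<^esub> t B)))" (is "_ = ?rhs")
proof (rule D.iso_mono[of "t (A \<odot>\<^bsub>M\<^esub> B) \<cdot> far F (l (A, B))"])
  let ?x = "(inv_arrow D (t A) \<star>\<^bsub>N\<^esub> Ident D (fob F B)) \<cdot>
      (R.shuffle (fob F A) (fob F B) \<cdot> (Ident D (fob F A) \<star>\<^bsub>N\<^esub> t B))"
  show "iso_arrow D (t (A \<odot>\<^bsub>M\<^esub> B) \<cdot> far F (l (A, B)))"
    using A B by (intro D.iso_cmp F.iso_far) simp_all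
  have "t (A \<odot>\<^bsub>M\<^esub> B) \<cdot> (far F (l (A, B)) \<cdot> (\<alpha> (fob (shift S) A, B) \<cdot> ?x))
    = (far (shift R) (\<alpha> (A, B)) \<cdot> (l' (fob F A, fob F B) \<cdot> (t A \<star>\<^bsub>N\<^esub> Ident D (fob F B)))) \<cdot> ?x"
    using A B alpha_l[OF A B] by (intro D.chain3) simp_all
  also have "\<dots> = far (shift R) (\<alpha> (A, B)) \<cdot> (l' (fob F A, fob F B) \<cdot>
      (R.shuffle (fob F A) (fob F B) \<cdot> (Ident D (fob F A) \<star>\<^bsub>N\<^esub> t B)))"
    using A B by simp
  also have "l' (fob F A, fob F B) \<cdot> (R.shuffle (fob F A) (fob F B) \<cdot> (Ident D (fob F A) \<star>\<^bsub>N\<^esub> t B))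
    = r' (fob F A, fob F B) \<cdot> (Ident D (fob F A) \<star>\<^bsub>N\<^esub> t B)"
    using A B by (intro D.chain1 R.l_shuffle) simp_all
  also have "far (shift R) (\<alpha> (A, B)) \<cdot> (r' (fob F A, fob F B) \<cdot> (Ident D (fob F A) \<star>\<^bsub>N\<^esub> t B))
    = t (A \<odot>\<^bsub>M\<^esub> B) \<cdot> (far F (r (A, B)) \<cdot> \<alpha> (A, fob (shift S) B))"
    using A B by (simp add: alpha_r)
  also have "far F (r (A, B)) = far F (l (A, B)) \<cdot> far F (S.shuffle A B)"
    using A B by (simp add: S.l_shuffle flip: F.far_cmp)
  finally show "(t (A \<odot>\<^bsub>M\<^esub> B) \<cdot> far F (l (A, B))) \<cdot> (far F (S.shuffle A B) \<cdot> \<alpha> (A, fob (shift S) B))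
    = (t (A \<odot>\<^bsub>M\<^esub> B) \<cdot> far F (l (A, B))) \<cdot> ?rhs"
    using A B by simp
qed (use A B in simp_all)

text \<open>The shuffle law passes from the left adjoint to the right adjoint: by
  \<open>tens_inject\<close> both sides become the shuffle in \<open>D\<close> after
  \<open>\<epsilon> Y \<otimes> \<epsilon> (T A)\<close>.\<close>

lemma slax_lam: "slax D N C M G lam R l' r' S l r u"
proof (intro slax.intro slax_axioms.intro)
  show "lax D N C M G lam" by (rule lax_lam)
  show "susp_smc D N R l' r'" "susp_smc C M S l r" "sftor D R C S G u" by unfold_locales
next
  fix Y A assume Y: "Y \<in> Obj D" and A: "A \<in> Obj D"
  let ?TY = "fob (shift R) Y" and ?TA = "fob (shift R) A"
  let ?GY = "fob G Y" and ?GA = "fob G A"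
  let ?TGY = "fob (shift S) ?GY" and ?TGA = "fob (shift S) ?GA"
  let ?it = "inv_arrow D (t ?GY)" and ?iu = "inv_arrow C (u Y)"
  let ?i = "Ident D (fob F ?GA)" and ?j = "Ident D (fob F ?GY)"
  show "far G (R.shuffle Y A) \<cdot>\<^bsub>C\<^esub> lam Y ?TA = lam ?TY A \<cdot>\<^bsub>C\<^esub> ((?iu \<star>\<^bsub>M\<^esub> Ident C ?GA) \<cdot>\<^bsub>C\<^esub>
    (S.shuffle ?GY ?GA \<cdot>\<^bsub>C\<^esub> (Ident C ?GY \<star>\<^bsub>M\<^esub> u A)))"
    (is "_ = ?rhs")
  proof (rule tens_inject[where E = "?TY \<odot>\<^bsub>N\<^esub> A" and A = ?GY and B = "fob G ?TA"])
    \<comment> \<open>The first factor: the inverses of \<open>u\<close> and \<open>t\<close>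
      together turn the counit at \<open>T Y\<close> into \<open>T\<close> of the counit at
      \<open>Y\<close>, to which naturality of the shuffle applies.\<close>
    have e: "\<epsilon> ?TY \<cdot> (far F ?iu \<cdot> ?it) = far (shift R) (\<epsilon> Y)"
    proof -
      have "\<epsilon> ?TY \<cdot> far F ?iu = far (shift R) (\<epsilon> Y) \<cdot> t ?GY"
        using Y counit_susp_chain[of Y "Ident C ?TGY"] by simp
      then have "\<epsilon> ?TY \<cdot> (far F ?iu \<cdot> ?it) = far (shift R) (\<epsilon> Y) \<cdot> (t ?GY \<cdot> ?it)"
        using Y by (intro D.chain) simp_all
      then show ?thesis using Y by simp
    qed
    have "far F (Ident C ?GY \<star>\<^bsub>M\<^esub> u A) \<cdot> \<alpha> (?GY, fob G ?TA) = \<alpha> (?GY, ?TGA) \<cdot> (?j \<star>\<^bsub>N\<^esub> far F (u A))"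
      using Y A alpha_nat[of "Ident C ?GY" "u A"] by simp
    moreover have "far F (S.shuffle ?GY ?GA) \<cdot> (\<alpha> (?GY, ?TGA) \<cdot> (?j \<star>\<^bsub>N\<^esub> far F (u A)))
      = (\<alpha> (?TGY, ?GA) \<cdot> ((?it \<star>\<^bsub>N\<^esub> ?i) \<cdot>
        (R.shuffle (fob F ?GY) (fob F ?GA) \<cdot> (?j \<star>\<^bsub>N\<^esub> t ?GA)))) \<cdot> (?j \<star>\<^bsub>N\<^esub> far F (u A))"
      using Y A by (intro D.chain1 alpha_shuffle) simp_all
    moreover have "far F (?iu \<star>\<^bsub>M\<^esub> Ident C ?GA) \<cdot> (\<alpha> (?TGY, ?GA) \<cdot> ((?it \<star>\<^bsub>N\<^esub> ?i) \<cdot>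
        (R.shuffle (fob F ?GY) (fob F ?GA) \<cdot> (?j \<star>\<^bsub>N\<^esub> (t ?GA \<cdot> far F (u A))))))
      = \<alpha> (fob G ?TY, ?GA) \<cdot> ((far F ?iu \<star>\<^bsub>N\<^esub> far F (Ident C ?GA)) \<cdot> ((?it \<star>\<^bsub>N\<^esub> ?i) \<cdot>
        (R.shuffle (fob F ?GY) (fob F ?GA) \<cdot> (?j \<star>\<^bsub>N\<^esub> (t ?GA \<cdot> far F (u A))))))"
      using Y A alpha_nat[of ?iu "Ident C ?GA", symmetric] by (intro D.chain) simp_all
    ultimately have "\<epsilon> (?TY \<odot>\<^bsub>N\<^esub> A) \<cdot> (far F ?rhs \<cdot> \<alpha> (?GY, fob G ?TA))
      = ((\<epsilon> ?TY \<cdot> (far F ?iu \<cdot> ?it)) \<star>\<^bsub>N\<^esub> \<epsilon> A) \<cdot>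
        (R.shuffle (fob F ?GY) (fob F ?GA) \<cdot> (?j \<star>\<^bsub>N\<^esub> (t ?GA \<cdot> far F (u A))))"
      using Y A by (simp add: lam_alpha_chain)
    also have "\<dots> = R.shuffle Y A \<cdot> ((\<epsilon> Y \<star>\<^bsub>N\<^esub> far (shift R) (\<epsilon> A)) \<cdot> (?j \<star>\<^bsub>N\<^esub> (t ?GA \<cdot> far F (u A))))"
      unfolding e using Y A R.shuffle_nat[of "\<epsilon> Y" "\<epsilon> A", symmetric] by (intro D.chain) simp_all
    also have "\<dots> = R.shuffle Y A \<cdot> (\<epsilon> Y \<star>\<^bsub>N\<^esub> \<epsilon> ?TA)"
      using Y A by (simp add: counit_susp)
    finally show "\<epsilon> (?TY \<odot>\<^bsub>N\<^esub> A) \<cdot> (far F (far G (R.shuffle Y A) \<cdot>\<^bsub>C\<^esub> lam Y ?TA) \<cdot> \<alpha> (?GY, fob G ?TA))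
      = \<epsilon> (?TY \<odot>\<^bsub>N\<^esub> A) \<cdot> (far F ?rhs \<cdot> \<alpha> (?GY, fob G ?TA))"
      using Y A by (simp add: lam_alpha)
  qed (use Y A in simp_all)
qed

end

section \<open>Right adjoints of exact functors\<close>

context susp
begin

lemma zero_simps [simp]:
  assumes "A \<in> Obj C" "B \<in> Obj C"
  shows "zero_ar S A B \<in> Arr C" "Dom C (zero_ar S A B) = A" "Cod C (zero_ar S A B) = B"
proof -
  interpret comm_group "hom_group C S A B" using assms by (intro hom_group) simp_all
  show "zero_ar S A B \<in> Arr C" "Dom C (zero_ar S A B) = A" "Cod C (zero_ar S A B) = B"
    using one_closed by (simp_all add: hom_group_def)
qed

lemma neg_simps [simp]:
  assumes "f \<in> Arr C"
  shows "neg_ar C S f \<in> Arr C" "Dom C (neg_ar C S f) = Dom C f" "Cod C (neg_ar C S f) = Cod C f"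
proof -
  interpret comm_group "hom_group C S (Dom C f) (Cod C f)" using assms by (intro hom_group) simp_all
  show "neg_ar C S f \<in> Arr C" "Dom C (neg_ar C S f) = Dom C f" "Cod C (neg_ar C S f) = Cod C f"
    using inv_closed[of f] assms by (simp_all add: hom_group_def neg_ar_def)
qed

lemma add_zero [simp]: "f \<in> Arr C \<Longrightarrow> Dom C f = A \<Longrightarrow> Cod C f = B \<Longrightarrow> add_ar S (zero_ar S A B) f = f"
  and add_neg [simp]: "f \<in> Arr C \<Longrightarrow> Dom C f = A \<Longrightarrow> Cod C f = B \<Longrightarrow> add_ar S f (neg_ar C S f) = zero_ar S A B"
proof -
  assume f: "f \<in> Arr C" "Dom C f = A" "Cod C f = B"
  then interpret comm_group "hom_group C S A B" by (intro hom_group) auto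
  show "add_ar S (zero_ar S A B) f = f" "add_ar S f (neg_ar C S f) = zero_ar S A B"
    using l_one[of f] r_inv[of f] f by (simp_all add: hom_group_def neg_ar_def)
qed

lemma add_cancel:
  assumes "f \<in> Arr C" "g \<in> Arr C" "Dom C f = Dom C g" "Cod C f = Cod C g" "add_ar S f g = f"
  shows "g = zero_ar S (Dom C g) (Cod C g)"
proof -
  interpret comm_group "hom_group C S (Dom C g) (Cod C g)" using assms by (intro hom_group) auto
  show ?thesis using l_cancel_one[of f g] assms by (simp add: hom_group_def)
qed

lemma neg_unique:
  assumes "f \<in> Arr C" "g \<in> Arr C" "Dom C f = Dom C g" "Cod C f = Cod C g"
    "add_ar S f g = zero_ar S (Dom C g) (Cod C g)"
  shows "g = neg_ar C S f"
proof -
  interpret comm_group "hom_group C S (Dom C g) (Cod C g)" using assms by (intro hom_group) auto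
  show ?thesis using inv_equality[of g f] m_comm[of f g] assms by (simp add: hom_group_def neg_ar_def)
qed

lemma sub_add:
  assumes "y \<in> Arr C" "z \<in> Arr C" "Dom C y = Dom C z" "Cod C y = Cod C z"
  shows "add_ar S (add_ar S y (neg_ar C S z)) z = y"
proof -
  interpret comm_group "hom_group C S (Dom C z) (Cod C z)" using assms by (intro hom_group) auto
  show ?thesis using inv_solve_right[of y z] m_assoc[of y "inv\<^bsub>hom_group C S (Dom C z) (Cod C z)\<^esub> z" z] l_inv[of z] r_one[of y]
      inv_closed[of z] assms by (simp add: hom_group_def neg_ar_def)
qed

text \<open>By bilinearity the composite is unchanged on being added to itself, and in a group this
  forces it to be zero.\<close>

lemma cmp_zero [simp]:
  assumes "f \<in> Arr C"
  shows "A \<in> Obj C \<Longrightarrow> Dom C f = B \<Longrightarrow> f \<cdot> zero_ar S A B = zero_ar S A (Cod C f)"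
    "B \<in> Obj C \<Longrightarrow> Cod C f = A \<Longrightarrow> zero_ar S A B \<cdot> f = zero_ar S (Dom C f) B"
proof -
  assume A: "A \<in> Obj C" "Dom C f = B"
  have "add_ar S (f \<cdot> zero_ar S A B) (f \<cdot> zero_ar S A B) = f \<cdot> add_ar S (zero_ar S A B) (zero_ar S A B)"
    using A assms by (subst add_right) auto
  then show "f \<cdot> zero_ar S A B = zero_ar S A (Cod C f)"
    using add_cancel[of "f \<cdot> zero_ar S A B" "f \<cdot> zero_ar S A B"] A assms by auto
next
  assume B: "B \<in> Obj C" "Cod C f = A"
  have "add_ar S (zero_ar S A B \<cdot> f) (zero_ar S A B \<cdot> f) = add_ar S (zero_ar S A B) (zero_ar S A B) \<cdot> f"
    using B assms by (subst add_left) auto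
  then show "zero_ar S A B \<cdot> f = zero_ar S (Dom C f) B"
    using add_cancel[of "zero_ar S A B \<cdot> f" "zero_ar S A B \<cdot> f"] B assms by auto
qed

lemma cmp_neg:
  assumes "f \<in> Arr C" "g \<in> Arr C" "Dom C g = Cod C f"
  shows "g \<cdot> neg_ar C S f = neg_ar C S (g \<cdot> f)" "neg_ar C S g \<cdot> f = neg_ar C S (g \<cdot> f)"
  by (rule neg_unique; use assms in \<open>simp flip: add_left add_right\<close>)+

lemma neg_inject:
  assumes "f \<in> Arr C" "g \<in> Arr C" "Dom C f = Dom C g" "Cod C f = Cod C g" "neg_ar C S f = neg_ar C S g"
  shows "f = g"
proof -
  interpret comm_group "hom_group C S (Dom C g) (Cod C g)" using assms by (intro hom_group) auto
  show ?thesis using inv_inj assms by (auto simp: inj_on_def hom_group_def neg_ar_def)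
qed

lemma neg_zero [simp]: "A \<in> Obj C \<Longrightarrow> B \<in> Obj C \<Longrightarrow> neg_ar C S (zero_ar S A B) = zero_ar S A B"
  by (rule neg_unique[symmetric]) simp_all

end

lemma (in sftor) far_zero [simp]:
  assumes "A \<in> Obj C" "B \<in> Obj C"
  shows "far F (zero_ar S A B) = zero_ar R (fob F A) (fob F B)"
  using far_add[of "zero_ar S A B" "zero_ar S A B"] R.add_cancel[of "far F (zero_ar S A B)" "far F (zero_ar S A B)"]
    assms by simp

section \<open>Distinguished triangles and exactness of Hom\<close>

locale tri =
  fixes C :: "('o, 'm) cat" (structure) and S \<Delta>
  assumes triangulated: "triangulated_category C S \<Delta>"

sublocale tri \<subseteq> susp C S
  by unfold_locales (use triangulated in \<open>simp add: triangulated_category_def\<close>)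

context tri
begin

lemmas tri_axioms = conjunct2[OF triangulated[unfolded triangulated_category_def]]

lemma triD [simp]:
  assumes "(u, v, w) \<in> \<Delta>"
  shows "u \<in> Arr C" "v \<in> Arr C" "w \<in> Arr C" "Cod C u = Dom C v" "Dom C w = Cod C v"
    "Cod C w = fob T (Dom C u)"
proof -
  have "triangle C S (u, v, w)"
    using tri_axioms[THEN conjunct1] assms by blast
  then show "u \<in> Arr C" "v \<in> Arr C" "w \<in> Arr C" "Cod C u = Dom C v" "Dom C w = Cod C v"
    "Cod C w = fob T (Dom C u)"
    by (auto simp: triangle_def)
qed

lemma triangleI:
  assumes "u \<in> Arr C" "v \<in> Arr C" "w \<in> Arr C" "Cod C u = Dom C v" "Dom C w = Cod C v"
    "Cod C w = fob T (Dom C u)"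
  shows "triangle C S (u, v, w)"
  using assms by (auto simp: triangle_def)

lemma rotate: "(u, v, w) \<in> \<Delta> \<Longrightarrow> (v, w, neg_ar C S (far T u)) \<in> \<Delta>"
  using tri_axioms[THEN conjunct2, THEN conjunct2, THEN conjunct2, THEN conjunct2, THEN conjunct1]
    triangleI[of u v w] triD[of u v w] by blast

lemma complete: "u \<in> Arr C \<Longrightarrow> \<exists>v w. (u, v, w) \<in> \<Delta>"
  using tri_axioms[THEN conjunct2, THEN conjunct2, THEN conjunct2, THEN conjunct1] by blast

lemma tri_iso:
  assumes "(u, v, w) \<in> \<Delta>" "triangle C S (u', v', w')"
    "a \<in> homs C (Dom C u) (Dom C u')" "b \<in> homs C (Cod C u) (Cod C u')" "e \<in> homs C (Cod C v) (Cod C v')"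
    "iso_arrow C a" "iso_arrow C b" "iso_arrow C e"
    "b \<cdot> u = u' \<cdot> a" "e \<cdot> v = v' \<cdot> b" "far T a \<cdot> w = w' \<cdot> e"
  shows "(u', v', w') \<in> \<Delta>"
  by (rule tri_axioms[THEN conjunct2, THEN conjunct1, rule_format, OF assms])

lemma tri_fill:
  assumes "(u, v, w) \<in> \<Delta>" "(u', v', w') \<in> \<Delta>"
    "a \<in> homs C (Dom C u) (Dom C u')" "b \<in> homs C (Cod C u) (Cod C u')" "b \<cdot> u = u' \<cdot> a"
  obtains e where "e \<in> homs C (Cod C v) (Cod C v')" "e \<cdot> v = v' \<cdot> b" "far T a \<cdot> w = w' \<cdot> e"
  using tri_axioms[THEN conjunct2, THEN conjunct2, THEN conjunct2, THEN conjunct2, THEN conjunct2,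
      THEN conjunct1, rule_format, OF assms] that by blast

lemma trivial_triangle:
  assumes "A \<in> Obj C"
  obtains Z where "Z \<in> Obj C" "(Ident C A, zero_ar S A Z, zero_ar S Z (fob T A)) \<in> \<Delta>"
proof -
  obtain Z where "zero_object C Z"
    using suspended unfolding suspended_category_def additive_category_def by blast
  then show ?thesis
    using that assms tri_axioms[THEN conjunct2, THEN conjunct2, THEN conjunct1]
    unfolding zero_object_def by blast
qed

lemma tri_zero:
  assumes t: "(u, v, w) \<in> \<Delta>"
  shows "v \<cdot> u = zero_ar S (Dom C u) (Cod C v)"
proof -
  note d = triD[OF t]
  obtain Z where Z: "Z \<in> Obj C" "(Ident C (Dom C u), zero_ar S (Dom C u) Z, zero_ar S Z (fob T (Dom C u))) \<in> \<Delta>"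
    using trivial_triangle[of "Dom C u"] d by auto
  \<comment> \<open>The pair of the identity and \<open>u\<close> extends to a map from the triangle
    on an identity; its third vertex \<open>Z\<close> comes with a zero arrow, so
    \<open>v \<cdot> u\<close> factors through zero.\<close>
  obtain e where "e \<in> homs C Z (Cod C v)" "e \<cdot> zero_ar S (Dom C u) Z = v \<cdot> u"
    by (rule tri_fill[OF Z(2) t, of "Ident C (Dom C u)" u]) (use d Z in simp_all)
  then show ?thesis using d Z by simp
qed

text \<open>Exactness of \<open>Hom (W, -)\<close> at the middle vertex. Filling produces the third
  arrow of a map of triangles, so both triangles are first rotated to put the wanted arrow in that
  place; it appears suspended there, and \<open>U\<close> removes the suspension.\<close>

lemma tri_exact:
  assumes t: "(u, v, w) \<in> \<Delta>" and m: "m \<in> Arr C" "Cod C m = Dom C v" "v \<cdot> m = zero_ar S (Dom C m) (Cod C v)"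
  obtains n where "n \<in> Arr C" "Dom C n = Dom C m" "Cod C n = Dom C u" "m = u \<cdot> n"
proof -
  note d = triD[OF t]
  let ?W = "Dom C m"
  obtain Z where Z: "Z \<in> Obj C" "(Ident C ?W, zero_ar S ?W Z, zero_ar S Z (fob T ?W)) \<in> \<Delta>"
    using trivial_triangle[of ?W] m by auto
  have W: "?W \<in> Obj C" using m by simp
  obtain e where e: "e \<in> homs C (fob T ?W) (fob T (Dom C u))"
    "far T m \<cdot> neg_ar C S (far T (Ident C ?W)) = neg_ar C S (far T u) \<cdot> e"
    by (rule tri_fill[OF rotate[OF Z(2)] rotate[OF t], of m "zero_ar S Z (Cod C v)"]) (use d Z m W in simp_all)
  \<comment> \<open>The sign of the rotation occurs on both sides and is cancelled.\<close>
  have "far T m = far T u \<cdot> e"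
    by (rule neg_inject) (use d m e in \<open>simp_all add: cmp_neg\<close>)
  then have "far U (far T m) = far U (far T u \<cdot> e)" by simp
  also have "\<dots> = u \<cdot> far U e" using d m e by simp
  finally have "m = u \<cdot> far U e" using m by simp
  then show ?thesis by (rule that[rotated 3]) (use d m e in simp_all)
qed

end

lemma exact_comp:
  assumes "exact_functor C S \<Delta> D R \<Gamma> F t" "exact_functor D R \<Gamma> E Q \<Theta> G u"
    and "triangulated_category C S \<Delta>"
  shows "exact_functor C S \<Delta> E Q \<Theta> (G \<circ>\<^sub>F F) (sus_comp E G u F t)"
proof -
  interpret tri C S \<Delta> by unfold_locales fact
  interpret F: sftor C S D R F t by unfold_locales (use assms in \<open>simp add: exact_functor_def\<close>)
  interpret G: sftor D R E Q G u by unfold_locales (use assms in \<open>simp add: exact_functor_def\<close>)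
  show ?thesis
    unfolding exact_functor_def
  proof (intro conjI allI impI)
    fix p q w assume t: "(p, q, w) \<in> \<Delta>"
    then have "(far F p, far F q, t (Dom C p) \<cdot>\<^bsub>D\<^esub> far F w) \<in> \<Gamma>"
      using assms unfolding exact_functor_def by blast
    then have "(far G (far F p), far G (far F q), u (Dom D (far F p)) \<cdot>\<^bsub>E\<^esub> far G (t (Dom C p) \<cdot>\<^bsub>D\<^esub> far F w)) \<in> \<Theta>"
      using assms unfolding exact_functor_def by blast
    then show "(far (G \<circ>\<^sub>F F) p, far (G \<circ>\<^sub>F F) q, sus_comp E G u F t (Dom C p) \<cdot>\<^bsub>E\<^esub> far (G \<circ>\<^sub>F F) w) \<in> \<Theta>"
      using triD[OF t] by (simp add: sus_comp_def)
  qed (rule suspended_functor_comp[OF F.suspended_functor G.suspended_functor])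
qed

lemma exact_id:
  assumes "triangulated_category C S \<Delta>"
  shows "exact_functor C S \<Delta> C S \<Delta> id_fun (sus_id C S)"
proof -
  interpret tri C S \<Delta> by unfold_locales fact
  show ?thesis
    unfolding exact_functor_def using suspended_functor_id[OF suspended] by (auto simp: sus_id_def)
qed

text \<open>A triangle on \<open>G u\<close> maps to the image under \<open>G\<close> of a triangle on \<open>u\<close>, by adjunction;
  the five lemma, applied to \<open>Hom (W, -)\<close>, shows that this map is an isomorphism.\<close>

lemma exact_right_adjoint:
  fixes C :: "('o, 'm) cat" (structure)
  assumes "susp_adj C S D R F t G u \<eta> \<epsilon>" "exact_functor C S \<Delta> D R \<Gamma> F t"
    "triangulated_category C S \<Delta>" "triangulated_category D R \<Gamma>"
  shows "exact_functor D R \<Gamma> C S \<Delta> G u"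
proof -
  interpret susp_adj C S D R F t G u \<eta> \<epsilon> by fact
  interpret C: tri C S \<Delta> by unfold_locales fact
  interpret D: tri D R \<Gamma> by unfold_locales fact
  show ?thesis
    unfolding exact_functor_def
  proof (intro conjI allI impI G.suspended_functor)
    fix p q w assume t: "(p, q, w) \<in> \<Gamma>"
    note d = D.triD[OF t]
    let ?A = "Dom D p" and ?B = "Dom D q" and ?E = "Cod D q"
    have o: "?A \<in> Obj D" "?B \<in> Obj D" "?E \<in> Obj D" using d by simp_all
    let ?w = "u ?A \<cdot> far G w"
    \<comment> \<open>A triangle on \<open>G p\<close> exists, but nothing places its third vertex
      in the image of \<open>G\<close>. The aim is an isomorphism \<open>k\<close> from that vertex
      to \<open>G ?E\<close>.\<close>
    obtain q' w' where t': "(far G p, q', w') \<in> \<Delta>" using C.complete[of "far G p"] d by auto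
    note d' = C.triD[OF t']
    let ?E' = "Cod C q'"
    have d'' [simp]: "Dom C q' = fob G ?B" "Dom C w' = ?E'" "Cod C w' = fob (shift S) (fob G ?A)" "q' \<in> Arr C" "w' \<in> Arr C"
      "?E' \<in> Obj C" using d d' by simp_all
    have tF: "(far F (far G p), far F q', t (fob G ?A) \<cdot>\<^bsub>D\<^esub> far F w') \<in> \<Gamma>"
      using assms(2) t' d unfolding exact_functor_def by fastforce
    \<comment> \<open>Exactness of \<open>F\<close> makes the image of this triangle distinguished;
      the counits at the first two vertices map it to the given one, and \<open>k\<close> is the
      transpose of the filler \<open>e\<close>.\<close>
    obtain e where e: "e \<in> homs D (fob F ?E') ?E" "e \<cdot>\<^bsub>D\<^esub> far F q' = q \<cdot>\<^bsub>D\<^esub> \<epsilon> ?B"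
      "far (shift R) (\<epsilon> ?A) \<cdot>\<^bsub>D\<^esub> (t (fob G ?A) \<cdot>\<^bsub>D\<^esub> far F w') = w \<cdot>\<^bsub>D\<^esub> e"
      by (rule D.tri_fill[OF tF t, of "\<epsilon> ?A" "\<epsilon> ?B"]) (use d o in simp_all)
    define k where "k = far G e \<cdot> \<eta> ?E'"
    have k [simp]: "k \<in> Arr C" "Dom C k = ?E'" "Cod C k = fob G ?E" using e by (simp_all add: k_def)
    have ek: "\<epsilon> ?E \<cdot>\<^bsub>D\<^esub> far F k = e" unfolding k_def using e by (intro sharp_flat) simp_all
    have kq: "k \<cdot> q' = far G q"
    proof (rule sharp_inject[where B = ?E])
      have "\<epsilon> ?E \<cdot>\<^bsub>D\<^esub> (far F k \<cdot>\<^bsub>D\<^esub> far F q') = e \<cdot>\<^bsub>D\<^esub> far F q'"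
        using o by (intro F.D.chain1 ek) simp_all
      then show "\<epsilon> ?E \<cdot>\<^bsub>D\<^esub> far F (k \<cdot> q') = \<epsilon> ?E \<cdot>\<^bsub>D\<^esub> far F (far G q)"
        using d o e by simp
    qed (use d o in simp_all)
    have kw: "?w \<cdot> k = w'"
    proof (rule susp_inject[where B = ?A])
      have "far (shift R) (\<epsilon> ?A) \<cdot>\<^bsub>D\<^esub> (t (fob G ?A) \<cdot>\<^bsub>D\<^esub> far F (?w \<cdot> k))
        = \<epsilon> (fob (shift R) ?A) \<cdot>\<^bsub>D\<^esub> (far F (far G w) \<cdot>\<^bsub>D\<^esub> far F k)"
        using d o by (subst counit_susp) simp_all
      also have "\<dots> = w \<cdot>\<^bsub>D\<^esub> e"
        using d o ek by simp
      finally show "far (shift R) (\<epsilon> ?A) \<cdot>\<^bsub>D\<^esub> (t (fob G ?A) \<cdot>\<^bsub>D\<^esub> far F (?w \<cdot> k))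
        = far (shift R) (\<epsilon> ?A) \<cdot>\<^bsub>D\<^esub> (t (fob G ?A) \<cdot>\<^bsub>D\<^esub> far F w')"
        using e by simp
    qed (use d o in simp_all)
    \<comment> \<open>Exactness of \<open>Hom (W, G -)\<close> on a triangle of
      \<open>\<Gamma>\<close>: transpose, apply \<open>tri_exact\<close> in \<open>D\<close>, and
      transpose back.\<close>
    have factor: "\<exists>n. n \<in> Arr C \<and> Dom C n = Dom C m \<and> Cod C n = fob G (Dom D x) \<and> m = far G x \<cdot> n"
      if xyz: "(x, y, z) \<in> \<Gamma>" and m: "m \<in> Arr C" "Cod C m = fob G (Dom D y)"
        "far G y \<cdot> m = zero_ar S (Dom C m) (fob G (Cod D y))" for x y z m
    proof -
      note dx = D.triD[OF xyz]
      let ?s = "\<epsilon> (Dom D y) \<cdot>\<^bsub>D\<^esub> far F m"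
      have "y \<cdot>\<^bsub>D\<^esub> ?s = \<epsilon> (Cod D y) \<cdot>\<^bsub>D\<^esub> far F (far G y \<cdot> m)"
        using dx m(1,2) by simp
      also have "\<dots> = zero_ar R (fob F (Dom C m)) (Cod D y)"
        unfolding m(3) using dx m(1) by simp
      finally have s0: "y \<cdot>\<^bsub>D\<^esub> ?s = zero_ar R (Dom D ?s) (Cod D y)"
        using dx m(1,2) by simp
      have s: "?s \<in> Arr D" "Cod D ?s = Dom D y" using dx m(1,2) by simp_all
      obtain n where n: "n \<in> Arr D" "Dom D n = Dom D ?s" "Cod D n = Dom D x" "?s = x \<cdot>\<^bsub>D\<^esub> n"
        using D.tri_exact[OF xyz s s0] by blast
      have nd: "Dom D n = fob F (Dom C m)" using n(2) dx m(1,2) by simp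
      have nn: "\<epsilon> (Dom D x) \<cdot>\<^bsub>D\<^esub> far F (far G n \<cdot> \<eta> (Dom C m)) = n"
        using n(1,3) nd dx m(1,2) by (intro sharp_flat) simp_all
      have "m = far G x \<cdot> (far G n \<cdot> \<eta> (Dom C m))"
        by (rule sharp_inject[where B = "Dom D y"]) (use n(1,3,4) nd dx m(1,2) in simp_all)
      then show ?thesis
        using n(1,3) nd dx m(1,2) by (intro exI[of _ "far G n \<cdot> \<eta> (Dom C m)"]) simp_all
    qed
    have inj: "x = y" if x: "x \<in> Arr C" "y \<in> Arr C" "Dom C x = Dom C y" "Cod C x = ?E'" "Cod C y = ?E'"
      and kxy: "k \<cdot> x = k \<cdot> y" for x y
    proof -
      \<comment> \<open>The chase for the difference \<open>d\<close>: from \<open>k d = 0\<close>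
        follows \<open>w' d = 0\<close>, so \<open>d = q' m\<close>; then \<open>G q\<close> kills
        \<open>m\<close>, so \<open>m = G p n\<close>, and \<open>d\<close> contains the zero
        composite \<open>q' G p\<close>.\<close>
      let ?d = "add_ar S x (neg_ar C S y)" and ?W = "Dom C y"
      have dd: "?d \<in> Arr C" "Dom C ?d = ?W" "Cod C ?d = ?E'" using x by simp_all
      have kd: "k \<cdot> ?d = zero_ar S ?W (fob G ?E)"
        using x kxy by (simp add: F.S.add_right F.S.cmp_neg)
      have "w' \<cdot> ?d = ?w \<cdot> (k \<cdot> ?d)"
        unfolding kw[symmetric] using dd d o by simp
      also have "\<dots> = zero_ar S (Dom C ?d) (Cod C w')"
        unfolding kd dd(2) using d o x by simp
      finally have wd: "w' \<cdot> ?d = zero_ar S (Dom C ?d) (Cod C w')" .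
      have dw: "Cod C ?d = Dom C w'" using dd(3) by simp
      obtain m where m: "m \<in> Arr C" "Dom C m = Dom C ?d" "Cod C m = Dom C q'" "?d = q' \<cdot> m"
        using C.tri_exact[OF C.rotate[OF t'] dd(1) dw wd] by blast
      have md: "Dom C m = ?W" "Cod C m = fob G ?B" using m(2,3) dd(2) by simp_all
      have "far G q \<cdot> m = k \<cdot> ?d"
        unfolding m(4) kq[symmetric] using m(1) md by simp
      then have qm: "far G q \<cdot> m = zero_ar S (Dom C m) (fob G ?E)"
        unfolding kd md .
      obtain n where n: "n \<in> Arr C" "Dom C n = Dom C m" "Cod C n = fob G ?A" "m = far G p \<cdot> n"
        using factor[OF t m(1) md(2) qm] by blast
      have nd: "Dom C n = ?W" using n(2) md by simp
      have "?d = (q' \<cdot> far G p) \<cdot> n"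
        unfolding m(4) n(4) using n(1,3) nd d o by simp
      also have "\<dots> = zero_ar S ?W ?E'"
        unfolding C.tri_zero[OF t'] using n(1,3) nd d o by simp
      finally show ?thesis using F.S.sub_add[of x y] x by simp
    qed
    \<comment> \<open>The surjective half of the five lemma, needed only at the identity of
      \<open>G ?E\<close>: it yields a right inverse of \<open>k\<close>.\<close>
    have "\<exists>x. x \<in> Arr C \<and> Dom C x = fob G ?E \<and> Cod C x = ?E' \<and> k \<cdot> x = Ident C (fob G ?E)"
    proof -
      let ?y = "Ident C (fob G ?E)"
      have "neg_ar D R (far (shift R) p) \<cdot>\<^bsub>D\<^esub> w = zero_ar R ?E (fob (shift R) ?B)"
        using D.tri_zero[OF D.rotate[OF D.rotate[OF t]]] d by simp
      then have np: "neg_ar D R (far (shift R) p \<cdot>\<^bsub>D\<^esub> w) = zero_ar R ?E (fob (shift R) ?B)"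
        using d by (simp add: F.R.cmp_neg)
      have "far (shift R) p \<cdot>\<^bsub>D\<^esub> w = zero_ar R ?E (fob (shift R) ?B)"
        by (rule F.R.neg_inject) (use d o np in simp_all)
      then have pw: "far G (far (shift R) p \<cdot>\<^bsub>D\<^esub> w) = zero_ar S (fob G ?E) (fob G (fob (shift R) ?B))"
        using o by simp
      have "far (shift S) (far G p) \<cdot> ?w = u ?B \<cdot> (far G (far (shift R) p) \<cdot> far G w)"
        using d o G.t_nat[of p] by (intro F.C.chain) simp_all
      also have "\<dots> = zero_ar S (fob G ?E) (fob (shift S) (fob G ?B))"
        using d o pw by simp
      finally have pz: "neg_ar C S (far (shift S) (far G p)) \<cdot> ?w
          = zero_ar S (Dom C ?w) (Cod C (neg_ar C S (far (shift S) (far G p))))"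
        using d o by (simp add: F.S.cmp_neg)
      have ww: "?w \<in> Arr C" "Cod C ?w = Dom C (neg_ar C S (far (shift S) (far G p)))"
        using d o by simp_all
      \<comment> \<open>The next arrow of the rotated triangle on \<open>G p\<close> kills
        \<open>?w\<close>, so \<open>?w\<close> factors through \<open>w'\<close>. This
        \<open>x\<close> is a first approximation to the right inverse.\<close>
      obtain x where x: "x \<in> Arr C" "Dom C x = Dom C ?w" "Cod C x = Dom C w'" "?w = w' \<cdot> x"
        using C.tri_exact[OF C.rotate[OF C.rotate[OF t']] ww pz] by blast
      have xd [simp]: "x \<in> Arr C" "Dom C x = fob G ?E" "Cod C x = ?E'" using x(1-3) d o by simp_all
      \<comment> \<open>The error \<open>d\<close> of this approximation is killed by
        \<open>G w\<close>, hence factors through \<open>G q\<close>, which equals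
        \<open>k q'\<close>; adding \<open>q' n\<close> to \<open>x\<close> corrects it.\<close>
      let ?d = "add_ar S ?y (neg_ar C S (k \<cdot> x))"
      have dd: "?d \<in> Arr C" "Dom C ?d = fob G ?E" "Cod C ?d = fob G ?E" using o by simp_all
      have "?w \<cdot> (k \<cdot> x) = w' \<cdot> x"
        unfolding kw[symmetric] using d o by simp
      also note x(4)[symmetric]
      finally have "?w \<cdot> ?d = zero_ar S (fob G ?E) (fob (shift S) (fob G ?A))"
        using d o by (subst F.S.add_right) (simp_all add: F.S.cmp_neg del: F.C.assoc)
      then have "inv_arrow C (u ?A) \<cdot> (u ?A \<cdot> (far G w \<cdot> ?d))
        = inv_arrow C (u ?A) \<cdot> zero_ar S (fob G ?E) (fob (shift S) (fob G ?A))"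
        using d o dd by simp
      then have wd: "far G w \<cdot> ?d = zero_ar S (Dom C ?d) (fob G (Cod D w))"
        using d o dd by simp
      have dw: "Cod C ?d = fob G (Dom D w)" using dd(3) d by simp
      obtain n where n: "n \<in> Arr C" "Dom C n = Dom C ?d" "Cod C n = fob G (Dom D q)" "?d = far G q \<cdot> n"
        using factor[OF D.rotate[OF t] dd(1) dw wd] by blast
      have nd [simp]: "n \<in> Arr C" "Dom C n = fob G ?E" "Cod C n = fob G ?B" using n(1-3) dd(2) by simp_all
      have "?y = add_ar S ?d (k \<cdot> x)"
        using o by (intro F.S.sub_add[symmetric]) simp_all
      also have "?d = k \<cdot> (q' \<cdot> n)"
        unfolding n(4) kq[symmetric] by simp
      also have "add_ar S (k \<cdot> (q' \<cdot> n)) (k \<cdot> x) = k \<cdot> add_ar S (q' \<cdot> n) x"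
        by (intro F.S.add_right[symmetric]) simp_all
      finally show ?thesis
        by (intro exI[of _ "add_ar S (q' \<cdot> n) x"]) simp_all
    qed
    then obtain x where x: "x \<in> Arr C" "Dom C x = fob G ?E" "Cod C x = ?E'" "k \<cdot> x = Ident C (fob G ?E)"
      by blast
    have "k \<cdot> (x \<cdot> k) = Ident C (fob G ?E) \<cdot> k"
      using x by (intro F.C.chain1) simp_all
    \<comment> \<open>Injectivity of composition with \<open>k\<close> turns the right inverse into
      a two-sided one.\<close>
    then have kxk: "k \<cdot> (x \<cdot> k) = k \<cdot> Ident C ?E'" by simp
    have "x \<cdot> k = Ident C ?E'"
      by (rule inj[OF _ _ _ _ _ kxk]) (use x in simp_all)
    then have iso: "iso_arrow C k" using x by (intro F.C.iso_arrowI[where g = x]) simp_all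
    show "(far G p, far G q, ?w) \<in> \<Delta>"
      by (rule C.tri_iso[OF t', of _ _ _ "Ident C (fob G ?A)" "Ident C (fob G ?B)" k])
        (use d o kq kw iso in \<open>auto simp: F.C.iso_Ident intro!: C.triangleI\<close>)
  qed
qed

section \<open>Push-forwards\<close>

text \<open>The description defining \<open>b_ar\<close> is known to determine an arrow only at
  objects of the category, so it is compared with \<open>conj_ar\<close> there.\<close>

lemma nat_trans_cong:
  assumes "nat_trans C D F G \<tau>" "\<And>A. A \<in> Obj C \<Longrightarrow> \<sigma> A = \<tau> A"
  shows "nat_trans C D F G \<sigma>"
proof -
  interpret ftor C D F by (rule ftor_of[OF nat_transD(1)[OF assms(1)]])
  show ?thesis
    by (rule nat_transI) (use nat_transD[OF assms(1)] assms(2) in simp_all)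
qed

lemma base'_simps [simp]:
  "Dom (base' P) = Dom (base P)" "Cod (base' P) = Cod (base P)" "g \<cdot>\<^bsub>base' P\<^esub> f = g \<cdot>\<^bsub>base P\<^esub> f"
  by (simp_all add: base'_def)

lemma base'_Arr [simp]: "f \<in> Arr (base' P) \<Longrightarrow> f \<in> Arr (base P)"
  by (simp add: base'_def)

locale pushforward =
  fixes P :: "('x, 'b, 'o, 'm) pseudo" and J :: "('b, 'o, 'm) adjoints"
  assumes pseudo: "pseudo_functor P" and monoidal: "monoidal_pseudo P" and adjoints: "adjoint_choice P J"
begin

lemma base: "cat (base P)"
  using pseudo by (simp add: pseudo_functor_def cat_def)

lemma fib_smc: "X \<in> Obj (base P) \<Longrightarrow> smclosed (fib P X) (fmon P X)"
  using pseudo by (simp add: pseudo_functor_def smclosed_def)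

lemma base'_Obj:
  assumes "f \<in> homs (base' P) X Y"
  shows "f \<in> homs (base P) X Y" "X \<in> Obj (base P)" "Y \<in> Obj (base P)"
proof -
  interpret cat "base P" by (rule base)
  show "f \<in> homs (base P) X Y" "X \<in> Obj (base P)" "Y \<in> Obj (base P)" using assms by auto
qed

lemma pull_push:
  assumes "f \<in> homs (base' P) X Y"
  shows "adjunction (fib P Y) (fib P X) (pull P f) (push J f) (eta_ps J f) (eps_ps J f)"
  using adjoints assms unfolding adjoint_choice_def by blast

lemma push_shriek:
  assumes "f \<in> homs (base' P) X Y"
  shows "adjunction (fib P X) (fib P Y) (push J f) (shriek J f) (eta_sh J f) (eps_sh J f)"
  using adjoints assms unfolding adjoint_choice_def by blast

lemma pcomp_iso:
  assumes "f \<in> homs (base P) X Y" "g \<in> homs (base P) Y Z"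
  shows "nat_iso (fib P Z) (fib P X) (pull P f \<circ>\<^sub>F pull P g) (pull P (g \<cdot>\<^bsub>base P\<^esub> f)) (pcomp P g f)"
  using pseudo assms unfolding pseudo_functor_def by blast

text \<open>The witnesses are the composite adjoints \<open>g_* f_*\<close> and
  \<open>f^! g^!\<close>; once membership is known, \<open>adjoint_choice\<close> supplies the
  chosen adjoints of \<open>gf\<close>.\<close>

lemma base'_cmp:
  assumes f: "f \<in> homs (base' P) X Y" and g: "g \<in> homs (base' P) Y Z"
  shows "g \<cdot>\<^bsub>base P\<^esub> f \<in> homs (base' P) X Z"
proof -
  interpret cat "base P" by (rule base)
  have gf: "g \<cdot>\<^bsub>base P\<^esub> f \<in> homs (base P) X Z"
    using f g by simp
  note 1 = adjunction_iso[OF adjunction_comp[OF pull_push[OF g] pull_push[OF f]]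
      pcomp_iso[OF base'_Obj(1)[OF f] base'_Obj(1)[OF g]]]
  note 2 = adjunction_comp[OF push_shriek[OF f] push_shriek[OF g]]
  show ?thesis
    using gf 1 2 unfolding base'_def by auto
qed

lemma monoidal_adj:
  assumes f: "f \<in> homs (base' P) X Y"
  shows "monoidal_adj (fib P Y) (fmon P Y) (fib P X) (fmon P X) (pull P f) (push J f)
    (eta_ps J f) (eps_ps J f) (pten P f)"
proof -
  have "symmetric_monoidal_functor (fib P Y) (fmon P Y) (fib P X) (fmon P X) (pull P f) (pten P f) (punit P f)"
    using monoidal base'_Obj(1)[OF f] unfolding monoidal_pseudo_def by blast
  then show ?thesis
    unfolding symmetric_monoidal_functor_def
    by (intro monoidal_adj.intro monoidal_adj_axioms.intro fib_smc base'_Obj[OF f] adj_of[OF pull_push[OF f]])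
      blast+
qed

lemma lambda_lam:
  assumes f: "f \<in> homs (base' P) X Y"
  shows "monoidal_adj.lam (fib P Y) (fmon P Y) (fib P X) (fmon P X) (push J f)
    (eta_ps J f) (eps_ps J f) (pten P f) = lambda_ar P J f"
proof -
  interpret monoidal_adj "fib P Y" "fmon P Y" "fib P X" "fmon P X" "pull P f" "push J f"
    "eta_ps J f" "eps_ps J f" "pten P f" by (rule monoidal_adj[OF f])
  show ?thesis using f by (intro ext) (simp add: lam_def lambda_ar_def)
qed

lemma lax_push:
  assumes f: "f \<in> homs (base' P) X Y"
  shows "lax (fib P X) (fmon P X) (fib P Y) (fmon P Y) (push J f) (lambda_ar P J f)"
  using monoidal_adj.lax_lam[OF monoidal_adj[OF f]] by (simp add: lambda_lam[OF f])

text \<open>Recognizes \<open>\<zeta>\<close> as the arrow that the general construction attaches to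
  \<open>e = \<epsilon>^!\<close>, which reduces its long definition to one equation for the
  transpose.\<close>

lemma lax_dual_push:
  assumes f: "f \<in> homs (base' P) X Y" and K: "K \<in> Obj (fib P Y)"
  shows "lax_dual (fib P X) (fmon P X) (fib P Y) (fmon P Y) (push J f) (lambda_ar P J f)
    (fob (shriek J f) K) K (eps_sh J f K) (zeta_ar P J f K)"
proof -
  interpret lax "fib P X" "fmon P X" "fib P Y" "fmon P Y" "push J f" "lambda_ar P J f"
    by (rule lax_push[OF f])
  interpret sh: adj "fib P X" "fib P Y" "push J f" "shriek J f" "eta_sh J f" "eps_sh J f"
    by (rule adj_of[OF push_shriek[OF f]])
  have d [simp]: "Dom (base P) f = X" "Cod (base P) f = Y" using f by simp_all
  show ?thesis
  proof (intro lax_dual.intro lax_axioms lax_dual_axioms.intro)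
    fix A assume A: "A \<in> Obj (fib P X)"
    let ?L = "fob (shriek J f) K" and ?pA = "fob (push J f) A"
    let ?D = "hob (fmon P X) A ?L"
    \<comment> \<open>In \<open>mu_ar\<close> the unit \<open>coev\<close> and
      \<open>\<lambda>\<close> together form a curried arrow; the other two factors only postcompose
      and come out of the transpose unchanged.\<close>
    have z: "zeta_ar P J f K A = har (fmon P Y) (Ident (fib P Y) ?pA) (eps_sh J f K) \<cdot>\<^bsub>fib P Y\<^esub>
      (har (fmon P Y) (Ident (fib P Y) ?pA) (far (push J f) (ev (fmon P X) A ?L)) \<cdot>\<^bsub>fib P Y\<^esub>
       curry_ar (fib P Y) (fmon P Y) (fob (push J f) ?D) ?pA (lambda_ar P J f ?D A))"
      by (simp add: zeta_ar_def mu_ar_def Let_def curry_ar_def)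
    show "zeta_ar P J f K A \<in> Arr (fib P Y)" "Dom (fib P Y) (zeta_ar P J f K A) = fob (push J f) ?D"
      "Cod (fib P Y) (zeta_ar P J f K A) = hob (fmon P Y) ?pA K"
      unfolding z using A K by simp_all
    have u: "D.uncurry ?pA (fob (push J f) (?D \<odot>\<^bsub>fmon P X\<^esub> A))
      (curry_ar (fib P Y) (fmon P Y) (fob (push J f) ?D) ?pA (lambda_ar P J f ?D A)) = lambda_ar P J f ?D A"
      using A K by (intro D.uncurry_curry) simp_all
    have u': "D.uncurry ?pA (fob (push J f) ?L)
      (har (fmon P Y) (Ident (fib P Y) ?pA) (far (push J f) (ev (fmon P X) A ?L)) \<cdot>\<^bsub>fib P Y\<^esub>
       curry_ar (fib P Y) (fmon P Y) (fob (push J f) ?D) ?pA (lambda_ar P J f ?D A))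
      = far (push J f) (ev (fmon P X) A ?L) \<cdot>\<^bsub>fib P Y\<^esub> lambda_ar P J f ?D A"
      using A K by (subst D.uncurry_har[where X = ?pA and K = "fob (push J f) (?D \<odot>\<^bsub>fmon P X\<^esub> A)"]) (simp_all add: u)
    show "D.uncurry ?pA K (zeta_ar P J f K A)
      = eps_sh J f K \<cdot>\<^bsub>fib P Y\<^esub> (far (push J f) (ev (fmon P X) A ?L) \<cdot>\<^bsub>fib P Y\<^esub> lambda_ar P J f ?D A)"
      unfolding z using A K
      by (subst D.uncurry_har[where X = ?pA and K = "fob (push J f) ?L"]) (simp_all add: u')
  qed (use K in simp_all)
qed

end

section \<open>The conjugates \<open>b\<close> and \<open>c\<close> for a composable pair\<close>

locale pushforward_pair = pushforward P J
  for P :: "('x, 'b, 'o, 'm) pseudo" and J :: "('b, 'o, 'm) adjoints" +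
  fixes X Y Z :: 'x and f g :: 'b
  assumes f: "f \<in> homs (base' P) X Y" and g: "g \<in> homs (base' P) Y Z"
begin

abbreviation "gf \<equiv> g \<cdot>\<^bsub>base P\<^esub> f"

lemma gf: "gf \<in> homs (base' P) X Z"
  by (rule base'_cmp[OF f g])

lemma src_tgt [simp]: "Dom (base P) f = X" "Cod (base P) f = Y" "Dom (base P) g = Y" "Cod (base P) g = Z"
  using f g by simp_all

abbreviation "eta_comp \<equiv> (\<lambda>A. far (push J g) (eta_ps J f (fob (pull P g) A)) \<cdot>\<^bsub>fib P Z\<^esub> eta_ps J g A)"
abbreviation "eps_comp \<equiv> (\<lambda>B. eps_ps J f B \<cdot>\<^bsub>fib P X\<^esub> far (pull P f) (eps_ps J g (fob (push J f) B)))"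
abbreviation "pten_comp \<equiv> (\<lambda>(A, B). far (pull P f) (pten P g (A, B)) \<cdot>\<^bsub>fib P X\<^esub>
  pten P f (fob (pull P g) A, fob (pull P g) B))"

text \<open>The composite constraint \<open>pten_comp\<close> is chosen so that monoidality of
  \<open>a\<close> becomes literally the condition \<open>a_tens\<close>.\<close>

lemma b_conjugate:
  "monoidal_conjugate (fib P Z) (fmon P Z) (fib P X) (fmon P X)
    (pull P f \<circ>\<^sub>F pull P g) (push J g \<circ>\<^sub>F push J f) eta_comp eps_comp pten_comp
    (pull P gf) (push J gf) (eta_ps J gf) (eps_ps J gf) (pten P gf) (pcomp P g f)"
proof -
  note m = monoidal_adj_comp[OF monoidal_adj[OF g] monoidal_adj[OF f]]
  note b = base'_Obj(1)[OF f] base'_Obj(1)[OF g]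
  interpret A: monoidal_adj "fib P Z" "fmon P Z" "fib P X" "fmon P X" "pull P f \<circ>\<^sub>F pull P g"
    "push J g \<circ>\<^sub>F push J f" eta_comp eps_comp pten_comp by (rule m)
  interpret A': monoidal_adj "fib P Z" "fmon P Z" "fib P X" "fmon P X" "pull P gf"
    "push J gf" "eta_ps J gf" "eps_ps J gf" "pten P gf" by (rule monoidal_adj[OF gf])
  interpret f: monoidal_adj "fib P Y" "fmon P Y" "fib P X" "fmon P X" "pull P f" "push J f"
    "eta_ps J f" "eps_ps J f" "pten P f" by (rule monoidal_adj[OF f])
  interpret g: monoidal_adj "fib P Z" "fmon P Z" "fib P Y" "fmon P Y" "pull P g" "push J g"
    "eta_ps J g" "eps_ps J g" "pten P g" by (rule monoidal_adj[OF g])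
  have "pcomp P g f (A \<odot>\<^bsub>fmon P Z\<^esub> B) \<cdot>\<^bsub>fib P X\<^esub> far (pull P f) (pten P g (A, B))
             \<cdot>\<^bsub>fib P X\<^esub> pten P f (fob (pull P g) A, fob (pull P g) B)
           = pten P gf (A, B) \<cdot>\<^bsub>fib P X\<^esub> (pcomp P g f A \<star>\<^bsub>fmon P X\<^esub> pcomp P g f B)"
    if "A \<in> Obj (fib P Z)" "B \<in> Obj (fib P Z)" for A B
    using monoidal b that unfolding monoidal_pseudo_def by blast
  then show ?thesis
    by (intro monoidal_conjugate.intro monoidal_conjugate_axioms.intro m monoidal_adj[OF gf]
        conjugate.intro conjugate_axioms.intro pcomp_iso[OF b] A.adj_axioms A'.adj_axioms) simp_all
qed

sublocale b: monoidal_conjugate "fib P Z" "fmon P Z" "fib P X" "fmon P X"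
    "pull P f \<circ>\<^sub>F pull P g" "push J g \<circ>\<^sub>F push J f" eta_comp eps_comp pten_comp
    "pull P gf" "push J gf" "eta_ps J gf" "eps_ps J gf" "pten P gf" "pcomp P g f"
  by (rule b_conjugate)

sublocale f: monoidal_adj "fib P Y" "fmon P Y" "fib P X" "fmon P X" "pull P f" "push J f"
    "eta_ps J f" "eps_ps J f" "pten P f" by (rule monoidal_adj[OF f])

sublocale g: monoidal_adj "fib P Z" "fmon P Z" "fib P Y" "fmon P Y" "pull P g" "push J g"
    "eta_ps J g" "eps_ps J g" "pten P g" by (rule monoidal_adj[OF g])

text \<open>By \<open>conj_cmp\<close> the conjugate induces the prescribed map on Hom sets, and by
  the Yoneda argument no other arrow does.\<close>

lemma b_ar_conj:
  assumes B: "B \<in> Obj (fib P X)"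
  shows "b_ar P J g f B = b.conj_ar B"
proof -
  have 1: "b.conj_ar B \<cdot>\<^bsub>fib P Z\<^esub> h = b_induced P J g f A B h"
    if h: "h \<in> homs (fib P Z) A (fob (push J gf) B)" for A h
  proof -
    have "A \<in> Obj (fib P Z)" using h by auto
    then show ?thesis
      using b.conj_cmp[of B h] B h by (simp add: b_induced_def Let_def)
  qed
  show ?thesis
    unfolding b_ar_def Let_def src_tgt
  proof (rule the_equality)
    fix u assume u: "u \<in> homs (fib P Z) (fob (push J gf) B) (fob (push J g) (fob (push J f) B)) \<and>
      (\<forall>A h. h \<in> homs (fib P Z) A (fob (push J gf) B) \<longrightarrow> u \<cdot>\<^bsub>fib P Z\<^esub> h = b_induced P J g f A B h)"
    \<comment> \<open>Uniqueness: two arrows inducing the same map agree on the identity.\<close>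
    let ?i = "Ident (fib P Z) (fob (push J gf) B)"
    have i: "?i \<in> homs (fib P Z) (fob (push J gf) B) (fob (push J gf) B)" using B by simp
    have "u \<cdot>\<^bsub>fib P Z\<^esub> ?i = b.conj_ar B \<cdot>\<^bsub>fib P Z\<^esub> ?i" unfolding 1[OF i] using u i by blast
    then show "u = b.conj_ar B" using conjunct1[OF u] B by simp
  qed (use B 1 in simp_all)
qed

lemma b_nat_iso: "nat_iso (fib P X) (fib P Z) (push J gf) (push J g \<circ>\<^sub>F push J f) (b_ar P J g f)"
  using b.conj_nat_iso nat_trans_cong[of "fib P X" "fib P Z" "push J gf" "push J g \<circ>\<^sub>F push J f" b.conj_ar]
  by (auto simp: nat_iso_def b_ar_conj)

text \<open>Here \<open>b\<close> is the isomorphism of left adjoints, from \<open>(gf)_*\<close> to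
  \<open>g_* f_*\<close>, so the conjugate of right adjoints runs from \<open>f^! g^!\<close> to
  \<open>(gf)^!\<close>.\<close>

lemma c_conjugate:
  "conjugate (fib P X) (fib P Z) (push J gf) (shriek J gf) (eta_sh J gf) (eps_sh J gf)
    (push J g \<circ>\<^sub>F push J f) (shriek J f \<circ>\<^sub>F shriek J g)
    (\<lambda>A. far (shriek J f) (eta_sh J g (fob (push J f) A)) \<cdot>\<^bsub>fib P X\<^esub> eta_sh J f A)
    (\<lambda>B. eps_sh J g B \<cdot>\<^bsub>fib P Z\<^esub> far (push J g) (eps_sh J f (fob (shriek J g) B)))
    (b_ar P J g f)"
  by (intro conjugate.intro conjugate_axioms.intro b_nat_iso adj_of[OF push_shriek[OF gf]]
      adj_of[OF adjunction_comp[OF push_shriek[OF f] push_shriek[OF g]]])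

sublocale c: conjugate "fib P X" "fib P Z" "push J gf" "shriek J gf" "eta_sh J gf" "eps_sh J gf"
    "push J g \<circ>\<^sub>F push J f" "shriek J f \<circ>\<^sub>F shriek J g"
    "\<lambda>A. far (shriek J f) (eta_sh J g (fob (push J f) A)) \<cdot>\<^bsub>fib P X\<^esub> eta_sh J f A"
    "\<lambda>B. eps_sh J g B \<cdot>\<^bsub>fib P Z\<^esub> far (push J g) (eps_sh J f (fob (shriek J g) B))"
    "b_ar P J g f"
  by (rule c_conjugate)

lemma c_ar_conj:
  assumes B: "B \<in> Obj (fib P Z)"
  shows "c_ar P J g f B = c.conj_ar B"
proof -
  interpret fs: adj "fib P X" "fib P Y" "push J f" "shriek J f" "eta_sh J f" "eps_sh J f"
    by (rule adj_of[OF push_shriek[OF f]])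
  interpret gs: adj "fib P Y" "fib P Z" "push J g" "shriek J g" "eta_sh J g" "eps_sh J g"
    by (rule adj_of[OF push_shriek[OF g]])
  let ?L = "fob (shriek J f) (fob (shriek J g) B)"
  have 1: "c.conj_ar B \<cdot>\<^bsub>fib P X\<^esub> h = c_induced P J g f A B h"
    if h: "h \<in> homs (fib P X) A ?L" for A h
  proof -
    have "A \<in> Obj (fib P X)" using h by auto
    then show ?thesis
      using c.conj_cmp[of B h] B h by (simp add: c_induced_def Let_def)
  qed
  show ?thesis
    unfolding c_ar_def Let_def src_tgt
  proof (rule the_equality)
    fix u assume u: "u \<in> homs (fib P X) ?L (fob (shriek J gf) B) \<and>
      (\<forall>A h. h \<in> homs (fib P X) A ?L \<longrightarrow> u \<cdot>\<^bsub>fib P X\<^esub> h = c_induced P J g f A B h)"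
    let ?i = "Ident (fib P X) ?L"
    have i: "?i \<in> homs (fib P X) ?L ?L" using B by simp
    have "u \<cdot>\<^bsub>fib P X\<^esub> ?i = c.conj_ar B \<cdot>\<^bsub>fib P X\<^esub> ?i" unfolding 1[OF i] using u i by blast
    then show "u = c.conj_ar B" using conjunct1[OF u] B by simp
  qed (use B 1 in simp_all)
qed

end

section \<open>The two duality preserving functors and their comparison\<close>

locale pushforward_dual = pushforward_pair P J X Y Z f g
  for P :: "('x, 'b, 'o, 'm) pseudo" and J :: "('b, 'o, 'm) adjoints" and X Y Z f g +
  fixes K :: 'o
  assumes K: "K \<in> Obj (fib P Z)"
begin

abbreviation "L \<equiv> fob (shriek J f) (fob (shriek J g) K)"

text \<open>The factor \<open>far (push J gf) (Ident ..)\<close> is the trace of the lax structure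
  of the identity functor under \<open>I_c\<close>; it is kept so that the composition lemmas apply
  as they stand.\<close>

abbreviation "lam_gf \<equiv> (\<lambda>A B. far (push J gf) (Ident (fib P X) (A \<odot>\<^bsub>fmon P X\<^esub> B)) \<cdot>\<^bsub>fib P Z\<^esub> lambda_ar P J gf A B)"
abbreviation "lam_g_f \<equiv> (\<lambda>A B. far (push J g) (lambda_ar P J f A B) \<cdot>\<^bsub>fib P Z\<^esub> lambda_ar P J g (fob (push J f) A) (fob (push J f) B))"
abbreviation "phi_gf \<equiv> (\<lambda>A. zeta_ar P J gf K A \<cdot>\<^bsub>fib P Z\<^esub>
      far (push J gf) (har (fmon P X) (Ident (fib P X) A) (c_ar P J g f K)))"
abbreviation "phi_g_f \<equiv> (\<lambda>A. zeta_ar P J g K (fob (push J f) A) \<cdot>\<^bsub>fib P Z\<^esub> far (push J g) (zeta_ar P J f (fob (shriek J g) K) A))"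
abbreviation "e_gf \<equiv> eps_sh J gf K \<cdot>\<^bsub>fib P Z\<^esub> far (push J gf) (c_ar P J g f K)"
abbreviation "e_g_f \<equiv> eps_sh J g K \<cdot>\<^bsub>fib P Z\<^esub> far (push J g) (eps_sh J f (fob (shriek J g) K))"

lemma c_homs: "c_ar P J g f K \<in> homs (fib P X) L (fob (shriek J gf) K)"
  using K by (simp add: c_ar_conj)

lemma shriek_K: "fob (shriek J g) K \<in> Obj (fib P Y)"
proof -
  interpret gs: adj "fib P Y" "fib P Z" "push J g" "shriek J g" "eta_sh J g" "eps_sh J g"
    by (rule adj_of[OF push_shriek[OF g]])
  show ?thesis using K by simp
qed

lemma lax_dual_gf:
  "lax_dual (fib P X) (fmon P X) (fib P Z) (fmon P Z) (push J gf)
    lam_gf L K e_gf phi_gf"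
  using lax_dual_comp[OF lax_dual_change[OF smclosed.smc[OF fib_smc[OF base'_Obj(2)[OF f]]] c_homs] lax_dual_push[OF gf K]] by simp

lemma lax_dual_g_f:
  "lax_dual (fib P X) (fmon P X) (fib P Z) (fmon P Z) (push J g \<circ>\<^sub>F push J f)
    lam_g_f L K e_g_f phi_g_f"
  by (rule lax_dual_comp[OF lax_dual_push[OF f shriek_K] lax_dual_push[OF g K]])

text \<open>Compatibility with tensor products is \<open>conj_tens\<close> for \<open>b\<close>,
  read through \<open>lam_comp\<close>; compatibility with the arrows into \<open>K\<close> is
  \<open>counit_conj\<close> for \<open>c\<close>.\<close>

lemma b_transformation:
  "lax_transformation (fib P X) (fmon P X) (fib P Z) (fmon P Z) (push J gf)
    lam_gf (push J g \<circ>\<^sub>F push J f) lam_g_f L K e_gf phi_gf e_g_f phi_g_f (b_ar P J g f)"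
proof (intro lax_transformation.intro lax_transformation_axioms.intro lax_dual_gf lax_dual_g_f)
  show "nat_trans (fib P X) (fib P Z) (push J gf) (push J g \<circ>\<^sub>F push J f) (b_ar P J g f)"
    using b_nat_iso by (simp add: nat_iso_def)
next
  fix A B assume A: "A \<in> Obj (fib P X)" and B: "B \<in> Obj (fib P X)"
  have "b.A.lam A B = far (push J g) (lambda_ar P J f A B) \<cdot>\<^bsub>fib P Z\<^esub>
      lambda_ar P J g (fob (push J f) A) (fob (push J f) B)"
    using lam_comp[OF monoidal_adj[OF g] monoidal_adj[OF f] A B] unfolding lambda_lam[OF f] lambda_lam[OF g] .
  moreover have "b.A'.lam A B = lambda_ar P J gf A B"
    by (simp add: lambda_lam[OF gf])
  moreover have "lambda_ar P J gf A B \<in> Arr (fib P Z)"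
    "Cod (fib P Z) (lambda_ar P J gf A B) = fob (push J gf) (A \<odot>\<^bsub>fmon P X\<^esub> B)"
    using A B b.A'.lam_simps[of A B] by (simp_all add: lambda_lam[OF gf])
  ultimately show "(far (push J g) (lambda_ar P J f A B) \<cdot>\<^bsub>fib P Z\<^esub>
      lambda_ar P J g (fob (push J f) A) (fob (push J f) B)) \<cdot>\<^bsub>fib P Z\<^esub>
      (b_ar P J g f A \<star>\<^bsub>fmon P Z\<^esub> b_ar P J g f B) =
    b_ar P J g f (A \<odot>\<^bsub>fmon P X\<^esub> B) \<cdot>\<^bsub>fib P Z\<^esub>
      (far (push J gf) (Ident (fib P X) (A \<odot>\<^bsub>fmon P X\<^esub> B)) \<cdot>\<^bsub>fib P Z\<^esub> lambda_ar P J gf A B)"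
    using b.conj_tens[OF A B] A B by (simp add: b_ar_conj)
next
  show "eps_sh J gf K \<cdot>\<^bsub>fib P Z\<^esub> far (push J gf) (c_ar P J g f K) =
    e_g_f \<cdot>\<^bsub>fib P Z\<^esub> b_ar P J g f L"
    using c.counit_conj[OF K] K by (simp add: c_ar_conj)
qed

end

section \<open>Suspended push-forwards\<close>

context pushforward
begin

context
  fixes Q :: "('x, 'b, 'o, 'm) suspensions"
  assumes susp_pseudo: "suspended_pseudo P Q" and susp_adjoints: "suspended_adjoints P J Q"
begin

lemma susp_fib: "X \<in> Obj (base P) \<Longrightarrow> susp_smc (fib P X) (fmon P X) (sfib Q X) (sten_l Q X) (sten_r Q X)"
  using susp_pseudo by (simp add: suspended_pseudo_def susp_smc_def)

lemma susp_pull: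
  "h \<in> homs (base P) X Y \<Longrightarrow> sftor (fib P Y) (sfib Q Y) (fib P X) (sfib Q X) (pull P h) (spull Q h)"
  unfolding sftor_def using susp_pseudo unfolding suspended_pseudo_def by blast

lemma susp_pull_push:
  assumes h: "h \<in> homs (base' P) X Y"
  shows "susp_adj (fib P Y) (sfib Q Y) (fib P X) (sfib Q X) (pull P h) (spull Q h)
    (push J h) (spush Q h) (eta_ps J h) (eps_ps J h)"
proof -
  have e: "suspended_transformation (fib P X) (sfib Q X) (fib P X) (sfib Q X)
      (pull P h \<circ>\<^sub>F push J h) (sus_comp (fib P X) (pull P h) (spull Q h) (push J h) (spush Q h))
      id_fun (sus_id (fib P X) (sfib Q X)) (eps_ps J h)"
    and s: "sftor (fib P X) (sfib Q X) (fib P Y) (sfib Q Y) (push J h) (spush Q h)"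
    using susp_adjoints h unfolding suspended_adjoints_def Let_def sftor_def by blast+
  interpret adj "fib P Y" "fib P X" "pull P h" "push J h" "eta_ps J h" "eps_ps J h"
    by (rule adj_of[OF pull_push[OF h]])
  interpret G: sftor "fib P X" "sfib Q X" "fib P Y" "sfib Q Y" "push J h" "spush Q h" by (rule s)
  show ?thesis
    using e unfolding suspended_transformation_def
    by (intro susp_adj.intro susp_adj_axioms.intro adj_axioms s susp_pull base'_Obj[OF h])
      (auto simp: sus_comp_def sus_id_def)
qed

lemma slax_push:
  assumes h: "h \<in> homs (base' P) X Y"
  shows "slax (fib P X) (fmon P X) (fib P Y) (fmon P Y) (push J h) (lambda_ar P J h)
    (sfib Q X) (sten_l Q X) (sten_r Q X) (sfib Q Y) (sten_l Q Y) (sten_r Q Y) (spush Q h)"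
proof -
  note hb = base'_Obj[OF h]
  have "spull Q h (A \<odot>\<^bsub>fmon P Y\<^esub> B) \<cdot>\<^bsub>fib P X\<^esub> far (pull P h) (sten_l Q Y (A, B))
      \<cdot>\<^bsub>fib P X\<^esub> pten P h (fob (shift (sfib Q Y)) A, B)
      = far (shift (sfib Q X)) (pten P h (A, B))
      \<cdot>\<^bsub>fib P X\<^esub> sten_l Q X (fob (pull P h) A, fob (pull P h) B)
      \<cdot>\<^bsub>fib P X\<^esub> (spull Q h A \<star>\<^bsub>fmon P X\<^esub> Ident (fib P X) (fob (pull P h) B)) \<and>
      spull Q h (A \<odot>\<^bsub>fmon P Y\<^esub> B) \<cdot>\<^bsub>fib P X\<^esub> far (pull P h) (sten_r Q Y (A, B))
      \<cdot>\<^bsub>fib P X\<^esub> pten P h (A, fob (shift (sfib Q Y)) B)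
      = far (shift (sfib Q X)) (pten P h (A, B))
      \<cdot>\<^bsub>fib P X\<^esub> sten_r Q X (fob (pull P h) A, fob (pull P h) B)
      \<cdot>\<^bsub>fib P X\<^esub> (Ident (fib P X) (fob (pull P h) A) \<star>\<^bsub>fmon P X\<^esub> spull Q h B)"
    if "A \<in> Obj (fib P Y)" "B \<in> Obj (fib P Y)" for A B
    using susp_pseudo hb(1) that unfolding suspended_pseudo_def by blast
  then interpret susp_monoidal_adj "fib P Y" "fmon P Y" "fib P X" "fmon P X" "pull P h" "push J h"
    "eta_ps J h" "eps_ps J h" "pten P h" "sfib Q Y" "sten_l Q Y" "sten_r Q Y"
    "sfib Q X" "sten_l Q X" "sten_r Q X" "spull Q h" "spush Q h"
    by (intro susp_monoidal_adj.intro susp_monoidal_adj_axioms.intro monoidal_adj[OF h]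
      susp_pull_push[OF h] susp_fib hb) simp_all
  show ?thesis using slax_lam by (simp add: lambda_lam[OF h])
qed

end

end

text \<open>An instance of \<open>conj_susp\<close>: the isomorphism \<open>a\<close> is suspended
  by assumption, and \<open>counit_susp_comp\<close> makes the composite adjunction a suspended one
  for the composite structures.\<close>

lemma (in pushforward_pair) b_suspended:
  assumes susp_pseudo: "suspended_pseudo P Q" and susp_adjoints: "suspended_adjoints P J Q"
  shows "suspended_transformation (fib P X) (sfib Q X) (fib P Z) (sfib Q Z) (push J gf) (spush Q gf)
    (push J g \<circ>\<^sub>F push J f) (sus_comp (fib P Z) (push J g) (spush Q g) (push J f) (spush Q f)) (b_ar P J g f)"
proof -
  note c = counit_susp_comp[OF susp_pull_push[OF assms g] susp_pull_push[OF assms f]]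
  have a: "suspended_transformation (fib P Z) (sfib Q Z) (fib P X) (sfib Q X)
      (pull P f \<circ>\<^sub>F pull P g) (sus_comp (fib P X) (pull P f) (spull Q f) (pull P g) (spull Q g))
      (pull P gf) (spull Q gf) (pcomp P g f)"
    using susp_pseudo base'_Obj(1)[OF f] base'_Obj(1)[OF g] unfolding suspended_pseudo_def by blast
  interpret sb: susp_conjugate "fib P Z" "sfib Q Z" "fib P X" "sfib Q X"
    "pull P f \<circ>\<^sub>F pull P g" "sus_comp (fib P X) (pull P f) (spull Q f) (pull P g) (spull Q g)"
    "push J g \<circ>\<^sub>F push J f" "sus_comp (fib P Z) (push J g) (spush Q g) (push J f) (spush Q f)"
    eta_comp eps_comp "pull P gf" "spull Q gf" "push J gf" "spush Q gf" "eta_ps J gf" "eps_ps J gf"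
    "pcomp P g f"
    using a unfolding suspended_transformation_def
    by (intro susp_conjugate.intro susp_conjugate_axioms.intro c susp_pull_push[OF assms gf] b.conjugate_axioms)
      blast
  show ?thesis
    using sb.suspended_conj b_nat_iso
    by (auto simp: suspended_transformation_def nat_iso_def b_ar_conj)
qed

lemma (in pushforward_dual) suspended_duality_morphism:
  assumes sp: "suspended_pseudo P Q" and sa: "suspended_adjoints P J Q"
  shows "suspended_duality_morphism (dual_at (fib P X) (fmon P X) L) (sfib Q X) (dual_sus_at P Q X L)
    (dual_at (fib P Z) (fmon P Z) K) (sfib Q Z) (dual_sus_at P Q Z K)
    (dualpair_comp (fib P Z) (push_dual P J gf K) (dual_change (fib P X) (fmon P X) (c_ar P J g f K)))
    (sus_comp (fib P Z) (push J gf) (spush Q gf) id_fun (sus_id (fib P X) (sfib Q X)))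
    (dualpair_comp (fib P Z) (push_dual P J g K) (push_dual P J f (fob (shriek J g) K)))
    (sus_comp (fib P Z) (push J g) (spush Q g) (push J f) (spush Q f)) (b_ar P J g f)"
proof -
  interpret lax_transformation "fib P X" "fmon P X" "fib P Z" "fmon P Z" "push J gf"
    lam_gf "push J g \<circ>\<^sub>F push J f" lam_g_f L K e_gf phi_gf e_g_f phi_g_f "b_ar P J g f"
    by (rule b_transformation)
  let ?t1 = "sus_comp (fib P Z) (push J gf) (spush Q gf) id_fun (sus_id (fib P X) (sfib Q X))"
  let ?t2 = "sus_comp (fib P Z) (push J g) (spush Q g) (push J f) (spush Q f)"
  note smcX = susp_smc.suspended_smc[OF susp_fib[OF sp sa base'_Obj(2)[OF f]]]
  have s1: "slax (fib P X) (fmon P X) (fib P Z) (fmon P Z) (push J gf)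
    lam_gf (sfib Q X) (sten_l Q X) (sten_r Q X) (sfib Q Z) (sten_l Q Z) (sten_r Q Z) ?t1"
    using slax_comp[OF slax_id[OF smcX] slax_push[OF sp sa gf]] by simp
  have s2: "slax (fib P X) (fmon P X) (fib P Z) (fmon P Z) (push J g \<circ>\<^sub>F push J f)
    lam_g_f (sfib Q X) (sten_l Q X) (sten_r Q X) (sfib Q Z) (sten_l Q Z) (sten_r Q Z) ?t2"
    by (rule slax_comp[OF slax_push[OF sp sa f] slax_push[OF sp sa g]])
  have "suspended_transformation (fib P X) (sfib Q X) (fib P Z) (sfib Q Z) (push J gf) ?t1
    (push J g \<circ>\<^sub>F push J f) ?t2 (b_ar P J g f)"
  proof -
    interpret push: sftor "fib P X" "sfib Q X" "fib P Z" "sfib Q Z" "push J gf" "spush Q gf"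
      using b_suspended[OF sp sa] by unfold_locales (simp add: suspended_transformation_def)
    \<comment> \<open>Composition with the suspended identity functor adds only the image of an
      identity arrow, so \<open>b_suspended\<close> applies to \<open>?t1\<close>.\<close>
    have "?t1 A = spush Q gf A" if "A \<in> Obj (fib P X)" for A
      using that by (simp add: sus_comp_def sus_id_def)
    then show ?thesis
      using b_suspended[OF sp sa] sftor.suspended_functor[OF slax.axioms(4)[OF s1]] by (simp add: suspended_transformation_def)
  qed
  moreover note duality_morphism
    slax_dual.suspended_duality_preserving[OF slax_dual.intro[OF F.lax_dual_axioms s1]]
    slax_dual.suspended_duality_preserving[OF slax_dual.intro[OF F'.lax_dual_axioms s2]]
  ultimately show ?thesis
    by (simp add: suspended_duality_morphism_def dualpair_comp_def push_dual_def dual_change_def)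
qed

section \<open>Exactness of push-forwards and the theorem\<close>

lemma (in pushforward) exact_push:
  assumes tp: "triangulated_pseudo P Q \<Delta>" and sa: "suspended_adjoints P J Q" and h: "h \<in> homs (base' P) V W"
  shows "exact_functor (fib P V) (sfib Q V) (\<Delta> V) (fib P W) (sfib Q W) (\<Delta> W) (push J h) (spush Q h)"
proof (rule exact_right_adjoint)
  have sp: "suspended_pseudo P Q" using tp by (simp add: triangulated_pseudo_def)
  show "susp_adj (fib P W) (sfib Q W) (fib P V) (sfib Q V) (pull P h) (spull Q h)
    (push J h) (spush Q h) (eta_ps J h) (eps_ps J h)"
    by (rule susp_pull_push[OF sp sa h])
  show "exact_functor (fib P W) (sfib Q W) (\<Delta> W) (fib P V) (sfib Q V) (\<Delta> V) (pull P h) (spull Q h)"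
    "triangulated_category (fib P W) (sfib Q W) (\<Delta> W)" "triangulated_category (fib P V) (sfib Q V) (\<Delta> V)"
    using tp base'_Obj[OF h] unfolding triangulated_pseudo_def by blast+
qed

theorem theorem5p1p9:
  fixes P :: "('x, 'b, 'o, 'm) pseudo"
    and J :: "('b, 'o, 'm) adjoints"
    and Q :: "('x, 'b, 'o, 'm) suspensions"
    and \<Delta> :: "'x \<Rightarrow> ('m \<times> 'm \<times> 'm) set"
    and X Y Z :: 'x and f g :: 'b and K :: 'o
  assumes "pseudo_functor P" and "associative_pseudo P" and "monoidal_pseudo P"
    and "adjoint_choice P J"
    and "f \<in> homs (base' P) X Y" and "g \<in> homs (base' P) Y Z"
    and "K \<in> Obj (fib P Z)"
  shows
    "let gf = g \<cdot>\<^bsub>base P\<^esub> f;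
         b = b_ar P J g f;
         L = fob (shriek J f) (fob (shriek J g) K);
         W1 = dual_at (fib P X) (fmon P X) L;
         W2 = dual_at (fib P Z) (fmon P Z) K;
         F1 = dualpair_comp (fib P Z) (push_dual P J gf K)
                (dual_change (fib P X) (fmon P X) (c_ar P J g f K));
         F2 = dualpair_comp (fib P Z) (push_dual P J g K) (push_dual P J f (fob (shriek J g) K));
         d1 = dual_sus_at P Q X L;
         d2 = dual_sus_at P Q Z K;
         t1 = sus_comp (fib P Z) (push J gf) (spush Q gf) id_fun (sus_id (fib P X) (sfib Q X));
         t2 = sus_comp (fib P Z) (push J g) (spush Q g) (push J f) (spush Q f)
     in nat_iso (fib P X) (fib P Z) (push J gf) (push J g \<circ>\<^sub>F push J f) b
      \<and> duality_morphism W1 W2 F1 F2 b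
      \<and> (suspended_pseudo P Q \<and> suspended_adjoints P J Q \<longrightarrow>
           suspended_duality_morphism W1 (sfib Q X) d1 W2 (sfib Q Z) d2 F1 t1 F2 t2 b)
      \<and> (triangulated_pseudo P Q \<Delta> \<and> suspended_adjoints P J Q \<longrightarrow>
           triangulated_duality_morphism W1 (sfib Q X) (\<Delta> X) d1 W2 (sfib Q Z) (\<Delta> Z) d2
             F1 t1 F2 t2 b)"
proof -
  interpret pushforward_dual P J X Y Z f g K
    by unfold_locales (rule assms)+
  let ?W1 = "dual_at (fib P X) (fmon P X) L" and ?W2 = "dual_at (fib P Z) (fmon P Z) K"
  let ?F1 = "dualpair_comp (fib P Z) (push_dual P J gf K) (dual_change (fib P X) (fmon P X) (c_ar P J g f K))"
  let ?F2 = "dualpair_comp (fib P Z) (push_dual P J g K) (push_dual P J f (fob (shriek J g) K))"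
  let ?t1 = "sus_comp (fib P Z) (push J gf) (spush Q gf) id_fun (sus_id (fib P X) (sfib Q X))"
  let ?t2 = "sus_comp (fib P Z) (push J g) (spush Q g) (push J f) (spush Q f)"
  have 1: "duality_morphism ?W1 ?W2 ?F1 ?F2 (b_ar P J g f)"
    using lax_transformation.duality_morphism[OF b_transformation]
    by (simp add: dualpair_comp_def push_dual_def dual_change_def)
  \<comment> \<open>Exactness of the dualities belongs to the triangulated structure; that of both
    composite functors follows from \<open>exact_push\<close> for \<open>f\<close>, \<open>g\<close>
    and \<open>gf\<close>. The rest is the suspended case.\<close>
  have 2: "triangulated_duality_morphism ?W1 (sfib Q X) (\<Delta> X) (dual_sus_at P Q X L)
      ?W2 (sfib Q Z) (\<Delta> Z) (dual_sus_at P Q Z K) ?F1 ?t1 ?F2 ?t2 (b_ar P J g f)"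
    if tp: "triangulated_pseudo P Q \<Delta>" and sa: "suspended_adjoints P J Q"
  proof -
    have sp: "suspended_pseudo P Q" using tp by (simp add: triangulated_pseudo_def)
    have tri: "triangulated_category (fib P V) (sfib Q V) (\<Delta> V)"
      and dual: "A \<in> Obj (fib P V) \<Longrightarrow> exact_functor (fib P V) (sfib Q V) (\<Delta> V)
          (op_cat (fib P V)) (op_susp (sfib Q V)) (op_tri (sfib Q V) (\<Delta> V))
          (dual_fun (fib P V) (fmon P V) A) (dual_sus_at P Q V A)"
      if "V \<in> Obj (base P)" for V A
      using tp that unfolding triangulated_pseudo_def by blast+
    note VX = base'_Obj(2)[OF assms(5)] and VZ = base'_Obj(3)[OF assms(6)]
    have L: "L \<in> Obj (fib P X)" using c_homs lax_dual.L[OF lax_dual_gf] by blast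
    note s = suspended_duality_morphism[OF sp sa]
    have "triangulated_with_duality ?W1 (sfib Q X) (\<Delta> X) (dual_sus_at P Q X L)"
      "triangulated_with_duality ?W2 (sfib Q Z) (\<Delta> Z) (dual_sus_at P Q Z K)"
      using s tri[OF VX] tri[OF VZ] dual[OF VX L] dual[OF VZ assms(7)]
      by (simp_all add: triangulated_with_duality_def suspended_duality_morphism_def
          suspended_duality_preserving_def dual_at_def)
    moreover have "exact_functor (fib P X) (sfib Q X) (\<Delta> X) (fib P Z) (sfib Q Z) (\<Delta> Z) (dfun ?F1) ?t1"
      using exact_comp[OF exact_id[OF tri[OF VX]] exact_push[OF tp sa gf] tri[OF VX]]
      by (simp add: dualpair_comp_def push_dual_def dual_change_def)
    moreover have "exact_functor (fib P X) (sfib Q X) (\<Delta> X) (fib P Z) (sfib Q Z) (\<Delta> Z) (dfun ?F2) ?t2"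
      using exact_comp[OF exact_push[OF tp sa assms(5)] exact_push[OF tp sa assms(6)] tri[OF VX]]
      by (simp add: dualpair_comp_def push_dual_def)
    ultimately show ?thesis
      using s by (simp add: triangulated_duality_morphism_def dual_at_def)
  qed
  show ?thesis
    unfolding Let_def using b_nat_iso 1 2 suspended_duality_morphism by blast
qed

end
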